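(* Let $(\Lambda V,d)$ be a 1-connected elliptic minimal Sullivan model over $\mathbb{Q}$ whose differential has homogeneous length, i.e. there is an integer $l\geq 2$ with $d(V)\subset \Lambda^l V$, and whose rational Hurewicz homomorphism is non-zero in some odd degree. Then $\dim_{\mathbb{Q}} H^*(\Lambda V,d)\geq \dim_{\mathbb{Q}} V$.
   Context: For a graded $\mathbb{Q}$-vector space $V$, $\Lambda V$ is the free graded-commutative algebra on $V$, $\Lambda^k V$ is the span of the elements of wordlength $k$, and $\Lambda^{\geq n}V=\bigoplus_{k\geq n}\Lambda^kV$. A minimal Sullivan model is a commutative differential graded algebra $(\Lambda V,d)$ over $\mathbb{Q}$, satisfying the usual Sullivan nilpotence condition, with $dV\subset \Lambda^{\geq 2}V$. It is 1-connected if $V$ is concentrated in degrees $\geq 2$, and elliptic if both $V$ and $H^*(\Lambda V,d)$ are finite dimensional. If $(\Lambda V,d)$ is the minimal model of a 1-connected space $X$, then $H^*(\Lambda V,d)\cong H^*(X,\mathbb{Q})$ and $V\cong \pi_*(X)\otimes\mathbb{Q}$ (as graded vector spaces, up to duality). In terms of the model, the rational Hurewicz homomorphism $\pi_*(X)\otimes\mathbb{Q}\to H_*(X,\mathbb{Q})$ is dual to the map $H^{+}(\Lambda V,d)\to V$ sending the class of a cocycle to its linear part (component in $\Lambda^1V=V$); it is non-zero in degree $k$ if this map is non-zero in degree $k$. Dimensions are total dimensions over all degrees. *)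

theory Defs
  imports Complex_Main
begin

text \<open>
  The type \<open>'a\<close> is the underlying ring of an algebra over the rationals.  A graded subspace is a
  family \<open>V :: nat \<Rightarrow> 'a set\<close> whose member \<open>V i\<close> is the part of degree \<open>i\<close>.
\<close>

locale rat_algebra = vector_space scale
  for scale :: "rat \<Rightarrow> 'a::ring_1 \<Rightarrow> 'a" +
  assumes scale_mult_left: "scale c x * y = scale c (x * y)"
    and scale_mult_right: "x * scale c y = scale c (x * y)"
begin

definition total :: "(nat \<Rightarrow> 'a set) \<Rightarrow> 'a set" where
  "total V = span (\<Union>i. V i)"

definition graded_subspace :: "(nat \<Rightarrow> 'a set) \<Rightarrow> bool" where
  "graded_subspace V \<longleftrightarrow>
     (\<forall>i. subspace (V i)) \<and>
     (\<forall>f. finite {i. f i \<noteq> 0} \<and> (\<forall>i. f i \<in> V i) \<and> (\<Sum>i | f i \<noteq> 0. f i) = 0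
          \<longrightarrow> (\<forall>i. f i = 0))"

definition homogeneous_basis :: "(nat \<Rightarrow> 'a set) \<Rightarrow> 'a set \<Rightarrow> bool" where
  "homogeneous_basis V B \<longleftrightarrow>
     B \<subseteq> (\<Union>i. V i) \<and> independent B \<and> (\<forall>i. V i = span (B \<inter> V i))"

text \<open>
  Words in \<open>B\<close> that are increasing for the order \<open>r\<close>, where a letter may be repeated if and only
  if its degree is even.
\<close>

definition ordered_words :: "(nat \<Rightarrow> 'a set) \<Rightarrow> 'a set \<Rightarrow> 'a rel \<Rightarrow> 'a list set" where
  "ordered_words V B r =
     {xs \<in> lists B.
        sorted_wrt (\<lambda>x y. (x, y) \<in> r \<and> (x = y \<longrightarrow> (\<exists>i. even i \<and> x \<in> V i))) xs}"

text \<open>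
  The ambient algebra is the free graded-commutative algebra on \<open>V\<close>, that is, the tensor product
  of the symmetric algebra on the even part of \<open>V\<close> and the exterior algebra on the odd part: the
  elements of \<open>V\<close> commute up to the Koszul sign, and the ordered monomials in a homogeneous basis
  of \<open>V\<close>, without repeated odd factors, are pairwise distinct and form a basis of the algebra.
\<close>

definition free_graded_commutative :: "(nat \<Rightarrow> 'a set) \<Rightarrow> bool" where
  "free_graded_commutative V \<longleftrightarrow>
     graded_subspace V \<and>
     (\<forall>i j. \<forall>v\<in>V i. \<forall>w\<in>V j. v * w = (- 1) ^ (i * j) * (w * v)) \<and>
     (\<exists>B r. homogeneous_basis V B \<and> linear_order_on B r \<and>
        inj_on prod_list (ordered_words V B r) \<and>
        independent (prod_list ` ordered_words V B r) \<and>
        span (prod_list ` ordered_words V B r) = UNIV)"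

definition generated_subalgebra :: "(nat \<Rightarrow> 'a set) \<Rightarrow> 'a set" where
  "generated_subalgebra V = span {prod_list vs | vs. set vs \<subseteq> total V}"

definition degree_part :: "(nat \<Rightarrow> 'a set) \<Rightarrow> nat \<Rightarrow> 'a set" where
  "degree_part V k =
     span {prod_list vs | vs ns. list_all2 (\<lambda>n v. v \<in> V n) ns vs \<and> sum_list ns = k}"

definition wordlength_part :: "(nat \<Rightarrow> 'a set) \<Rightarrow> nat \<Rightarrow> 'a set" where
  "wordlength_part V k = span {prod_list vs | vs. set vs \<subseteq> total V \<and> length vs = k}"

definition wordlength_ge :: "(nat \<Rightarrow> 'a set) \<Rightarrow> nat \<Rightarrow> 'a set" where
  "wordlength_ge V n = span (\<Union>k\<in>{n..}. wordlength_part V k)"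

definition linear_part :: "(nat \<Rightarrow> 'a set) \<Rightarrow> 'a \<Rightarrow> 'a" where
  "linear_part V x =
     (THE v. v \<in> wordlength_part V 1 \<and> x - v \<in> span (\<Union>k\<in>- {1}. wordlength_part V k))"

definition finite_dim :: "'a set \<Rightarrow> bool" where
  "finite_dim S \<longleftrightarrow> (\<exists>T. finite T \<and> T \<subseteq> S \<and> S \<subseteq> span T)"

text \<open>
  For subspaces \<open>N \<subseteq> M\<close>, a set \<open>S\<close> of representatives of a basis of the quotient space \<open>M / N\<close>,
  and the dimension of this quotient.  As for \<^const>\<open>dim\<close>, infinite dimension gives the value 0.
\<close>

definition quotient_basis :: "'a set \<Rightarrow> 'a set \<Rightarrow> 'a set \<Rightarrow> bool" where
  "quotient_basis M N S \<longleftrightarrow>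
     S \<subseteq> M \<and>
     (\<forall>T c. finite T \<and> T \<subseteq> S \<and> (\<Sum>x\<in>T. scale (c x) x) \<in> N \<longrightarrow> (\<forall>x\<in>T. c x = 0)) \<and>
     (\<forall>x\<in>M. \<exists>y\<in>span S. x - y \<in> N)"

definition finite_dim_quotient :: "'a set \<Rightarrow> 'a set \<Rightarrow> bool" where
  "finite_dim_quotient M N \<longleftrightarrow> (\<exists>S. finite S \<and> quotient_basis M N S)"

definition dim_quotient :: "'a set \<Rightarrow> 'a set \<Rightarrow> nat" where
  "dim_quotient M N = card (SOME S. quotient_basis M N S)"

end

locale sullivan_algebra = rat_algebra scale
  for scale :: "rat \<Rightarrow> 'a::ring_1 \<Rightarrow> 'a" +
  fixes V :: "nat \<Rightarrow> 'a set"
    and d :: "'a \<Rightarrow> 'a"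
  assumes free: "free_graded_commutative V"
    and positive: "V 0 = {0}"
    and d_linear: "Vector_Spaces.linear scale scale d"
    and d_degree: "d ` degree_part V k \<subseteq> degree_part V (Suc k)"
    and d_derivation: "x \<in> degree_part V k \<Longrightarrow> d (x * y) = d x * y + (- 1) ^ k * (x * d y)"
    and d_d: "d (d x) = 0"
    and nilpotence: "\<exists>F :: nat \<Rightarrow> nat \<Rightarrow> 'a set.
          (\<forall>j i. subspace (F j i)) \<and>
          (\<forall>j i. F j i \<subseteq> F (Suc j) i) \<and>
          (\<forall>i. (\<Union>j. F j i) = V i) \<and>
          (\<forall>i. \<forall>v\<in>F 0 i. d v = 0) \<and>
          (\<forall>j i. d ` F (Suc j) i \<subseteq> generated_subalgebra (F j))"
begin

definition cocycles :: "'a set" where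
  "cocycles = {x. d x = 0}"

definition coboundaries :: "'a set" where
  "coboundaries = range d"

definition cohomology_dim :: nat where
  "cohomology_dim = dim_quotient cocycles coboundaries"

definition one_connected :: bool where
  "one_connected \<longleftrightarrow> (\<forall>k<2. V k = {0})"

definition elliptic :: bool where
  "elliptic \<longleftrightarrow> finite_dim (total V) \<and> finite_dim_quotient cocycles coboundaries"

text \<open>
  Non-vanishing in degree \<open>k > 0\<close> of the map from cohomology to \<open>V\<close> that takes the class of a
  cocycle to its linear part; it is dual to the rational Hurewicz homomorphism.
\<close>

definition hurewicz_nonzero :: "nat \<Rightarrow> bool" where
  "hurewicz_nonzero k \<longleftrightarrow>
     k > 0 \<and> (\<exists>z \<in> cocycles \<inter> degree_part V k. linear_part V z \<noteq> 0)"

end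

locale minimal_sullivan_model = sullivan_algebra +
  assumes minimal: "d ` total V \<subseteq> wordlength_ge V 2"

end

theory Submission
  imports Defs "HOL-Library.Multiset" "HOL-Computational_Algebra.Polynomial_FPS"
begin

text \<open>
  As \<open>d\<close> is homogeneous for wordlength, the linear part \<open>y\<close> of a cocycle in the given odd degree is
  a cocycle.  Choose generators \<open>v 0 = y, v 1, \<dots>\<close> of \<open>V\<close>, the later ones in order of degree;
  the ideals \<open>I k = (v 0, \<dots>, v (k - 1))\<close> are stable under \<open>d\<close>.  Multiplication by \<open>v k\<close> yields long
  exact sequences relating the cohomology, bigraded by degree and wordlength, of consecutive quotients
  \<open>A / I k\<close> of \<open>A = \<Lambda>V\<close>.  Descending along them from \<open>A / I N\<close>, the ground field, gives two facts: the
  least degree of a class of wordlength \<open>p\<close> increases strictly with \<open>p\<close>, without gaps, and a class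
  of maximal degree has wordlength at least the number of odd generators.

  Let \<open>n\<close> be the number of odd generators of \<open>V\<close>.  In every wordlength below \<open>n\<close> the quotient
  \<open>A / (y)\<close> then has a class of least degree; it is killed by the connecting map \<open>\<theta>\<close>,
  which lowers degrees and does not lower wordlengths.  So \<open>dim H(A) = dim ker \<theta> + dim coker \<theta> =
  2 dim ker \<theta> \<ge> 2n\<close>.  Finally the even generators are not more numerous than the odd ones:
  \<open>d\<close> preserves the weight \<open>(l - 1) deg - wordlength\<close>, so the quotient of the products of
  \<open>1 - X^u\<close> over the weights \<open>u\<close> of the odd and of the even generators is the Euler characteristic
  of \<open>H(A)\<close>, a polynomial in \<open>X\<close>, and its order at \<open>X = 1\<close> is not negative.
\<close>

section \<open>Independence modulo a subspace\<close>

text \<open>The order of the generators has to serve two purposes. Ideals stable under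
  \<open>d\<close> come from ordering by degree, while the final doubling needs \<open>y\<close> in
  front, whatever its degree; \<open>d y = 0\<close> reconciles the two. Since \<open>y\<close> is
  odd, its annihilator is the ideal \<open>(y)\<close> itself, so the sequence at the first stage is
  \<open>0 -> A/(y) -> A -> A/(y) -> 0\<close>. Sub and quotient are the same complex, the
  connecting map is an endomorphism, and this is the origin of the factor 2. Homogeneous length
  gives \<open>d\<close> the bidegree \<open>(1, l - 1)\<close>, so the connecting map of a
  generator of degree \<open>g\<close> has bidegree \<open>(1 - g, l - 2)\<close>. With
  \<open>g \<ge> 2\<close> and \<open>l \<ge> 2\<close> the degree drops while the wordlength does
  not, so that a class of least degree in its wordlength has no room for a nonzero image; this
  comparison recurs throughout the descent. The descent only records which bidegrees carry a class;
  dimensions enter at the first stage and in the Euler characteristic.\<close>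

locale relative_independence = vector_space scale for scale :: "'k::field \<Rightarrow> 'b::ab_group_add \<Rightarrow> 'b"
begin

text \<open>Quotient spaces are never formed as types. A set with this property represents an
  independent set of the quotient by \<open>N\<close>, and all stages of the tower can be compared
  inside one ambient space.\<close>

definition indep_mod :: "'b set \<Rightarrow> 'b set \<Rightarrow> bool" where
  "indep_mod N L \<longleftrightarrow> independent L \<and> span L \<inter> N \<subseteq> {0}"

text \<open>\<open>F\<close> need not lie in \<open>M\<close>, so a spanning set for
  \<open>M\<close> also serves every smaller space.\<close>

definition spans_mod :: "'b set \<Rightarrow> 'b set \<Rightarrow> 'b set \<Rightarrow> bool" where
  "spans_mod N M F \<longleftrightarrow> (\<forall>x\<in>M. \<exists>y\<in>span F. x - y \<in> N)"

text \<open>Killing a basis of \<open>N\<close> and fixing a complementary basis gives an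
  endomorphism with kernel \<open>N\<close>. It stands in for the quotient map and carries the usual
  bound on independent sets over to independence modulo \<open>N\<close>.\<close>

lemma quotient_map_exists:
  assumes "subspace N"
  obtains \<pi> where "Vector_Spaces.linear scale scale \<pi>" "\<And>x. \<pi> x = 0 \<longleftrightarrow> x \<in> N"
proof -
  interpret vp: vector_space_pair scale scale ..
  obtain C where C: "C \<subseteq> N" "independent C" "N \<subseteq> span C" using basis_exists[of N] by metis
  have N: "span C = N" using C assms span_minimal by blast
  define B where "B = extend_basis C"
  have B: "C \<subseteq> B" "independent B" "span B = UNIV"
    unfolding B_def using extend_basis_superset independent_extend_basis span_extend_basis C(2) by auto
  define \<pi> where "\<pi> = vp.construct B (\<lambda>b. if b \<in> C then 0 else b)"
  have lin: "Vector_Spaces.linear scale scale \<pi>" unfolding \<pi>_def using B(2) by (rule vp.linear_construct)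
  interpret \<pi>: Vector_Spaces.linear scale scale \<pi> by (rule lin)
  have on_B: "\<pi> b = (if b \<in> C then 0 else b)" if "b \<in> B" for b
    unfolding \<pi>_def by (rule vp.construct_basis[OF B(2) that])
  have on_C: "\<pi> x = 0" if "x \<in> span C" for x
    using that by (induction rule: span_induct_alt) (use on_B B(1) in \<open>auto simp: \<pi>.add \<pi>.scale\<close>)
  have on_rest: "\<pi> x = x" if "x \<in> span (B - C)" for x
    using that by (induction rule: span_induct_alt) (use on_B in \<open>auto simp: \<pi>.add \<pi>.scale\<close>)
  have "x \<in> N" if "\<pi> x = 0" for x
  proof -
    have "x \<in> span (C \<union> (B - C))" using B by (simp add: Un_absorb1)
    then obtain a b where ab: "a \<in> span C" "b \<in> span (B - C)" "x = a + b"
      unfolding span_Un by blast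
    then have "b = 0" using that on_C[of a] on_rest[of b] by (simp add: \<pi>.add)
    then show ?thesis using ab N by simp
  qed
  then show ?thesis using that lin on_C N by blast
qed

lemma indep_mod_card_le:
  assumes "subspace N" "finite F" "spans_mod N M F" "L \<subseteq> M" "indep_mod N L"
  shows "finite L \<and> card L \<le> card F"
proof -
  interpret vp: vector_space_pair scale scale ..
  obtain \<pi> where \<pi>: "Vector_Spaces.linear scale scale \<pi>" "\<And>x. \<pi> x = 0 \<longleftrightarrow> x \<in> N"
    using quotient_map_exists[OF assms(1)] by blast
  interpret \<pi>: Vector_Spaces.linear scale scale \<pi> by (rule \<pi>(1))
  have inj: "inj_on \<pi> (span L)"
  proof (rule inj_onI)
    fix x y assume xy: "x \<in> span L" "y \<in> span L" "\<pi> x = \<pi> y"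
    then have "x - y \<in> span L" "\<pi> (x - y) = 0" by (auto simp: span_diff \<pi>.diff)
    then have "x - y \<in> {0}" using assms(5) \<pi>(2) unfolding indep_mod_def by blast
    then show "x = y" by simp
  qed
  have "independent (\<pi> ` L)"
    using vp.linear_independent_injective_image[OF \<pi>(1) _ inj] assms(5) unfolding indep_mod_def by blast
  moreover have "\<pi> ` L \<subseteq> span (\<pi> ` F)"
  proof
    fix z assume "z \<in> \<pi> ` L"
    then obtain x where x: "x \<in> L" "z = \<pi> x" by blast
    then obtain y where y: "y \<in> span F" "x - y \<in> N" using assms(3,4) unfolding spans_mod_def by blast
    then have "\<pi> (x - y) = 0" using \<pi>(2) by blast
    then have "z = \<pi> y" using x by (simp add: \<pi>.diff)
    then show "z \<in> span (\<pi> ` F)" using y(1) vp.linear_span_image[OF \<pi>(1)] by blast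
  qed
  ultimately have *: "finite (\<pi> ` L)" "card (\<pi> ` L) \<le> card (\<pi> ` F)"
    using independent_span_bound[OF finite_imageI[OF assms(2)]] by blast+
  have i: "inj_on \<pi> L" using inj_on_subset[OF inj span_superset] .
  show ?thesis using * card_image[OF i] finite_imageD[OF _ i] card_image_le[OF assms(2), of \<pi>] by auto
qed

lemma indep_mod_insert:
  assumes "subspace N" "indep_mod N L" "\<And>y. y \<in> span L \<Longrightarrow> x - y \<notin> N"
  shows "indep_mod N (insert x L)" "x \<notin> L"
proof -
  have x: "x \<notin> span L" using assms(3)[of x] subspace_0[OF assms(1)] by auto
  then show "x \<notin> L" using span_base by blast
  have "z = 0" if z: "z \<in> span (insert x L)" "z \<in> N" for z
  proof -
    obtain c where c: "z - scale c x \<in> span L" using z(1) unfolding span_insert by blast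
    have "c = 0"
    proof (rule ccontr)
      assume "c \<noteq> 0"
      define y where "y = - scale (inverse c) (z - scale c x)"
      have "x - y = scale (inverse c) z" unfolding y_def using \<open>c \<noteq> 0\<close> by (simp add: scale_right_diff_distrib)
      then have "x - y \<in> N" using subspace_scale[OF assms(1) z(2)] by simp
      moreover have "y \<in> span L" unfolding y_def using c span_neg span_scale by blast
      ultimately show False using assms(3) by blast
    qed
    then show ?thesis using c z(2) assms(2) unfolding indep_mod_def by auto
  qed
  then show "indep_mod N (insert x L)" using x assms(2) unfolding indep_mod_def
    by (auto simp: independent_insert)
qed

text \<open>Independent sets modulo \<open>N\<close> have at most \<open>card F\<close> elements, so
  one of largest size exists; an element of \<open>M\<close> outside its span modulo
  \<open>N\<close> could be added to it.\<close>

lemma indep_mod_maximal: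
  assumes N: "subspace N" and F: "finite F" "spans_mod N M F"
  obtains L where "L \<subseteq> M" "finite L" "indep_mod N L" "spans_mod N M L"
proof -
  let ?P = "\<lambda>n. \<exists>L. L \<subseteq> M \<and> finite L \<and> indep_mod N L \<and> card L = n"
  have "?P 0" unfolding indep_mod_def by (intro exI[of _ "{}"]) (auto simp: independent_empty)
  moreover have "n \<le> card F" if "?P n" for n using that indep_mod_card_le[OF N F] by blast
  ultimately have "?P (Greatest ?P)" "\<And>m. ?P m \<Longrightarrow> m \<le> Greatest ?P"
    using GreatestI_nat[of ?P 0 "card F"] Greatest_le_nat[of ?P _ "card F"] by blast+
  then obtain n where n: "?P n" "\<And>m. ?P m \<Longrightarrow> m \<le> n" by blast
  from n(1) obtain L where L: "L \<subseteq> M" "finite L" "indep_mod N L" "card L = n" by blast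
  have "\<exists>y\<in>span L. x - y \<in> N" if "x \<in> M" for x
  proof (rule ccontr)
    assume "\<not> ?thesis"
    then have "indep_mod N (insert x L)" "x \<notin> L" using indep_mod_insert[OF N L(3)] by blast+
    then have "?P (Suc n)" using L that by (intro exI[of _ "insert x L"]) auto
    then show False using n(2) by fastforce
  qed
  then show ?thesis using that L unfolding spans_mod_def by blast
qed

text \<open>Gluing along a two-step filtration: a relation is first read modulo the larger space
  \<open>N'\<close>, where \<open>G\<close> disappears and \<open>K\<close> is independent, and what
  remains is a relation of \<open>G\<close> modulo \<open>N\<close>.\<close>

lemma indep_mod_Un:
  assumes "indep_mod N' K" "finite K" "indep_mod N G" "span G \<subseteq> N'" "N \<subseteq> N'" "subspace N'"
  shows "indep_mod N (K \<union> G)" "K \<inter> G = {}"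
proof -
  have K: "independent K" "span K \<inter> N' \<subseteq> {0}" and G: "independent G" "span G \<inter> N \<subseteq> {0}"
    using assms unfolding indep_mod_def by auto
  have "0 \<notin> K" using K(1) dependent_zero by blast
  moreover have "K \<inter> G \<subseteq> {0}" using K(2) assms(4) span_base by blast
  ultimately show "K \<inter> G = {}" by blast
  have "independent (K \<union> G)"
    using assms(2) K
  proof (induction K)
    case (insert k K)
    have sub: "span K \<subseteq> span (insert k K)" by (rule span_mono) auto
    have ind: "independent K" "k \<notin> span K" using insert.prems(1) insert.hyps(2)
      by (auto simp: independent_insert)
    have "k \<notin> span (K \<union> G)"
    proof
      assume "k \<in> span (K \<union> G)"
      then obtain a b where ab: "a \<in> span K" "b \<in> span G" "k = a + b" unfolding span_Un by blast
      have "k - a \<in> span (insert k K)" using ab(1) sub by (intro span_diff) (auto intro: span_base)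
      moreover have "k - a \<in> N'" using ab assms(4) by auto
      ultimately have "k - a = 0" using insert.prems(2) by blast
      then show False using ab(1) ind(2) by simp
    qed
    moreover have "independent (K \<union> G)" using insert ind(1) sub by blast
    ultimately show ?case by (simp add: independent_insert)
  qed (use G in auto)
  moreover have "x = 0" if x: "x \<in> span (K \<union> G)" "x \<in> N" for x
  proof -
    obtain a b where ab: "a \<in> span K" "b \<in> span G" "x = a + b" using x(1) unfolding span_Un by blast
    have "a = x - b" using ab by simp
    moreover have "x \<in> N'" "b \<in> N'" using x(2) ab(2) assms(4,5) by auto
    ultimately have "a \<in> N'" using subspace_diff[OF assms(6)] by blast
    then have "a = 0" using K(2) ab(1) by blast
    then show ?thesis using ab x(2) G(2) by auto
  qed
  ultimately show "indep_mod N (K \<union> G)" unfolding indep_mod_def by blast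
qed

lemma indep_mod_image:
  assumes "Vector_Spaces.linear scale scale f" "indep_mod R G"
    and "\<And>x. x \<in> span G \<Longrightarrow> f x \<in> N \<Longrightarrow> x \<in> R" "0 \<in> N"
  shows "indep_mod N (f ` G)" "inj_on f G"
proof -
  interpret vp: vector_space_pair scale scale ..
  interpret f: Vector_Spaces.linear scale scale f by (rule assms(1))
  have ker: "x = 0" if "x \<in> span G" "f x \<in> N" for x
    using assms(2,3) that unfolding indep_mod_def by blast
  have inj: "inj_on f (span G)"
  proof (rule inj_onI)
    fix x y assume "x \<in> span G" "y \<in> span G" "f x = f y"
    then have "x - y = 0" using ker[of "x - y"] assms(4) by (simp add: span_diff f.diff)
    then show "x = y" by simp
  qed
  then show "inj_on f G" using inj_on_subset span_superset by blast
  have "independent (f ` G)"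
    using vp.linear_independent_injective_image[OF assms(1) _ inj] assms(2) unfolding indep_mod_def by blast
  moreover have "span (f ` G) \<inter> N \<subseteq> {0}"
  proof
    fix y assume "y \<in> span (f ` G) \<inter> N"
    then have "y \<in> f ` span G" "y \<in> N" using vp.linear_span_image[OF assms(1), of G] by auto
    then obtain x where "x \<in> span G" "y = f x" "f x \<in> N" by auto
    then show "y \<in> {0}" using ker[of x] f.zero by simp
  qed
  ultimately show "indep_mod N (f ` G)" unfolding indep_mod_def by blast
qed

lemma subspace_plus: "subspace {x. \<exists>a\<in>A. x - a \<in> B}" if "subspace A" "subspace B"
proof (rule subspaceI)
  show "0 \<in> {x. \<exists>a\<in>A. x - a \<in> B}" using that subspace_0 by (auto intro!: bexI[of _ 0])
next
  fix x y assume "x \<in> {x. \<exists>a\<in>A. x - a \<in> B}" "y \<in> {x. \<exists>a\<in>A. x - a \<in> B}"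
  then obtain a b where ab: "a \<in> A" "x - a \<in> B" "b \<in> A" "y - b \<in> B" by blast
  then have "a + b \<in> A" "(x - a) + (y - b) \<in> B" using that subspace_add by blast+
  then show "x + y \<in> {x. \<exists>a\<in>A. x - a \<in> B}" by (auto intro!: bexI[of _ "a + b"] simp: algebra_simps)
next
  fix c x assume "x \<in> {x. \<exists>a\<in>A. x - a \<in> B}"
  then obtain a where a: "a \<in> A" "x - a \<in> B" by blast
  then have "scale c a \<in> A" "scale c (x - a) \<in> B" using that subspace_scale by blast+
  then show "scale c x \<in> {x. \<exists>a\<in>A. x - a \<in> B}"
    by (auto intro!: bexI[of _ "scale c a"] simp: scale_right_diff_distrib)
qed

end

section \<open>Long exact sequences along a tower of quotients\<close>

text \<open>\<open>Hn k i p\<close> stands for a nonzero class of degree \<open>i\<close> and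
  wordlength \<open>p\<close> in the cohomology of \<open>A / I k\<close>, and \<open>r\<close> for
  \<open>l - 1\<close>. The assumptions \<open>les1\<close>, \<open>les2\<close>,
  \<open>les3\<close> express exactness at the quotient, the middle and the sub term. The sub term
  is \<open>A / I (Suc k)\<close> for an odd generator, whose annihilator modulo \<open>I k\<close>
  is generated by itself, and \<open>A / I k\<close> for an even one, which is not a zero
  divisor.\<close>

locale exact_tower =
  fixes Hn :: "nat \<Rightarrow> int \<Rightarrow> int \<Rightarrow> bool" and g :: "nat \<Rightarrow> nat" and N :: nat and r D :: int
  assumes les1: "k < N \<Longrightarrow> Hn (Suc k) i p \<Longrightarrow>
      Hn k i p \<or> Hn (if odd (g k) then Suc k else k) (i + 1 - int (g k)) (p + r - 1)"
    and les2: "k < N \<Longrightarrow> Hn k i p \<Longrightarrow>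
      Hn (Suc k) i p \<or> Hn (if odd (g k) then Suc k else k) (i - int (g k)) (p - 1)"
    and les3: "k < N \<Longrightarrow> Hn (if odd (g k) then Suc k else k) i p \<Longrightarrow>
      Hn k (i + int (g k)) (p + 1) \<or> Hn (Suc k) (i + int (g k) - 1) (p + 1 - r)"
    and last: "Hn N i p \<longleftrightarrow> i = 0 \<and> p = 0"
    and range: "Hn k i p \<Longrightarrow> 0 \<le> i \<and> 0 \<le> p \<and> i \<le> D * p"
    and g2: "k < N \<Longrightarrow> 2 \<le> g k"
    and r1: "1 \<le> r"
begin

section \<open>Least degrees in each wordlength\<close>

definition decr :: "nat \<Rightarrow> bool" where
  "decr k \<longleftrightarrow> (\<forall>i p. Hn k i p \<and> 1 \<le> p \<longrightarrow> (\<exists>j<i. Hn k j (p - 1)))"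

lemma decr_le:
  assumes "decr k" "Hn k i p" "0 \<le> q" "q \<le> p"
  shows "\<exists>j\<le>i. Hn k j q"
  using assms(2-4)
proof (induction "nat (p - q)" arbitrary: i p)
  case 0
  then have "p = q" by auto
  with 0 show ?case by auto
next
  case (Suc n)
  then have "1 \<le> p" by auto
  with Suc.prems(1) assms(1) obtain j where j: "j < i" "Hn k j (p - 1)" unfolding decr_def by blast
  have "n = nat (p - 1 - q)" "q \<le> p - 1" using Suc.hyps(2) by auto
  then obtain j' where "j' \<le> j" "Hn k j' q"
    using Suc.hyps(1)[OF _ j(2) Suc.prems(2)] by auto
  with j(1) show ?case by (intro exI[of _ j']) auto
qed

lemma least_degree:
  assumes "Hn k i p"
  obtains j where "j \<le> i" "Hn k j p" "\<And>j'. Hn k j' p \<Longrightarrow> j \<le> j'"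
proof -
  define n where "n = (LEAST n. Hn k (int n) p)"
  define P where "P n = Hn k (int n) p" for n
  have "int (nat i) = i" using range[OF assms] by simp
  then have *: "P (nat i)" using assms unfolding P_def by simp
  have "Hn k (int n) p" "n \<le> nat i"
    using LeastI[of P, OF *] Least_le[of P, OF *] unfolding n_def P_def by auto
  moreover have "int n \<le> j'" if "Hn k j' p" for j'
  proof -
    have "int (nat j') = j'" using range[OF that] by simp
    then have "Hn k (int (nat j')) p" using that by simp
    then have "n \<le> nat j'" unfolding n_def by (rule Least_le)
    then show ?thesis using range[OF that] by linarith
  qed
  ultimately show ?thesis using that[of "int n"] range[OF assms] by auto
qed

text \<open>A nonzero connecting image would have degree below \<open>j\<close> and wordlength at
  least \<open>p\<close>; \<open>decr_le\<close> would turn it into a class of wordlength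
  \<open>p\<close> and degree below \<open>j\<close>, against the minimality of
  \<open>j\<close>.\<close>

lemma least_degree_lifts:
  assumes "k < N" "odd (g k)" "decr (Suc k)" "\<And>j'. Hn (Suc k) j' p \<Longrightarrow> j \<le> j'" "0 \<le> p"
  shows "\<not> Hn (Suc k) (j + 1 - int (g k)) (p + r - 1)"
proof
  assume "Hn (Suc k) (j + 1 - int (g k)) (p + r - 1)"
  then obtain j' where "j' \<le> j + 1 - int (g k)" "Hn (Suc k) j' p"
    using decr_le[OF assms(3)] assms(5) r1 by (metis add_diff_eq le_add_same_cancel1 diff_ge_0_iff_ge)
  then show False using assms(4)[of j'] g2[OF assms(1)] by auto
qed

text \<open>A class of wordlength \<open>p - 1\<close> and degree below \<open>i\<close> is found in
  the quotient, either under the image of the given class or by division by the odd generator. The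
  class of least degree in that wordlength then lifts.\<close>

lemma decr_step_odd:
  assumes k: "k < N" and "odd (g k)" and D: "decr (Suc k)"
  shows "decr k"
  unfolding decr_def
proof (intro allI impI, elim conjE)
  fix i p assume h: "Hn k i p" and p: "1 \<le> p"
  have "\<exists>j<i. Hn (Suc k) j (p - 1)"
    using les2[OF k h]
  proof
    assume "Hn (Suc k) i p"
    then show ?thesis using D p unfolding decr_def by blast
  next
    assume "Hn (if odd (g k) then Suc k else k) (i - int (g k)) (p - 1)"
    then show ?thesis using assms(2) g2[OF k] by (intro exI[of _ "i - int (g k)"]) auto
  qed
  then obtain j0 where j0: "j0 < i" "Hn (Suc k) j0 (p - 1)" by blast
  obtain j where j: "j \<le> j0" "Hn (Suc k) j (p - 1)"
     "\<And>j'. Hn (Suc k) j' (p - 1) \<Longrightarrow> j \<le> j'"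
    using least_degree[OF j0(2)] by blast
  have "\<not> Hn (Suc k) (j + 1 - int (g k)) (p - 1 + r - 1)"
    by (rule least_degree_lifts[OF k assms(2) D j(3)]) (use p in auto)
  then have "Hn k j (p - 1)" using les1[OF k j(2)] assms(2) by auto
  then show "\<exists>j<i. Hn k j (p - 1)" using j(1) j0(1) by (intro exI[of _ j]) auto
qed

text \<open>For an even generator, division and the connecting map both land in stage
  \<open>k\<close> itself, about which nothing is known yet; induction on the degree supplies the
  missing information.\<close>

lemma decr_step_even:
  assumes k: "k < N" and "even (g k)" and D: "decr (Suc k)"
  shows "decr k"
proof -
  have "\<exists>j<i. Hn k j (p - 1)" if "Hn k i p" "1 \<le> p" for i p
    using that
  proof (induction "nat i" arbitrary: i p rule: less_induct)
    case less
    \<comment> \<open>From any degree below \<open>i\<close>, the induction hypothesis can be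
      iterated to lower the wordlength to \<open>q\<close>, as it only meets smaller
      degrees.\<close>
    have below: "\<exists>j'\<le>j. Hn k j' q" if "Hn k j p'" "j < i" "0 \<le> q" "q \<le> p'" for j p' q
      using that
    proof (induction "nat (p' - q)" arbitrary: j p')
      case 0
      then have "p' = q" by auto
      with 0 show ?case by auto
    next
      case (Suc n)
      have "nat j < nat i" using Suc.prems(2) range[OF Suc.prems(1)] by auto
      moreover have "1 \<le> p'" using Suc.hyps(2) Suc.prems by auto
      ultimately obtain j1 where j1: "j1 < j" "Hn k j1 (p' - 1)"
        using less.hyps[OF _ Suc.prems(1)] by blast
      have "n = nat (p' - 1 - q)" "q \<le> p' - 1" "j1 < i" using Suc.hyps(2) Suc.prems(2) j1(1) by auto
      then obtain j' where "j' \<le> j1" "Hn k j' q"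
        using Suc.hyps(1)[OF _ j1(2) _ Suc.prems(3)] by auto
      with j1(1) show ?case by (intro exI[of _ j']) auto
    qed
    from les2[OF k less.prems(1)] show ?case
    proof
      assume "Hn (if odd (g k) then Suc k else k) (i - int (g k)) (p - 1)"
      then show ?thesis using assms(2) g2[OF k] by (intro exI[of _ "i - int (g k)"]) auto
    next
      assume "Hn (Suc k) i p"
      then obtain j where j: "j < i" "Hn (Suc k) j (p - 1)"
        using D less.prems(2) unfolding decr_def by blast
      from les1[OF k j(2)] show ?thesis
      proof
        assume "Hn k j (p - 1)"
        with j(1) show ?thesis by blast
      next
        assume "Hn (if odd (g k) then Suc k else k) (j + 1 - int (g k)) (p - 1 + r - 1)"
        then have "Hn k (j + 1 - int (g k)) (p - 1 + r - 1)" using assms(2) by simp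
        from below[OF this, of "p - 1"] obtain j' where
          "j' \<le> j + 1 - int (g k)" "Hn k j' (p - 1)"
          using j(1) g2[OF k] r1 less.prems(2) by auto
        then show ?thesis using j(1) g2[OF k] by (intro exI[of _ j']) auto
      qed
    qed
  qed
  then show ?thesis unfolding decr_def by blast
qed

lemma decr: "k \<le> N \<Longrightarrow> decr k"
proof (induction rule: inc_induct)
  case base
  show ?case unfolding decr_def using last by auto
next
  case (step k)
  then show ?case using decr_step_odd decr_step_even by blast
qed

text \<open>The unit class lifts, because its connecting image would have the negative degree
  \<open>1 - g k\<close>.\<close>

lemma zero_class: "k \<le> N \<Longrightarrow> Hn k 0 0"
proof (induction rule: inc_induct)
  case base
  show ?case using last by auto
next
  case (step k)
  then show ?case using les1[of k 0 0] range[of _ "0 + 1 - int (g k)"] g2[of k] by fastforce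
qed

section \<open>Classes of maximal degree and their wordlength\<close>

definition bounded :: "nat \<Rightarrow> bool" where
  "bounded k \<longleftrightarrow> (\<exists>M. \<forall>i p. Hn k i p \<longrightarrow> p \<le> M)"

text \<open>A class either lifts to stage \<open>k\<close> or has a connecting image of smaller
  degree and no smaller wordlength. For an even generator that image lies in stage \<open>k\<close>;
  for an odd one it lies in stage \<open>Suc k\<close> again, whence the induction on the
  degree.\<close>

lemma bounded_step:
  assumes k: "k < N" and B: "bounded k"
  shows "bounded (Suc k)"
proof -
  from B obtain M where M: "\<And>i p. Hn k i p \<Longrightarrow> p \<le> M" unfolding bounded_def by blast
  have "p \<le> M" if "Hn (Suc k) i p" for i p
    using that
  proof (induction "nat i" arbitrary: i p rule: less_induct)
    case less
    from les1[OF k less.prems] show ?case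
    proof
      assume *: "Hn (if odd (g k) then Suc k else k) (i + 1 - int (g k)) (p + r - 1)"
      show ?thesis
      proof (cases "odd (g k)")
        case True
        with * have h: "Hn (Suc k) (i + 1 - int (g k)) (p + r - 1)" by simp
        have "p + r - 1 \<le> M"
          by (rule less.hyps[OF _ h]) (use range[OF h] range[OF less.prems] g2[OF k] in auto)
        then show ?thesis using r1 by auto
      next
        case False
        with * have "p + r - 1 \<le> M" using M by auto
        then show ?thesis using r1 by auto
      qed
    qed (use M in auto)
  qed
  then show ?thesis unfolding bounded_def by blast
qed

text \<open>Only the degree is required to be maximal. The wordlength is left free, and the bound of
  \<open>top_wordlength\<close> holds for each class of this kind.\<close>

definition top_class :: "nat \<Rightarrow> int \<Rightarrow> int \<Rightarrow> bool" where
  "top_class k i p \<longleftrightarrow> Hn k i p \<and> (\<forall>i' p'. Hn k i' p' \<longrightarrow> i' \<le> i)"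

lemma top_class_exists:
  assumes "bounded k" "k \<le> N"
  obtains i p where "top_class k i p"
proof -
  from assms obtain M where M: "\<And>i p. Hn k i p \<Longrightarrow> p \<le> M" unfolding bounded_def by blast
  let ?S = "{i. \<exists>p. Hn k i p}"
  have "?S \<subseteq> {0..\<bar>D\<bar> * \<bar>M\<bar>}"
  proof
    fix i assume "i \<in> ?S"
    then obtain p where p: "Hn k i p" by blast
    have "D * p \<le> \<bar>D\<bar> * \<bar>M\<bar>" using M[OF p] range[OF p]
      by (meson abs_ge_self abs_ge_zero dual_order.trans mult_mono)
    then show "i \<in> {0..\<bar>D\<bar> * \<bar>M\<bar>}" using range[OF p] by auto
  qed
  then have fin: "finite ?S" using finite_subset by blast
  moreover have ne: "?S \<noteq> {}" using zero_class[OF assms(2)] by blast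
  ultimately have "Max ?S \<in> ?S" by (rule Max_in)
  then obtain p where "Hn k (Max ?S) p" by blast
  then have "top_class k (Max ?S) p" unfolding top_class_def using fin by (auto intro: Max_ge)
  then show ?thesis using that by blast
qed

text \<open>The product of a top class with the generator exceeds the maximal degree and vanishes,
  so the class is a connecting image. By \<open>les1\<close> its preimage has the largest degree in
  the quotient.\<close>

lemma top_step_even:
  assumes k: "k < N" and ev: "even (g k)" and t: "top_class k i p"
  shows "top_class (Suc k) (i + int (g k) - 1) (p + 1 - r)"
  unfolding top_class_def
proof (intro conjI allI impI)
  have "\<not> Hn k (i + int (g k)) (p + 1)" using t g2[OF k] unfolding top_class_def by force
  then show "Hn (Suc k) (i + int (g k) - 1) (p + 1 - r)"
    using les3[OF k, of i p] t ev unfolding top_class_def by auto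
next
  fix i' p' assume "Hn (Suc k) i' p'"
  from les1[OF k this] have "i' \<le> i \<or> i' + 1 - int (g k) \<le> i"
    using t ev unfolding top_class_def by auto
  then show "i' \<le> i + int (g k) - 1" using g2[OF k] by auto
qed

text \<open>Take a top class of the quotient. Its product with the generator survives, since
  otherwise it would be the connecting image of a class above the top degree. Hence the top degree
  of stage \<open>k\<close> exceeds that of the quotient by at least \<open>g k\<close>, so the
  given class dies in the quotient and is divisible by the generator.\<close>

lemma top_step_odd:
  assumes k: "k < N" and od: "odd (g k)" and t: "top_class k i p" and B: "bounded (Suc k)"
  shows "top_class (Suc k) (i - int (g k)) (p - 1)"
proof -
  obtain i' p' where t': "top_class (Suc k) i' p'" using top_class_exists[OF B] k by auto
  have "\<not> Hn (Suc k) (i' + int (g k) - 1) (p' + 1 - r)"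
    using t' g2[OF k] unfolding top_class_def by force
  then have "Hn k (i' + int (g k)) (p' + 1)"
    using les3[OF k, of i' p'] t' od unfolding top_class_def by auto
  then have le: "i' + int (g k) \<le> i" using t unfolding top_class_def by auto
  then have "\<not> Hn (Suc k) i p" using t' g2[OF k] unfolding top_class_def by force
  then have "Hn (Suc k) (i - int (g k)) (p - 1)"
    using les2[OF k, of i p] t od unfolding top_class_def by auto
  then show ?thesis using t' le unfolding top_class_def by (metis le_diff_eq order_trans)
qed

text \<open>Along the tower the wordlength of a top class falls by 1 at an odd generator and by
  \<open>r - 1 \<ge> 0\<close> at an even one; it ends at 0, in the ground field.\<close>

lemma top_wordlength:
  assumes "k \<le> N" "bounded k" "top_class k i p"
  shows "int (card {j \<in> {k..<N}. odd (g j)}) \<le> p"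
  using assms
proof (induction arbitrary: i p rule: inc_induct)
  case base
  then show ?case using last unfolding top_class_def by auto
next
  case (step k)
  have B: "bounded (Suc k)" using bounded_step step by auto
  have S: "{j \<in> {k..<N}. odd (g j)} =
     (if odd (g k) then insert k {j \<in> {Suc k..<N}. odd (g j)} else {j \<in> {Suc k..<N}. odd (g j)})"
    using step(2) by (auto simp: Suc_le_eq) (metis le_neq_implies_less)+
  show ?case
  proof (cases "odd (g k)")
    case True
    from step.IH[OF B top_step_odd[OF step(2) True step(5) B]] show ?thesis
      unfolding S using True by simp
  next
    case False
    then have "even (g k)" by simp
    from step.IH[OF B top_step_even[OF step(2) this step(5)]] show ?thesis
      unfolding S using False r1 by simp
  qed
qed

text \<open>The first generator is itself odd, so stage 1 retains one odd generator less than the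
  total. Its top class still has wordlength at least \<open>q\<close>, and \<open>decr\<close> then
  provides a class of wordlength exactly \<open>q\<close>.\<close>

lemma liftable_classes:
  assumes "0 < N" "odd (g 0)" "bounded 0" "q < card {j \<in> {..<N}. odd (g j)}"
  shows "\<exists>j. Hn 1 j (int q) \<and> \<not> Hn 1 (j + 1 - int (g 0)) (int q + r - 1)"
proof -
  have B: "bounded 1" using bounded_step assms by auto
  obtain i p where t: "top_class 1 i p" using top_class_exists[OF B] assms(1) by auto
  define T where "T = {j \<in> {1..<N}. odd (g j)}"
  have "finite T" "0 \<notin> T" unfolding T_def by auto
  moreover have S: "{j \<in> {..<N}. odd (g j)} = insert 0 T"
    using assms(1,2) unfolding T_def by (auto simp: Suc_le_eq)
  ultimately have "q \<le> card T" using assms(4) unfolding S by simp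
  moreover have "int (card T) \<le> p" unfolding T_def using top_wordlength[OF _ B t] assms(1) by simp
  ultimately have "int q \<le> p" by simp
  then obtain i1 where "Hn 1 i1 (int q)"
    using decr_le[OF decr, of 1 i p "int q"] t assms(1) unfolding top_class_def by auto
  from least_degree[OF this] obtain j where j: "Hn 1 j (int q)"
      "\<And>j'. Hn 1 j' (int q) \<Longrightarrow> j \<le> j'" by blast
  have "\<not> Hn (Suc 0) (j + 1 - int (g 0)) (int q + r - 1)"
    by (rule least_degree_lifts) (use assms j decr in auto)
  then show ?thesis using j by auto
qed

end

text \<open>
  A complex with differential \<open>d\<close>, its components \<open>pr i p\<close> of degree \<open>i\<close> and wordlength \<open>p\<close>, and
  subcomplexes \<open>I k\<close>.  Multiplication by the \<open>k\<close>-th generator is \<open>\<mu> k\<close>; it induces a short exact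
  sequence \<open>0 \<rightarrow> A / J k \<rightarrow> A / I k \<rightarrow> A / I (Suc k) \<rightarrow> 0\<close>.  Integer gradings avoid
  side conditions on subtraction.
\<close>

locale ideal_tower = relative_independence scale
  for scale :: "'k::field \<Rightarrow> 'a::ab_group_add \<Rightarrow> 'a" +
  fixes d :: "'a \<Rightarrow> 'a" and pr :: "int \<Rightarrow> int \<Rightarrow> 'a \<Rightarrow> 'a"
    and I :: "nat \<Rightarrow> 'a set" and \<mu> :: "nat \<Rightarrow> 'a \<Rightarrow> 'a"
    and g :: "nat \<Rightarrow> nat" and N :: nat and r D :: int and e :: 'a
  assumes d_lin: "Vector_Spaces.linear scale scale d"
    and \<mu>_lin: "k < N \<Longrightarrow> Vector_Spaces.linear scale scale (\<mu> k)"
    and pr_lin: "Vector_Spaces.linear scale scale (pr i p)"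
    and dd: "d (d x) = 0"
    and I_sub: "subspace (I k)"
    and d_I: "k \<le> N \<Longrightarrow> x \<in> I k \<Longrightarrow> d x \<in> I k"
    and pr_I: "k \<le> N \<Longrightarrow> x \<in> I k \<Longrightarrow> pr i p x \<in> I k"
    and pr_d: "pr i p (d x) = d (pr (i - 1) (p - r) x)"
    and pr_\<mu>: "k < N \<Longrightarrow> pr i p (\<mu> k x) = \<mu> k (pr (i - int (g k)) (p - 1) x)"
    and pr_pr: "pr i p (pr i p x) = pr i p x"
    and pr_range: "pr i p x \<noteq> 0 \<Longrightarrow> 0 \<le> i \<and> 0 \<le> p \<and> i \<le> D * p"
    and I_Suc: "k < N \<Longrightarrow> x \<in> I (Suc k) \<longleftrightarrow> (\<exists>a. x - \<mu> k a \<in> I k)"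
    and \<mu>_J: "k < N \<Longrightarrow> \<mu> k x \<in> I k \<longleftrightarrow> x \<in> (if odd (g k) then I (Suc k) else I k)"
    and d_\<mu>: "k < N \<Longrightarrow>
      (if odd (g k) then d (\<mu> k x) + \<mu> k (d x) else d (\<mu> k x) - \<mu> k (d x)) \<in> I k"
    and I_last: "(i, p) \<noteq> (0, 0) \<Longrightarrow> pr i p x = x \<Longrightarrow> x \<in> I N"
    and unit: "pr 0 0 e = e" "e \<notin> I N" "d e = 0"
    and g2: "k < N \<Longrightarrow> 2 \<le> g k"
    and r1: "1 \<le> r"
begin

text \<open>\<open>Z k\<close> and \<open>bd k\<close> are the preimages in \<open>A\<close> of the
  cocycles and of the coboundaries of \<open>A / I k\<close>.\<close>

definition Z :: "nat \<Rightarrow> 'a set" where "Z k = {z. d z \<in> I k}"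

definition bd :: "nat \<Rightarrow> 'a set" where "bd k = {x. \<exists>a. x - d a \<in> I k}"

definition Hn :: "nat \<Rightarrow> int \<Rightarrow> int \<Rightarrow> bool" where
  "Hn k i p \<longleftrightarrow> (\<exists>z. pr i p z = z \<and> z \<in> Z k \<and> z \<notin> bd k)"

abbreviation J :: "nat \<Rightarrow> nat" where "J k \<equiv> if odd (g k) then Suc k else k"

lemma lin_simps:
  assumes "Vector_Spaces.linear scale scale f"
  shows "f (x + y) = f x + f y" "f (x - y) = f x - f y" "f (- x) = - f x" "f 0 = 0"
  using assms by (auto simp: linear_iff_module_hom module_hom.add module_hom.diff module_hom.neg
    module_hom.zero)

lemmas d_simps = lin_simps[OF d_lin]
lemmas pr_simps = lin_simps[OF pr_lin]
lemmas \<mu>_simps = lin_simps[OF \<mu>_lin]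

lemma I_intros:
  "0 \<in> I k" "x \<in> I k \<Longrightarrow> y \<in> I k \<Longrightarrow> x + y \<in> I k"
  "x \<in> I k \<Longrightarrow> y \<in> I k \<Longrightarrow> x - y \<in> I k" "x \<in> I k \<Longrightarrow> - x \<in> I k"
  using I_sub subspace_0 subspace_add subspace_diff subspace_neg by blast+

lemma I_diff: "x - y \<in> I k \<Longrightarrow> x \<in> I k \<longleftrightarrow> y \<in> I k"
  using I_intros(2)[of "x - y" k y] I_intros(3)[of x k "x - y"] by auto

lemma I_mono: "k < N \<Longrightarrow> x \<in> I k \<Longrightarrow> x \<in> I (Suc k)"
  using I_Suc[of k x] \<mu>_simps(4)[of k] by (metis diff_zero)

lemma \<mu>_I_J: "k < N \<Longrightarrow> \<mu> k x \<in> I k \<longleftrightarrow> x \<in> I (J k)"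
  using \<mu>_J by auto

lemma \<mu>_I_Suc: "k < N \<Longrightarrow> \<mu> k x \<in> I (Suc k)"
  using I_Suc[of k] I_intros(1)[of k] by (metis diff_self)

lemma d_\<mu>_I: "k < N \<Longrightarrow> d (\<mu> k x) \<in> I k \<longleftrightarrow> d x \<in> I (J k)"
  using d_\<mu>[of k x] I_diff[of "d (\<mu> k x)" "\<mu> k (d x)" k] I_diff[of "d (\<mu> k x)" "- \<mu> k (d x)" k]
    \<mu>_I_J[of k "d x"] I_intros(4)[of "\<mu> k (d x)" k] I_intros(4)[of "- \<mu> k (d x)" k]
  by (auto split: if_splits)

lemma \<mu>_d_range: "k < N \<Longrightarrow> \<exists>a. \<mu> k (d x) - d a \<in> I k"
  using d_\<mu>[of k x] I_intros(4)[OF d_\<mu>[of k x]]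
  by (intro exI[of _ "if odd (g k) then - \<mu> k x else \<mu> k x"])
    (auto simp: d_simps algebra_simps split: if_splits)

lemma Z_iff: "x \<in> Z k \<longleftrightarrow> d x \<in> I k" unfolding Z_def by simp

text \<open>The projections commute with \<open>d\<close> up to a shift and preserve
  \<open>I k\<close>, so a primitive may be projected to the right bidegree.\<close>

lemma bd_hom:
  assumes "k \<le> N" "pr i p z = z" "z \<in> bd k"
  obtains a where "pr (i - 1) (p - r) a = a" "z - d a \<in> I k"
proof -
  from assms(3) obtain a where "z - d a \<in> I k" unfolding bd_def by blast
  from pr_I[OF assms(1) this, of i p] have "z - d (pr (i - 1) (p - r) a) \<in> I k"
    using assms(2) by (simp add: pr_simps pr_d)
  then show ?thesis using that pr_pr by blast
qed

lemma I_Suc_hom: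
  assumes "k < N" "pr i p x = x" "x \<in> I (Suc k)"
  obtains b where "pr (i - int (g k)) (p - 1) b = b" "x - \<mu> k b \<in> I k"
proof -
  from assms I_Suc obtain b where "x - \<mu> k b \<in> I k" by blast
  from pr_I[OF less_imp_le[OF assms(1)] this, of i p]
  have "x - \<mu> k (pr (i - int (g k)) (p - 1) b) \<in> I k"
    using assms(1,2) by (simp add: pr_simps pr_\<mu>)
  then show ?thesis using that pr_pr by blast
qed

lemma \<mu>_bd:
  assumes "k < N" "x \<in> bd (J k)"
  shows "\<mu> k x \<in> bd k"
proof -
  from assms(2) obtain a where "x - d a \<in> I (J k)" unfolding bd_def by blast
  then have 1: "\<mu> k x - \<mu> k (d a) \<in> I k" using assms(1) \<mu>_I_J \<mu>_simps(2) by metis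
  obtain a' where "\<mu> k (d a) - d a' \<in> I k" using \<mu>_d_range[OF assms(1)] by blast
  from I_intros(2)[OF 1 this] show ?thesis unfolding bd_def by auto
qed

lemma bd_I_diff: "x \<in> bd k \<Longrightarrow> x - y \<in> I k \<Longrightarrow> y \<in> bd k"
proof -
  assume "x \<in> bd k" and xy: "x - y \<in> I k"
  then obtain a where "x - d a \<in> I k" unfolding bd_def by blast
  from I_intros(3)[OF this xy] show ?thesis unfolding bd_def by (auto simp: algebra_simps)
qed

lemma bd_mono: "k < N \<Longrightarrow> x \<in> bd k \<Longrightarrow> x \<in> bd (Suc k)"
  unfolding bd_def using I_mono by blast

text \<open>The first alternative is stronger than \<open>les1\<close>: the lifted cocycle is still
  no boundary modulo \<open>I (Suc k)\<close>. Counting the kernel of \<theta> relies on this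
  form.\<close>

lemma exact_quotient:
  assumes k: "k < N" and z: "pr i p z = z" "z \<in> Z (Suc k)" "z \<notin> bd (Suc k)"
  shows "(\<exists>z'. pr i p z' = z' \<and> z' \<in> Z k \<and> z' \<notin> bd (Suc k)) \<or>
    Hn (J k) (i + 1 - int (g k)) (p + r - 1)"
proof -
  have "pr (i + 1) (p + r) (d z) = d z" using z(1) by (simp add: pr_d)
  \<comment> \<open>\<open>b\<close> represents the connecting image of the class of
    \<open>z\<close>.\<close>
  then obtain b where b: "pr (i + 1 - int (g k)) (p + r - 1) b = b" "d z - \<mu> k b \<in> I k"
    using I_Suc_hom[OF k, of "i + 1" "p + r" "d z"] z(2) unfolding Z_iff by (metis diff_add_eq)
  have "d (\<mu> k b) \<in> I k"
    using d_I[of k "d z - \<mu> k b"] b(2) k I_intros(4)[of "- d (\<mu> k b)" k] by (auto simp: d_simps dd)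
  then have Zb: "b \<in> Z (J k)" unfolding Z_iff using d_\<mu>_I[OF k] by blast
  show ?thesis
  proof (cases "b \<in> bd (J k)")
    case False
    then show ?thesis unfolding Hn_def using b(1) Zb by blast
  next
    case True
    have "J k \<le> N" using k by auto
    from bd_hom[OF this b(1) True] obtain a where
      a: "pr (i - int (g k)) (p - 1) a = a" "b - d a \<in> I (J k)" by (auto simp: algebra_simps)
    have 1: "\<mu> k b - \<mu> k (d a) \<in> I k" using a(2) k \<mu>_I_J \<mu>_simps(2) by metis
    \<comment> \<open>As \<open>b\<close> bounds, a multiple of the generator corrects
      \<open>z\<close> to a cocycle modulo \<open>I k\<close>; the sign is that of the Leibniz
      rule.\<close>
    define z' where "z' = (if odd (g k) then z + \<mu> k a else z - \<mu> k a)"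
    have "d z' = (d z - \<mu> k b) + (\<mu> k b - \<mu> k (d a)) +
       (if odd (g k) then d (\<mu> k a) + \<mu> k (d a) else - (d (\<mu> k a) - \<mu> k (d a)))"
      unfolding z'_def by (simp add: d_simps)
    moreover have "(if odd (g k) then d (\<mu> k a) + \<mu> k (d a) else - (d (\<mu> k a) - \<mu> k (d a))) \<in> I k"
      using d_\<mu>[OF k, of a] I_intros(4)[of "d (\<mu> k a) - \<mu> k (d a)" k] by (simp split: if_splits)
    ultimately have "z' \<in> Z k" unfolding Z_iff using I_intros(2)[OF b(2) 1] I_intros(2) by simp
    moreover have "pr i p z' = z'" unfolding z'_def using z(1) a(1) k by (simp add: pr_simps pr_\<mu>)
    moreover have "z' - z \<in> I (Suc k)" unfolding z'_def
      using \<mu>_I_Suc[OF k, of a] I_intros(4) by auto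
    then have "z' \<notin> bd (Suc k)" using bd_I_diff z(3) by blast
    ultimately show ?thesis by blast
  qed
qed

lemma exact_middle:
  assumes k: "k < N" and h: "Hn k i p"
  shows "Hn (Suc k) i p \<or> Hn (J k) (i - int (g k)) (p - 1)"
proof -
  from h obtain z where z: "pr i p z = z" "z \<in> Z k" "z \<notin> bd k" unfolding Hn_def by blast
  show ?thesis
  proof (cases "z \<in> bd (Suc k)")
    case False
    then show ?thesis using z I_mono[OF k] unfolding Hn_def Z_iff by blast
  next
    case True
    obtain a where a: "pr (i - 1) (p - r) a = a" "z - d a \<in> I (Suc k)"
      using bd_hom[OF Suc_leI[OF k] z(1) True] by blast
    have "pr i p (z - d a) = z - d a" using z(1) a(1) by (simp add: pr_simps pr_d)
    from I_Suc_hom[OF k this a(2)] obtain b where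
      b: "pr (i - int (g k)) (p - 1) b = b" "z - d a - \<mu> k b \<in> I k" by blast
    have "d z - d (\<mu> k b) \<in> I k"
      using d_I[OF _ b(2)] k by (simp add: d_simps dd)
    then have "b \<in> Z (J k)" using z(2) I_diff d_\<mu>_I[OF k] unfolding Z_iff by blast
    moreover have "b \<notin> bd (J k)"
    proof
      assume "b \<in> bd (J k)"
      from \<mu>_bd[OF k this] obtain a' where "\<mu> k b - d a' \<in> I k" unfolding bd_def by blast
      from I_intros(2)[OF b(2) this] have "z - d (a + a') \<in> I k" by (simp add: d_simps algebra_simps)
      then show False using z(3) unfolding bd_def by blast
    qed
    ultimately show ?thesis using b(1) unfolding Hn_def by blast
  qed
qed

lemma exact_sub:
  assumes k: "k < N" and h: "Hn (J k) i p"
  shows "Hn k (i + int (g k)) (p + 1) \<or> Hn (Suc k) (i + int (g k) - 1) (p + 1 - r)"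
proof -
  from h obtain z where z: "pr i p z = z" "z \<in> Z (J k)" "z \<notin> bd (J k)" unfolding Hn_def by blast
  have h1: "pr (i + int (g k)) (p + 1) (\<mu> k z) = \<mu> k z" using k z(1) by (simp add: pr_\<mu>)
  have h2: "\<mu> k z \<in> Z k" using z(2) d_\<mu>_I[OF k] unfolding Z_iff by blast
  show ?thesis
  proof (cases "\<mu> k z \<in> bd k")
    case False
    then show ?thesis using h1 h2 unfolding Hn_def by blast
  next
    case True
    from bd_hom[OF _ h1 True] k obtain c where
      c: "pr (i + int (g k) - 1) (p + 1 - r) c = c" "\<mu> k z - d c \<in> I k" by auto
    have "d c \<in> I (Suc k)" using I_mono[OF k c(2)] \<mu>_I_Suc[OF k, of z] I_diff by blast
    moreover have "c \<notin> bd (Suc k)"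
    proof
      assume "c \<in> bd (Suc k)"
      then obtain a' where "c - d a' \<in> I (Suc k)" unfolding bd_def by blast
      then obtain a where "c - d a' - \<mu> k a \<in> I k" using I_Suc[OF k] by blast
      from d_I[OF _ this] k have "d c - d (\<mu> k a) \<in> I k" by (simp add: d_simps dd)
      from I_intros(2)[OF c(2) this] have 1: "\<mu> k z - d (\<mu> k a) \<in> I k" by simp
      define a1 where "a1 = (if odd (g k) then - a else a)"
      have "\<mu> k (z - d a1) \<in> I k"
        using I_intros(2)[OF 1 d_\<mu>[OF k, of a]] unfolding a1_def
        using k by (auto simp: \<mu>_simps d_simps split: if_splits)
      then have "z - d a1 \<in> I (J k)" using \<mu>_I_J[OF k] by blast
      then show False using z(3) unfolding bd_def by blast
    qed
    ultimately show ?thesis using c(1) unfolding Hn_def Z_iff by blast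
  qed
qed

end

sublocale ideal_tower \<subseteq> exact_tower Hn g N r D
proof
  fix k i p assume k: "k < N"
  show "Hn (Suc k) i p \<Longrightarrow> Hn k i p \<or> Hn (J k) (i + 1 - int (g k)) (p + r - 1)"
    using exact_quotient[OF k] bd_mono[OF k] unfolding Hn_def[of "Suc k"] Hn_def[of k] by blast
  show "Hn k i p \<Longrightarrow> Hn (Suc k) i p \<or> Hn (J k) (i - int (g k)) (p - 1)"
    by (rule exact_middle[OF k])
  show "Hn (J k) i p \<Longrightarrow> Hn k (i + int (g k)) (p + 1) \<or> Hn (Suc k) (i + int (g k) - 1) (p + 1 - r)"
    by (rule exact_sub[OF k])
  show "2 \<le> g k" using g2 k .
next
  show "1 \<le> r" by (rule r1)
next
  fix k i p assume "Hn k i p"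
  then obtain z where "pr i p z = z" "z \<notin> bd k" unfolding Hn_def by blast
  moreover have "0 \<in> bd k" unfolding bd_def using I_intros(1) d_simps(4) by (auto intro!: exI[of _ 0])
  ultimately have "pr i p z \<noteq> 0" by metis
  then show "0 \<le> i \<and> 0 \<le> p \<and> i \<le> D * p" using pr_range by blast
next
  fix i p
  have *: "e \<notin> bd N"
  proof
    assume "e \<in> bd N"
    from bd_hom[OF _ unit(1) this] obtain a where
      a: "pr (0 - 1) (0 - r) a = a" "e - d a \<in> I N" by auto
    \<comment> \<open>A primitive of the unit would live in degree -1, where there is
      nothing.\<close>
    have "a = 0" using pr_range[of "0 - 1" "0 - r" a] a(1) by auto
    then show False using a(2) unit(2) by (simp add: d_simps)
  qed
  show "Hn N i p \<longleftrightarrow> i = 0 \<and> p = 0"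
  proof
    assume "Hn N i p"
    then obtain z where z: "pr i p z = z" "z \<notin> bd N" unfolding Hn_def by blast
    have "z \<notin> I N" using z(2) unfolding bd_def using d_simps(4) by (metis diff_zero mem_Collect_eq)
    then show "i = 0 \<and> p = 0" using I_last[of i p z] z(1) by auto
  next
    assume "i = 0 \<and> p = 0"
    then show "Hn N i p" unfolding Hn_def Z_iff using unit * I_intros(1) by auto
  qed
qed

text \<open>Finite cohomology is assumed for \<open>A\<close> only; at stage 1 it follows from
  bounded wordlengths.\<close>

locale finite_ideal_tower = ideal_tower +
  assumes I0: "I 0 = {0}" and N0: "0 < N" and odd0: "odd (g 0)"
    and pr_finite: "\<exists>F. finite F \<and> range (pr i p) \<subseteq> span F"
    and pr_sum: "\<exists>T. finite T \<and> x = (\<Sum>(i, p)\<in>T. pr i p x)"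
    and pr_other: "(i, p) \<noteq> (i', p') \<Longrightarrow> pr i p (pr i' p' x) = 0"
    and finite_cohomology: "\<exists>F. finite F \<and> spans_mod (range d) {z. d z = 0} F"
begin

lemma bd0: "bd 0 = range d"
  unfolding bd_def I0 by auto

lemma Z0: "Z 0 = {z. d z = 0}"
  unfolding Z_def I0 by auto

lemma linear_subspaces:
  "subspace (Z k)" "subspace (bd k)"
proof -
  interpret d: Vector_Spaces.linear scale scale d by (rule d_lin)
  show "subspace (Z k)" unfolding Z_def
    using I_sub by (auto simp: subspace_def d.add d.scale d.zero)
  have "{x. \<exists>a\<in>range d. x - a \<in> I k} = bd k" unfolding bd_def by auto
  moreover have "subspace (range d)" using d.subspace_image subspace_UNIV by blast
  ultimately show "subspace (bd k)" using subspace_plus[OF _ I_sub, of "range d" k] by simp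
qed

lemma pr_in_all:
  assumes "subspace S" "\<And>i p. pr i p x \<in> S"
  shows "x \<in> S"
proof -
  obtain T where T: "finite T" "x = (\<Sum>(i, p)\<in>T. pr i p x)" using pr_sum by blast
  have "(\<Sum>(i, p)\<in>T. pr i p x) \<in> S" using assms by (intro subspace_sum) auto
  then show ?thesis using T(2) by simp
qed

text \<open>The classes have distinct wordlengths, so projecting a relation to the bidegree of one
  of them removes all the others.\<close>

lemma hom_indep_mod:
  assumes "finite Q" and "\<And>q. q \<in> Q \<Longrightarrow> pr (i q) q (x q) = x q \<and> x q \<notin> bd k" and k: "k \<le> N"
  shows "indep_mod (bd k) (x ` Q) \<and> inj_on x Q"
  using assms(1,2)
proof (induction Q)
  case empty
  show ?case by (simp add: indep_mod_def independent_empty)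
next
  case (insert q Q)
  have ih: "indep_mod (bd k) (x ` Q)" "inj_on x Q" using insert by auto
  have "x q - y \<notin> bd k" if y: "y \<in> span (x ` Q)" for y
  proof
    assume b: "x q - y \<in> bd k"
    interpret pr: Vector_Spaces.linear scale scale "pr (i q) q" by (rule pr_lin)
    have "pr (i q) q y = 0" using y
    proof (induction rule: span_induct_alt)
      case (step c z y)
      then obtain q' where "q' \<in> Q" "z = x q'" by blast
      then have "pr (i q) q z = 0" using pr_other[of "i q" q "i q'" q' z] insert.prems[of q'] insert.hyps(2)
        by auto
      then show ?case using step by (simp add: pr.add pr.scale)
    qed (simp add: pr.zero)
    moreover obtain a where a: "x q - y - d a \<in> I k" using b unfolding bd_def by blast
    ultimately have "x q - d (pr (i q - 1) (q - r) a) \<in> I k"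
      using pr_I[OF k a, of "i q" q] insert.prems[of q] by (simp add: pr_simps pr_d)
    then show False using insert.prems[of q] unfolding bd_def by blast
  qed
  from indep_mod_insert[OF linear_subspaces(2) ih(1) this] ih(2) insert.hyps(2)
  show ?case by auto
qed

lemma bounded_iff_range:
  assumes "\<And>i p. Hn k i p \<Longrightarrow> p \<le> M"
  shows "finite {(i, p). Hn k i p}"
proof (rule finite_subset)
  show "{(i, p). Hn k i p} \<subseteq> {0..\<bar>D\<bar> * \<bar>M\<bar>} \<times> {0..M}"
  proof clarify
    fix i p assume h: "Hn k i p"
    have "D * p \<le> \<bar>D\<bar> * \<bar>M\<bar>" using assms[OF h] range[OF h]
      by (meson abs_ge_self abs_ge_zero dual_order.trans mult_mono)
    then show "i \<in> {0..\<bar>D\<bar> * \<bar>M\<bar>} \<and> p \<in> {0..M}" using range[OF h] assms[OF h] by auto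
  qed
qed auto

text \<open>Infinitely many wordlengths would yield arbitrarily large independent families of
  classes.\<close>

lemma bounded0: "bounded 0"
proof -
  obtain F where F: "finite F" "spans_mod (bd 0) (Z 0) F" using finite_cohomology unfolding bd0 Z0 by blast
  let ?Q = "{p. \<exists>i. Hn 0 i p}"
  have "\<forall>p. \<exists>i x. p \<in> ?Q \<longrightarrow> pr i p x = x \<and> x \<in> Z 0 \<and> x \<notin> bd 0"
    unfolding Hn_def by blast
  then obtain i x where ix: "\<And>p. p \<in> ?Q \<Longrightarrow> pr (i p) p (x p) = x p \<and> x p \<in> Z 0 \<and> x p \<notin> bd 0"
    by metis
  have "card Q \<le> card F" if "finite Q" "Q \<subseteq> ?Q" for Q
  proof -
    have 1: "indep_mod (bd 0) (x ` Q) \<and> inj_on x Q"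
      by (rule hom_indep_mod[OF that(1), of i]) (use ix that(2) in blast)+
    have "x ` Q \<subseteq> Z 0" using ix that(2) by blast
    then have "card (x ` Q) \<le> card F"
      using indep_mod_card_le[OF linear_subspaces(2) F] 1 by blast
    then show ?thesis using 1 card_image by metis
  qed
  then have "finite ?Q" using infinite_arbitrarily_large[of ?Q "Suc (card F)"] by (metis Suc_n_not_le_n)
  then have "p \<le> Max ?Q" if "Hn 0 i p" for i p using that by (intro Max_ge) auto
  then show ?thesis unfolding bounded_def by blast
qed

lemma finite_Hn: "k \<le> 1 \<Longrightarrow> finite {(i, p). Hn k i p}"
  using bounded0 bounded_step[OF N0 bounded0] bounded_iff_range unfolding bounded_def
  by (cases "k = 0") (auto simp: le_Suc_eq)

text \<open>Homogeneous components in the finitely many bidegrees with cohomology lie in a finite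
  span; all the other components are boundaries.\<close>

lemma finite_spans:
  assumes "k \<le> 1"
  obtains F where "finite F" "spans_mod (bd k) (Z k) F"
proof -
  have k: "k \<le> N" using assms N0 by auto
  obtain F where F: "\<And>i p. finite (F i p) \<and> range (pr i p) \<subseteq> span (F i p)" using pr_finite by metis
  define G where "G = (\<Union>(i, p)\<in>{(i, p). Hn k i p}. F i p)"
  have "finite G" unfolding G_def using finite_Hn[OF assms] F by auto
  moreover have "x \<in> {x. \<exists>y\<in>span G. x - y \<in> bd k}" if x: "x \<in> Z k" for x
  proof (rule pr_in_all)
    show "subspace {x. \<exists>y\<in>span G. x - y \<in> bd k}"
      using subspace_plus linear_subspaces by simp
    fix i p
    have z: "pr i p x \<in> Z k" unfolding Z_iff
      using pr_I[OF k, of "d x" "i + 1" "p + r"] x unfolding Z_iff by (simp add: pr_d)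
    show "pr i p x \<in> {x. \<exists>y\<in>span G. x - y \<in> bd k}"
    proof (cases "pr i p x \<in> bd k")
      case True
      then show ?thesis using span_zero by (auto intro!: bexI[of _ 0])
    next
      case False
      then have "Hn k i p" unfolding Hn_def using z pr_pr by blast
      then have "F i p \<subseteq> G" unfolding G_def by blast
      then have "pr i p x \<in> span G" using F[of i p] span_mono by blast
      then show ?thesis using subspace_0[OF linear_subspaces(2)] by (auto intro!: bexI[of _ "pr i p x"])
    qed
  qed
  ultimately show ?thesis using that unfolding spans_mod_def by blast
qed

lemma spans_mod_mono: "spans_mod A M F \<Longrightarrow> A \<subseteq> B \<Longrightarrow> L \<subseteq> M \<Longrightarrow> spans_mod B L F"
  unfolding spans_mod_def by blast

text \<open>
  The connecting endomorphism of the cohomology of the first quotient has kernel and cokernel of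
  equal dimension.  Classes of the kernel lift to cocycles, those of the cokernel are multiplied
  by the first generator.
\<close>

theorem many_classes:
  obtains L where "L \<subseteq> {z. d z = 0}" "finite L" "indep_mod (range d) L"
    "2 * card {j \<in> {..<N}. odd (g j)} \<le> card L"
proof -
  define n where "n = card {j \<in> {..<N}. odd (g j)}"
  have J0: "J 0 = 1" using odd0 by simp
  have N1: "1 \<le> N" "0 \<le> N" using N0 by auto
  interpret d: Vector_Spaces.linear scale scale d by (rule d_lin)
  interpret m: Vector_Spaces.linear scale scale "\<mu> 0" by (rule \<mu>_lin[OF N0])
  have d_m: "d (\<mu> 0 x) = - \<mu> 0 (d x)" for x
    using d_\<mu>[OF N0, of x] odd0 I0 by (simp add: add_eq_0_iff)
  have m_0: "\<mu> 0 x = 0 \<longleftrightarrow> x \<in> I 1" for x using \<mu>_J[OF N0, of x] odd0 I0 by simp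
  have I_1: "x \<in> I 1 \<longleftrightarrow> x \<in> range (\<mu> 0)" for x using I_Suc[OF N0, of x] I0 by auto
  have Z01: "Z 0 \<subseteq> Z 1" unfolding Z_def I0 using I_intros(1) by auto
  have bd01: "bd 0 \<subseteq> bd 1" using bd_mono[OF N0] by auto
  obtain F where F: "finite F" "spans_mod (bd 1) (Z 1) F" using finite_spans[of 1] by auto
  \<comment> \<open>Up to boundaries, these are the elements that lift to cocycles of
    \<open>A\<close>, that is, the preimage of the kernel of the connecting map \<theta>.\<close>
  define K0 where "K0 = {x. \<exists>a\<in>Z 0. x - a \<in> bd 1}"
  have K0: "subspace K0" unfolding K0_def
    using subspace_plus linear_subspaces by simp
  have bd_K0: "bd 1 \<subseteq> K0" unfolding K0_def using subspace_0[OF linear_subspaces(1)] by (auto intro!: bexI[of _ 0])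
  have Z_K0: "Z 0 \<subseteq> K0" unfolding K0_def using subspace_0[OF linear_subspaces(2)]
    by (metis (mono_tags, lifting) cancel_comm_monoid_add_class.diff_cancel mem_Collect_eq subsetI)
  \<comment> \<open>By exactness the image of \<theta> is the kernel of multiplication by the first
    generator into the cohomology of \<open>A\<close>; \<open>R\<close> is the preimage of that
    kernel.\<close>
  define R where "R = {x. \<mu> 0 x \<in> bd 0}"
  have R: "subspace R" unfolding R_def using linear_subspaces(2)[of 0]
    by (auto simp: subspace_def m.add m.scale m.zero)
  have bd_R: "bd 1 \<subseteq> R" unfolding R_def using \<mu>_bd[OF N0] J0 by auto

  \<comment> \<open>\<open>K\<close>, \<open>P\<close> and \<open>G\<close> represent bases of the
    kernel of \<theta>, of a complement of it, and of the cokernel; \<open>th\<close> below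
    represents \<theta> on \<open>P\<close>.\<close>
  obtain K where K: "K \<subseteq> Z 0" "finite K" "indep_mod (bd 1) K" "spans_mod (bd 1) (Z 0) K"
    using indep_mod_maximal[OF linear_subspaces(2) F(1) spans_mod_mono[OF F(2) order_refl Z01]] by blast
  obtain P where P: "P \<subseteq> Z 1" "finite P" "indep_mod K0 P" "spans_mod K0 (Z 1) P"
    using indep_mod_maximal[OF K0 F(1) spans_mod_mono[OF F(2) bd_K0 order_refl]] by blast
  obtain G where G: "G \<subseteq> Z 1" "finite G" "indep_mod R G" "spans_mod R (Z 1) G"
    using indep_mod_maximal[OF R F(1) spans_mod_mono[OF F(2) bd_R order_refl]] by blast
  have span_K: "span K \<subseteq> Z 0" using K(1) linear_subspaces(1) span_minimal by blast

  have "\<forall>z\<in>P. \<exists>b. d z = \<mu> 0 b" using P(1) I_1 unfolding Z_def by fast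
  then obtain th where th: "\<And>z. z \<in> P \<Longrightarrow> d z = \<mu> 0 (th z)" by metis
  have th_span: "\<exists>b\<in>span (th ` P). d y = \<mu> 0 b" if "y \<in> span P" for y
    using that
  proof (induction rule: span_induct_alt)
    case base
    show ?case by (auto intro!: bexI[of _ 0] simp: span_zero d.zero m.zero)
  next
    case (step c x y)
    then obtain b where b: "b \<in> span (th ` P)" "d y = \<mu> 0 b" by blast
    have "scale c (th x) + b \<in> span (th ` P)"
      using b(1) step(1) by (simp add: span_add span_base span_scale)
    then show ?case using b(2) th[OF step(1)] by (auto intro!: bexI[of _ "scale c (th x) + b"]
      simp: d.add d.scale m.add m.scale)
  qed

  have R_spans: "spans_mod (bd 1) R (th ` P)"
    unfolding spans_mod_def
  proof
    fix x assume "x \<in> R"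
    then obtain z where z: "\<mu> 0 x = d z" unfolding R_def bd0 by blast
    then have "z \<in> Z 1" unfolding Z_iff I_1 by (metis rangeI)
    then obtain y where y: "y \<in> span P" "z - y \<in> K0" using P(4) unfolding spans_mod_def by blast
    then obtain z0 where z0: "d z0 = 0" "z - y - z0 \<in> bd 1" unfolding K0_def Z0 by auto
    then obtain a c where ac: "z - y - z0 - d a = \<mu> 0 c" using I_1 unfolding bd_def by blast
    obtain b where b: "b \<in> span (th ` P)" "d y = \<mu> 0 b" using th_span[OF y(1)] by blast
    \<comment> \<open>Applying \<open>d\<close> to \<open>z = y + z0 + d a + \<mu> 0 c\<close> gives
      \<open>\<mu> 0 x = \<mu> 0 b - \<mu> 0 (d c)\<close>, so \<open>x\<close> and \<open>b\<close>
      differ by a boundary modulo \<open>I 1\<close>.\<close>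
    have "d (\<mu> 0 c) = d z - d y" unfolding ac[symmetric] by (simp add: d.diff z0(1) dd)
    moreover have "\<mu> 0 (d c) = - d (\<mu> 0 c)" using d_m[of c] by simp
    ultimately have "\<mu> 0 (x - b - d (- c)) = 0" using z b(2) by (simp only: m.diff d.neg m.neg) simp
    then have "x - b \<in> bd 1" using m_0 unfolding bd_def by blast
    then show "\<exists>y\<in>span (th ` P). x - y \<in> bd 1" using b(1) by blast
  qed
  have "spans_mod (bd 1) (Z 1) (th ` P \<union> G)"
    unfolding spans_mod_def
  proof
    fix x assume "x \<in> Z 1"
    then obtain y where y: "y \<in> span G" "x - y \<in> R" using G(4) unfolding spans_mod_def by blast
    then obtain w where w: "w \<in> span (th ` P)" "x - y - w \<in> bd 1" using R_spans unfolding spans_mod_def by blast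
    have "w + y \<in> span (th ` P \<union> G)" using w(1) y(1) unfolding span_Un by blast
    then show "\<exists>y\<in>span (th ` P \<union> G). x - y \<in> bd 1" using w(2)
      by (auto intro!: bexI[of _ "w + y"] simp: algebra_simps)
  qed
  moreover have "finite (th ` P \<union> G)" using P(2) G(2) by auto
  moreover have PK: "indep_mod (bd 1) (P \<union> K)" "P \<inter> K = {}"
    using indep_mod_Un[OF P(3,2) K(3) _ bd_K0 K0] span_K Z_K0 by auto
  moreover have "P \<union> K \<subseteq> Z 1" using P(1) K(1) Z01 by auto
  \<comment> \<open>\<open>P\<close> and \<open>K\<close> are jointly independent in the cohomology
    of the first quotient, while \<open>G\<close> and the image of \<open>P\<close> span it.
    Cancelling \<open>card P\<close> bounds the kernel by the cokernel.\<close>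
  ultimately have "card (P \<union> K) \<le> card (th ` P \<union> G)"
    using indep_mod_card_le[OF linear_subspaces(2)] by blast
  also have "card (th ` P \<union> G) \<le> card P + card G"
    using card_Un_le[of "th ` P" G] card_image_le[OF P(2), of th] by linarith
  finally have KG: "card K \<le> card G" using card_Un_disjoint[OF P(2) K(2) PK(2)] by simp

  have "\<exists>j x. pr j (int q) x = x \<and> x \<in> Z 0 \<and> x \<notin> bd 1" if q: "q < n" for q
  proof -
    obtain j where j: "Hn 1 j (int q)" "\<not> Hn 1 (j + 1 - int (g 0)) (int q + r - 1)"
      using liftable_classes[OF N0 odd0 bounded0] q unfolding n_def by blast
    then obtain z where "pr j (int q) z = z" "z \<in> Z 1" "z \<notin> bd 1" unfolding Hn_def by blast
    with exact_quotient[OF N0, of j "int q" z] j(2) odd0 show ?thesis by auto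
  qed
  then obtain j x where jx: "\<And>q. q < n \<Longrightarrow> pr (j q) (int q) (x q) = x q \<and> x q \<in> Z 0 \<and> x q \<notin> bd 1"
    by metis
  \<comment> \<open>\<open>hom_indep_mod\<close> indexes classes by integer wordlengths.\<close>
  define X where "X q = x (nat q)" for q
  have X: "indep_mod (bd 1) (X ` (int ` {..<n})) \<and> inj_on X (int ` {..<n})"
    by (rule hom_indep_mod[of _ "\<lambda>q. j (nat q)"]) (use jx N1 in \<open>auto simp: X_def\<close>)
  have "card (X ` (int ` {..<n})) \<le> card K"
    by (rule indep_mod_card_le[THEN conjunct2, OF linear_subspaces(2) K(2,4)])
      (use X jx in \<open>auto simp: X_def\<close>)
  then have nK: "n \<le> card K" using X by (simp add: card_image)

  have mG: "indep_mod (bd 0) (\<mu> 0 ` G)" "inj_on (\<mu> 0) G"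
    using indep_mod_image[OF \<mu>_lin[OF N0] G(3), of "bd 0"] subspace_0[OF linear_subspaces(2)]
    unfolding R_def by auto
  have "\<mu> 0 ` G \<subseteq> Z 0"
  proof clarify
    fix y assume "y \<in> G"
    then have "d y \<in> I 1" using G(1) unfolding Z_def by blast
    then have "d (\<mu> 0 y) = 0" using d_m m_0 by simp
    then show "\<mu> 0 y \<in> Z 0" unfolding Z0 by simp
  qed
  \<comment> \<open>Multiples of the first generator vanish in the first quotient, where
    \<open>K\<close> remains independent; so the lifts and the multiples are independent
    together.\<close>
  moreover have "\<mu> 0 ` G \<subseteq> bd 1" unfolding bd_def using I_1 by (auto intro!: exI[of _ 0] simp: d.zero)
  then have "span (\<mu> 0 ` G) \<subseteq> bd 1" using linear_subspaces(2) span_minimal by blast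
  from indep_mod_Un[OF K(3,2) mG(1) this bd01 linear_subspaces(2)]
  have "indep_mod (bd 0) (K \<union> \<mu> 0 ` G)" "K \<inter> \<mu> 0 ` G = {}" .
  moreover have "card (K \<union> \<mu> 0 ` G) = card K + card G"
    using calculation K(2) G(2) mG(2) by (simp add: card_Un_disjoint card_image)
  ultimately show ?thesis
    using that[of "K \<union> \<mu> 0 ` G"] K(1,2) G(2) KG nK unfolding bd0 Z0 n_def by auto
qed

section \<open>Euler characteristic in a fixed weight\<close>

lemma rank_nullity:
  assumes "Vector_Spaces.linear scale scale f" "subspace G" "finite F" "G \<subseteq> span F"
  shows "dim G = dim {x \<in> G. f x = 0} + dim (f ` G)"
proof -
  interpret vp: vector_space_pair scale scale ..
  interpret f: Vector_Spaces.linear scale scale f by (rule assms(1))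
  define N where "N = {x. f x = 0}"
  have N: "subspace N" unfolding N_def by (auto simp: subspace_def f.add f.scale f.zero)
  have "spans_mod N G F" unfolding spans_mod_def
    using assms(4) subspace_0[OF N] by (metis diff_self subsetD)
  from indep_mod_maximal[OF N assms(3) this] obtain L where
    L: "L \<subseteq> G" "finite L" "indep_mod N L" "spans_mod N G L" by blast
  obtain C where C: "C \<subseteq> G \<inter> N" "independent C" "G \<inter> N \<subseteq> span C" "card C = dim (G \<inter> N)"
    using basis_exists[of "G \<inter> N"] by blast
  have "C \<subseteq> span F" using C(1) assms(4) by blast
  from independent_span_bound[OF assms(3) C(2) this] have fC: "finite C" by simp
  have span_C: "span C \<subseteq> N" using C(1) N span_minimal by blast
  have iC: "indep_mod {0} C" unfolding indep_mod_def using C(2) by auto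
  have "{0} \<subseteq> N" using subspace_0[OF N] by simp
  from indep_mod_Un[OF L(3,2) iC span_C this N]
  have LC: "independent (L \<union> C)" "L \<inter> C = {}" unfolding indep_mod_def by auto
  have "G \<subseteq> span (L \<union> C)"
  proof
    fix x assume x: "x \<in> G"
    then obtain y where y: "y \<in> span L" "x - y \<in> N" using L(4) unfolding spans_mod_def by blast
    have "y \<in> G" using y(1) L(1) assms(2) span_minimal by blast
    then have "x - y \<in> span C" using C(3) y(2) subspace_diff[OF assms(2) x] by blast
    then have "y + (x - y) \<in> span (L \<union> C)" using y(1) unfolding span_Un by blast
    then show "x \<in> span (L \<union> C)" by simp
  qed
  moreover have "L \<union> C \<subseteq> G" using L(1) C(1) by blast
  ultimately have "dim G = card (L \<union> C)" using LC(1) basis_card_eq_dim by metis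
  also have "\<dots> = card L + card C" using card_Un_disjoint[OF L(2) fC LC(2)] .
  finally have 1: "dim G = card L + card C" .
  have im: "indep_mod {0} (f ` L)" "inj_on f L"
    using indep_mod_image[OF assms(1) L(3), of "{0}"] unfolding N_def by auto
  have "f ` G \<subseteq> span (f ` L)"
  proof clarify
    fix x assume "x \<in> G"
    then obtain y where y: "y \<in> span L" "x - y \<in> N" using L(4) unfolding spans_mod_def by blast
    then have "f x = f y" unfolding N_def by (simp add: f.diff)
    then show "f x \<in> span (f ` L)" using y(1) vp.linear_span_image[OF assms(1)] by blast
  qed
  moreover have "f ` L \<subseteq> f ` G" using L(1) by blast
  ultimately have "dim (f ` G) = card (f ` L)" using im(1) basis_card_eq_dim unfolding indep_mod_def by metis
  moreover have "{x \<in> G. f x = 0} = G \<inter> N" unfolding N_def by auto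
  ultimately show ?thesis using 1 C(4) card_image[OF im(2)] by simp
qed

text \<open>The weight \<open>r * i - p\<close> is constant along \<open>d\<close>, and in weight
  \<open>w\<close> the degree determines the wordlength. Above the largest weight of a class the
  complex is exact and the alternating sum telescopes. The bound \<open>2 * p \<le> i\<close> forces
  \<open>i \<le> 2 * w\<close>, which makes the sum finite.\<close>

lemma euler_characteristic_vanishes:
  assumes range2: "\<And>i p x. pr i p x \<noteq> 0 \<Longrightarrow> 2 * p \<le> i"
  shows "\<exists>W. \<forall>w>W. (\<Sum>i\<in>{..2 * w}. (- 1) ^ i * int (dim (range (pr (int i) (r * int i - int w))))) = 0"
proof -
  have fin: "finite ((\<lambda>(i, p). nat (r * i - p)) ` {(i, p). Hn 0 i p})" using finite_Hn[of 0] by simp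
  define W where "W = Max (insert 0 ((\<lambda>(i, p). nat (r * i - p)) ` {(i, p). Hn 0 i p}))"
  have W: "nat (r * i - p) \<le> W" if "Hn 0 i p" for i p
    unfolding W_def using fin that by (intro Max_ge) auto
  have "(\<Sum>i\<in>{..2 * w}. (- 1) ^ i * int (dim (range (pr (int i) (r * int i - int w))))) = 0"
    if w: "w > W" for w
  proof -
    define G where "G i = range (pr i (r * i - int w))" for i
    have G_iff: "x \<in> G i \<longleftrightarrow> pr i (r * i - int w) x = x" for x i
      unfolding G_def using pr_pr by (metis rangeE rangeI)
    have exact: "{x \<in> G i. d x = 0} = d ` G (i - 1)" for i
    proof (intro equalityI subsetI)
      fix x assume "x \<in> {x \<in> G i. d x = 0}"
      then have x: "pr i (r * i - int w) x = x" "x \<in> Z 0" unfolding G_iff Z0 by auto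
      have "\<not> Hn 0 i (r * i - int w)" using W[of i "r * i - int w"] w by auto
      then have "x \<in> bd 0" using x unfolding Hn_def by blast
      from bd_hom[OF _ x(1) this] obtain a where "pr (i - 1) (r * i - int w - r) a = a" "x = d a"
        unfolding I0 by auto
      then show "x \<in> d ` G (i - 1)" using G_iff[of a "i - 1"] by (auto simp: algebra_simps)
    next
      fix x assume "x \<in> d ` G (i - 1)"
      then obtain a where "a \<in> G (i - 1)" and xa: "x = d a" by blast
      then have "pr (i - 1) (r * (i - 1) - int w) a = a" unfolding G_iff by simp
      then show "x \<in> {x \<in> G i. d x = 0}" unfolding G_iff xa by (auto simp: dd pr_d algebra_simps)
    qed
    define b where "b i = int (dim (d ` G i))" for i
    have G_dim: "int (dim (G i)) = b (i - 1) + b i" for i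
    proof -
      interpret pr: Vector_Spaces.linear scale scale "pr i (r * i - int w)" by (rule pr_lin)
      obtain F where F: "finite F" "G i \<subseteq> span F" unfolding G_def using pr_finite by blast
      have "subspace (G i)" unfolding G_def using pr.subspace_image subspace_UNIV by blast
      from rank_nullity[OF d_lin this F] show ?thesis unfolding b_def exact by simp
    qed
    have zero: "G i = {0}" if "i < 0 \<or> int (2 * w) < i" for i
    proof -
      have "pr i (r * i - int w) x = 0" for x
      proof (rule ccontr)
        assume "pr i (r * i - int w) x \<noteq> 0"
        from pr_range[OF this] range2[OF this] have i: "0 \<le> i" "2 * (r * i - int w) \<le> i" by auto
        moreover have "i \<le> r * i" using i(1) r1 by (simp add: mult_le_cancel_right1)
        ultimately show False using that by auto
      qed
      then show ?thesis unfolding G_def by auto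
    qed
    have d0: "d ` {0} = {0}" by (simp add: d_simps)
    have b0: "b (- 1) = 0" unfolding b_def using zero[of "- 1"] d0 dim_le_card[of "{0}" "{}"] by simp
    have "{x \<in> G (int (2 * w) + 1). d x = 0} \<subseteq> {0}" using zero[of "int (2 * w) + 1"] by auto
    then have "d ` G (int (2 * w)) \<subseteq> {0}" using exact[of "int (2 * w) + 1"] by simp
    then have bw: "b (int (2 * w)) = 0"
      unfolding b_def using dim_le_card[of "d ` G (int (2 * w))" "{}"] by simp
    have "(\<Sum>i\<in>{..n}. (- 1) ^ i * int (dim (G (int i)))) = (- 1) ^ n * b (int n)" for n
      by (induction n) (simp_all add: G_dim b0 algebra_simps)
    from this[of "2 * w"] bw show ?thesis unfolding G_def by simp
  qed
  then show ?thesis by blast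
qed

end

section \<open>Counting monomials with signs\<close>

text \<open>
  A multiset \<open>m\<close> of generators stands for a monomial, in which generators of odd degree occur at
  most once.
\<close>

definition monomials :: "('i \<Rightarrow> nat) \<Rightarrow> 'i set \<Rightarrow> 'i multiset set" where
  "monomials g K = {m. set_mset m \<subseteq> K \<and> (\<forall>k. odd (g k) \<longrightarrow> count m k \<le> 1)}"

lemma finite_bounded_multisets:
  assumes "finite K"
  shows "finite {m. set_mset m \<subseteq> K \<and> size m \<le> n}"
proof -
  have "{m. set_mset m \<subseteq> K \<and> size m \<le> n} \<subseteq> mset ` {xs. set xs \<subseteq> K \<and> length xs \<le> n}"
  proof
    fix m assume m: "m \<in> {m. set_mset m \<subseteq> K \<and> size m \<le> n}"
    obtain xs where "mset xs = m" using ex_mset by blast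
    with m show "m \<in> mset ` {xs. set xs \<subseteq> K \<and> length xs \<le> n}" by force
  qed
  then show ?thesis using finite_lists_length_le[OF assms] finite_subset by blast
qed

definition weight_set :: "('i \<Rightarrow> nat) \<Rightarrow> ('i \<Rightarrow> nat) \<Rightarrow> 'i set \<Rightarrow> nat \<Rightarrow> 'i multiset set" where
  "weight_set g u K w = {m \<in> monomials g K. (\<Sum>k\<in>#m. u k) = w}"

text \<open>The coefficient of \<open>X ^ w\<close> in the Euler-Poincare series of the free
  algebra, graded by the weight \<open>u\<close>.\<close>

definition signed_count :: "('i \<Rightarrow> nat) \<Rightarrow> ('i \<Rightarrow> nat) \<Rightarrow> 'i set \<Rightarrow> nat \<Rightarrow> rat" where
  "signed_count g u K w = (\<Sum>m\<in>weight_set g u K w. (- 1) ^ (\<Sum>k\<in>#m. g k))"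

lemma size_le_sum_mset:
  assumes "\<And>k. k \<in># m \<Longrightarrow> 0 < u k"
  shows "size m \<le> (\<Sum>k\<in>#m. (u k :: nat))"
  using assms
proof (induction m)
  case (add k m)
  then have "size m \<le> (\<Sum>k\<in>#m. u k)" "0 < u k" by auto
  then show ?case by simp
qed simp

lemma finite_weight_set:
  assumes "finite K" "\<And>k. k \<in> K \<Longrightarrow> 0 < u k"
  shows "finite (weight_set g u K w)"
proof (rule finite_subset)
  show "weight_set g u K w \<subseteq> {m. set_mset m \<subseteq> K \<and> size m \<le> w}"
  proof
    fix m assume m: "m \<in> weight_set g u K w"
    have "size m \<le> (\<Sum>k\<in>#m. u k)"
      by (rule size_le_sum_mset) (use m assms(2) in \<open>auto simp: weight_set_def monomials_def\<close>)
    then show "m \<in> {m. set_mset m \<subseteq> K \<and> size m \<le> w}"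
      using m by (auto simp: weight_set_def monomials_def)
  qed
qed (rule finite_bounded_multisets[OF assms(1)])

text \<open>Either \<open>k\<close> does not occur, or one occurrence can be removed; it may then
  occur again just when \<open>g k\<close> is even.\<close>

lemma weight_set_insert:
  assumes "k \<notin> K"
  shows "weight_set g u (insert k K) w = weight_set g u K w \<union>
    (if u k \<le> w then add_mset k ` weight_set g u (if odd (g k) then K else insert k K) (w - u k) else {})"
    (is "?L = ?R")
proof (intro equalityI subsetI)
  fix m assume m: "m \<in> ?L"
  show "m \<in> ?R"
  proof (cases "k \<in># m")
    case False
    then show ?thesis using m by (auto simp: weight_set_def monomials_def)
  next
    case True
    then obtain m' where m': "m = add_mset k m'" by (metis insert_DiffM)
    have c: "count m' j \<le> 1" if "odd (g j)" for j
    proof -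
      have "count m' j \<le> count m j" using m' by simp
      also have "\<dots> \<le> 1" using m that by (auto simp: weight_set_def monomials_def)
      finally show ?thesis .
    qed
    have sub: "set_mset m' \<subseteq> insert k K" "(\<Sum>k\<in>#m'. u k) = w - u k"
      using m m' by (auto simp: weight_set_def monomials_def)
    have "m' \<in> weight_set g u (if odd (g k) then K else insert k K) (w - u k)"
    proof (cases "odd (g k)")
      case True
      then have "count m k \<le> 1" using m by (auto simp: weight_set_def monomials_def)
      then have "k \<notin># m'" using m' by (simp add: not_in_iff)
      then show ?thesis using True c sub by (auto simp: weight_set_def monomials_def)
    next
      case False
      then show ?thesis using c sub by (auto simp: weight_set_def monomials_def)
    qed
    moreover have "u k \<le> w" using m m' by (auto simp: weight_set_def)
    ultimately show ?thesis using m' by auto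
  qed
next
  fix m assume "m \<in> ?R"
  then consider "m \<in> weight_set g u K w"
    | m' where "m = add_mset k m'" "u k \<le> w"
        "m' \<in> weight_set g u (if odd (g k) then K else insert k K) (w - u k)"
    by (auto split: if_splits)
  then show "m \<in> ?L"
  proof cases
    case 1
    then show ?thesis by (auto simp: weight_set_def monomials_def)
  next
    case 2
    have "count m j \<le> 1" if "odd (g j)" for j
    proof (cases "j = k")
      case True
      then have "k \<notin># m'" using 2 that assms by (auto simp: weight_set_def monomials_def)
      then show ?thesis using 2(1) True by (simp add: not_in_iff)
    next
      case False
      then show ?thesis using 2 that by (auto simp: weight_set_def monomials_def)
    qed
    moreover have "set_mset m \<subseteq> insert k K" "(\<Sum>k\<in>#m. u k) = w"
      using 2 by (auto simp: weight_set_def monomials_def split: if_splits)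
    ultimately show ?thesis by (auto simp: weight_set_def monomials_def)
  qed
qed

lemma signed_count_insert:
  assumes "finite K" "k \<notin> K" "\<And>j. j \<in> insert k K \<Longrightarrow> 0 < u j"
  shows "signed_count g u (insert k K) w = signed_count g u K w +
    (if u k \<le> w then (- 1) ^ g k * signed_count g u (if odd (g k) then K else insert k K) (w - u k) else 0)"
proof -
  let ?K = "if odd (g k) then K else insert k K"
  have *: "finite (weight_set g u L v)" if "finite L" "L \<subseteq> insert k K" for L v
    by (rule finite_weight_set[OF that(1)]) (use assms(3) that(2) in blast)
  have "finite ?K" "?K \<subseteq> insert k K" using assms(1) by auto
  then have fin: "finite (weight_set g u K w)" "finite (weight_set g u ?K (w - u k))"
    using * assms(1) by blast+
  let ?A = "add_mset k ` weight_set g u ?K (w - u k)"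
  let ?f = "\<lambda>m. (- 1) ^ (\<Sum>k\<in>#m. g k) :: rat"
  have disj: "weight_set g u K w \<inter> ?A = {}"
  proof (rule equals0I, elim IntE imageE)
    fix m m' assume "m \<in> weight_set g u K w" "m = add_mset k m'"
    then have "k \<in> K" unfolding weight_set_def monomials_def by simp
    then show False using assms(2) by simp
  qed
  have "(\<Sum>m\<in>?A. ?f m) = (\<Sum>m\<in>weight_set g u ?K (w - u k). ?f (add_mset k m))"
    by (subst sum.reindex) (auto simp: inj_on_def)
  also have "\<dots> = (- 1) ^ g k * signed_count g u ?K (w - u k)"
    unfolding signed_count_def sum_distrib_left by (simp only: image_mset_add_mset sum_mset.add_mset power_add)
  finally have A: "(\<Sum>m\<in>?A. ?f m) = (- 1) ^ g k * signed_count g u ?K (w - u k)" .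
  show ?thesis
  proof (cases "u k \<le> w")
    case True
    have "signed_count g u (insert k K) w = (\<Sum>m\<in>weight_set g u K w \<union> ?A. ?f m)"
      unfolding signed_count_def weight_set_insert[OF assms(2)] using True by (simp only: if_True)
    also have "\<dots> = signed_count g u K w + (\<Sum>m\<in>?A. ?f m)"
      unfolding signed_count_def[of g u K]
      by (rule sum.union_disjoint[OF fin(1) finite_imageI[OF fin(2)] disj])
    finally show ?thesis unfolding A using True by (simp only: if_True)
  next
    case False
    then show ?thesis
      unfolding signed_count_def weight_set_insert[OF assms(2)] by (simp only: if_False Un_empty_right add_0_right)
  qed
qed

text \<open>An odd generator multiplies the series by \<open>1 - X ^ u k\<close>. For an even one
  the new series \<open>B\<close> satisfies \<open>B = A + X ^ u k * B\<close>, which amounts to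
  division by the same factor.\<close>

lemma signed_count_series:
  assumes "finite K" "\<And>j. j \<in> K \<Longrightarrow> 0 < u j"
  shows "Abs_fps (signed_count g u K) * (\<Prod>k\<in>{k \<in> K. even (g k)}. 1 - fps_X ^ u k) =
    (\<Prod>k\<in>{k \<in> K. odd (g k)}. 1 - fps_X ^ u k)"
  using assms
proof (induction K)
  case empty
  have "weight_set g u {} w = (if w = 0 then {{#}} else {})" for w
    by (auto simp: weight_set_def monomials_def)
  then have "Abs_fps (signed_count g u {}) = 1"
    by (intro fps_ext) (simp add: signed_count_def)
  then show ?case by simp
next
  case (insert k K)
  define A where "A = Abs_fps (signed_count g u K)"
  define B where "B = Abs_fps (signed_count g u (insert k K))"
  have shift: "fps_nth (fps_X ^ u k * f) w = (if u k \<le> w then fps_nth f (w - u k) else 0)" for w and f :: "rat fps"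
    by (simp add: fps_X_power_mult_nth)
  have step: "signed_count g u (insert k K) w = signed_count g u K w +
    (if u k \<le> w then (- 1) ^ g k * signed_count g u (if odd (g k) then K else insert k K) (w - u k) else 0)"
    for w by (rule signed_count_insert) (use insert in auto)
  have IH: "A * (\<Prod>k\<in>{k \<in> K. even (g k)}. 1 - fps_X ^ u k) = (\<Prod>k\<in>{k \<in> K. odd (g k)}. 1 - fps_X ^ u k)"
    unfolding A_def using insert by auto
  show ?case
  proof (cases "odd (g k)")
    case True
    have "B = A - fps_X ^ u k * A"
      by (intro fps_ext) (use True in \<open>simp add: A_def B_def shift step\<close>)
    then have AB: "B = (1 - fps_X ^ u k) * A" by (simp add: algebra_simps)
    have "{j \<in> insert k K. even (g j)} = {j \<in> K. even (g j)}"
      "{j \<in> insert k K. odd (g j)} = insert k {j \<in> K. odd (g j)}" using True by auto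
    then show ?thesis using IH insert.hyps unfolding B_def[symmetric] AB by (simp add: mult.assoc)
  next
    case False
    have "B = A + fps_X ^ u k * B"
    proof (rule fps_ext)
      fix w show "fps_nth B w = fps_nth (A + fps_X ^ u k * B) w"
        using step[of w] False unfolding A_def B_def by (simp add: shift)
    qed
    then have AB: "A = B * (1 - fps_X ^ u k)" by (simp add: algebra_simps)
    have "{j \<in> insert k K. odd (g j)} = {j \<in> K. odd (g j)}"
      "{j \<in> insert k K. even (g j)} = insert k {j \<in> K. even (g j)}" using False by auto
    then show ?thesis using IH insert.hyps unfolding B_def[symmetric] AB by (simp add: mult.assoc)
  qed
qed

text \<open>
  A rational function with these numerator and denominator is a polynomial only if its order at
  \<open>1\<close> is not negative.
\<close>

lemma even_le_odd:
  assumes "finite K" "\<And>j. j \<in> K \<Longrightarrow> 0 < u j" "\<And>w. w > W \<Longrightarrow> signed_count g u K w = 0"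
  shows "card {k \<in> K. even (g k)} \<le> card {k \<in> K. odd (g k)}"
proof (rule ccontr)
  let ?E = "{k \<in> K. even (g k)}" and ?O = "{k \<in> K. odd (g k)}"
  assume "\<not> ?thesis"
  then have lt: "card ?O < card ?E" by simp
  define P where "P = Poly (map (signed_count g u K) [0..<Suc W])"
  define X where "X = monom (1::rat) 1"
  define S where "S k = (\<Sum>i<u k. X ^ i)" for k
  have P: "fps_of_poly P = Abs_fps (signed_count g u K)"
  proof (rule fps_ext)
    fix n show "fps_nth (fps_of_poly P) n = fps_nth (Abs_fps (signed_count g u K)) n"
      unfolding P_def using assms(3)[of n] by (auto simp: nth_default_def simp del: upt_Suc)
  qed
  have X: "fps_of_poly X = fps_X" unfolding X_def by (simp add: fps_of_poly_monom')
  have "fps_of_poly (P * (\<Prod>k\<in>?E. 1 - X ^ u k)) = fps_of_poly (\<Prod>k\<in>?O. 1 - X ^ u k)"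
    using signed_count_series[OF assms(1,2), where g = g]
    by (simp add: fps_of_poly_mult fps_of_poly_prod fps_of_poly_diff fps_of_poly_power P X)
  then have "P * (\<Prod>k\<in>?E. 1 - X ^ u k) = (\<Prod>k\<in>?O. 1 - X ^ u k)" by (simp only: fps_of_poly_eq_iff)
  \<comment> \<open>Each \<open>1 - X ^ u k\<close> is \<open>1 - X\<close> times
    \<open>S k\<close>, and \<open>S k\<close> has the value \<open>u k\<close> at 1. After
    cancellation a positive power of \<open>1 - X\<close> is left on one side only, and evaluation
    at 1 equates 0 with a product of positive weights.\<close>
  then have "P * ((1 - X) ^ card ?E * (\<Prod>k\<in>?E. S k)) = (1 - X) ^ card ?O * (\<Prod>k\<in>?O. S k)"
    unfolding S_def one_diff_power_eq prod.distrib by simp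
  moreover have "(1 - X) ^ card ?E = (1 - X) ^ card ?O * (1 - X) ^ (card ?E - card ?O)"
    using lt by (simp flip: power_add)
  ultimately have "(1 - X) ^ card ?O * (P * (1 - X) ^ (card ?E - card ?O) * (\<Prod>k\<in>?E. S k)) =
    (1 - X) ^ card ?O * (\<Prod>k\<in>?O. S k)" by (simp add: mult_ac)
  moreover have "coeff (1 - X) 0 \<noteq> 0" unfolding X_def by simp
  then have "1 - X \<noteq> 0" by (metis coeff_0)
  ultimately have "P * (1 - X) ^ (card ?E - card ?O) * (\<Prod>k\<in>?E. S k) = (\<Prod>k\<in>?O. S k)" by simp
  then have "poly (P * (1 - X) ^ (card ?E - card ?O) * (\<Prod>k\<in>?E. S k)) 1 = poly (\<Prod>k\<in>?O. S k) 1" by simp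
  moreover have "poly X 1 = 1" unfolding X_def by (simp add: poly_monom)
  ultimately have "0 = (\<Prod>k\<in>?O. of_nat (u k) :: rat)"
    using zero_power[of "card ?E - card ?O", where 'a = rat] lt
    by (simp add: poly_prod S_def poly_sum del: power_eq_0_iff)
  then obtain k where "k \<in> ?O" "u k = 0" using assms(1) by (auto simp: prod_zero_iff)
  then show False using assms(2)[of k] by simp
qed

section \<open>Monomial bases\<close>

locale generated_algebra = rat_algebra scale
  for scale :: "rat \<Rightarrow> 'a::ring_1 \<Rightarrow> 'a" +
  fixes v :: "nat \<Rightarrow> 'a" and g :: "nat \<Rightarrow> nat" and N :: nat
  assumes comm: "j < N \<Longrightarrow> k < N \<Longrightarrow> v j * v k = (- 1) ^ (g j * g k) * (v k * v j)"
begin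

abbreviation E :: "nat multiset set" where "E \<equiv> monomials g {..<N}"

definition M :: "nat multiset \<Rightarrow> 'a" where
  "M m = prod_list (map v (sorted_list_of_multiset m))"

lemma comm_sign: "j < N \<Longrightarrow> k < N \<Longrightarrow> v j * v k = v k * v j \<or> v j * v k = - (v k * v j)"
  using comm[of j k] by (cases "even (g j * g k)") auto

lemma swap_sign:
  assumes "j < N" "k < N"
  shows "v k * (v j * x) = v j * (v k * x) \<or> v k * (v j * x) = - (v j * (v k * x))"
  using comm_sign[OF assms(2,1)]
proof
  assume "v k * v j = v j * v k"
  then show ?thesis by (simp flip: mult.assoc)
next
  assume "v k * v j = - (v j * v k)"
  then have "(v k * v j) * x = - (v j * v k) * x" by (rule arg_cong)
  then show ?thesis by (simp add: mult.assoc)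
qed

lemma square_zero:
  assumes "k < N" "odd (g k)"
  shows "v k * v k = 0"
proof -
  have "odd (g k * g k)" using assms(2) by simp
  then have "v k * v k = - (v k * v k)" using comm[OF assms(1,1)] by simp
  then have "v k * v k + v k * v k = 0" by (metis add.right_inverse)
  moreover have "v k * v k + v k * v k = scale 2 (v k * v k)"
    using scale_left_distrib[of 1 1 "v k * v k"] by simp
  ultimately show ?thesis using scale_eq_0_iff[of 2 "v k * v k"] by simp
qed

lemma mult_product_zero:
  assumes "k < N" "odd (g k)" "set js \<subseteq> {..<N}" "k \<in> set js"
  shows "v k * prod_list (map v js) = 0"
  using assms(3,4)
proof (induction js)
  case (Cons j js)
  have a: "v k * prod_list (map v (j # js)) = (v k * v j) * prod_list (map v js)" by (simp add: mult.assoc)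
  show ?case
  proof (cases "j = k")
    case True
    then show ?thesis unfolding a using square_zero[OF assms(1,2)] by simp
  next
    case False
    then have "v k * prod_list (map v js) = 0" using Cons by auto
    then show ?thesis using swap_sign[of j k "prod_list (map v js)"] assms(1) Cons.prems by auto
  qed
qed simp

lemma mult_product_insort:
  assumes "k < N" "set js \<subseteq> {..<N}"
  shows "v k * prod_list (map v js) = prod_list (map v (insort k js)) \<or>
    v k * prod_list (map v js) = - prod_list (map v (insort k js))"
  using assms(2)
proof (induction js)
  case (Cons j js)
  show ?case
  proof (cases "k \<le> j")
    case True
    then show ?thesis by simp
  next
    case False
    have "v k * prod_list (map v (j # js)) = v j * (v k * prod_list (map v js)) \<or>
      v k * prod_list (map v (j # js)) = - (v j * (v k * prod_list (map v js)))"
      using swap_sign assms(1) Cons.prems by auto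
    moreover have "v k * prod_list (map v js) = prod_list (map v (insort k js)) \<or>
      v k * prod_list (map v js) = - prod_list (map v (insort k js))" using Cons by auto
    ultimately show ?thesis using False by auto
  qed
qed simp

text \<open>The Koszul sign is left undetermined, as spans and the vanishing of coefficients do not
  depend on it.\<close>

lemma gen_mult_M:
  assumes "k < N" "m \<in> E"
  shows "add_mset k m \<in> E \<Longrightarrow> v k * M m = M (add_mset k m) \<or> v k * M m = - M (add_mset k m)"
    and "add_mset k m \<notin> E \<Longrightarrow> v k * M m = 0"
proof -
  have m: "set (sorted_list_of_multiset m) \<subseteq> {..<N}" using assms(2) unfolding monomials_def by auto
  show "v k * M m = M (add_mset k m) \<or> v k * M m = - M (add_mset k m)"
    using mult_product_insort[OF assms(1) m] unfolding M_def by simp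
  assume a: "add_mset k m \<notin> E"
  then obtain j where j: "odd (g j)" "1 < count (add_mset k m) j"
    using assms unfolding monomials_def by fastforce
  moreover have "count m j \<le> 1" using assms(2) j(1) unfolding monomials_def by auto
  ultimately have "j = k" "k \<in># m" by (auto split: if_splits simp: count_eq_zero_iff)
  then show "v k * M m = 0" using mult_product_zero[OF assms(1) _ m] j(1) unfolding M_def by auto
qed

lemma M_empty: "M {#} = 1" unfolding M_def by simp

text \<open>One definition for both gradings: \<open>f = g\<close> gives the degree and the constant
  function 1 the wordlength.\<close>

definition F :: "(nat \<Rightarrow> nat) \<Rightarrow> nat \<Rightarrow> 'a set" where
  "F f i = span (M ` {m \<in> E. (\<Sum>k\<in>#m. f k) = i})"

lemma subspace_F: "subspace (F f i)" unfolding F_def by (rule subspace_span)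

lemma mult_right_span:
  assumes "\<And>x. x \<in> A \<Longrightarrow> x * y \<in> S" "subspace S" "z \<in> span A"
  shows "z * y \<in> S"
  using assms(3)
proof (induction rule: span_induct_alt)
  case base
  then show ?case using subspace_0[OF assms(2)] by simp
next
  case (step c x z)
  have "(scale c x + z) * y = scale c (x * y) + z * y" by (simp add: distrib_right scale_mult_left)
  then show ?case using assms(1)[OF step(1)] step(2) assms(2) subspace_add subspace_scale by metis
qed

lemma mult_left_span:
  assumes "\<And>x. x \<in> A \<Longrightarrow> y * x \<in> S" "subspace S" "z \<in> span A"
  shows "y * z \<in> S"
  using assms(3)
proof (induction rule: span_induct_alt)
  case base
  then show ?case using subspace_0[OF assms(2)] by simp
next
  case (step c x z)
  have "y * (scale c x + z) = scale c (y * x) + y * z" by (simp add: distrib_left scale_mult_right)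
  then show ?case using assms(1)[OF step(1)] step(2) assms(2) subspace_add subspace_scale by metis
qed

lemma gen_mult_F:
  assumes "k < N" "x \<in> F f i"
  shows "v k * x \<in> F f (i + f k)"
proof (rule mult_left_span[OF _ subspace_F assms(2)[unfolded F_def]])
  fix y assume "y \<in> M ` {m \<in> E. (\<Sum>k\<in>#m. f k) = i}"
  then obtain m where m: "m \<in> E" "(\<Sum>k\<in>#m. f k) = i" "y = M m" by blast
  show "v k * y \<in> F f (i + f k)"
  proof (cases "add_mset k m \<in> E")
    case True
    then have "M (add_mset k m) \<in> F f (i + f k)" unfolding F_def using m by (intro span_base) auto
    then show ?thesis using gen_mult_M(1)[OF assms(1) m(1) True] subspace_neg[OF subspace_F] m(3) by auto
  next
    case False
    then show ?thesis using gen_mult_M(2)[OF assms(1) m(1)] m(3) subspace_0[OF subspace_F] by simp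
  qed
qed

lemma one_F: "1 \<in> F f 0"
  unfolding F_def using M_empty by (intro span_base) (auto simp: monomials_def image_iff intro!: exI[of _ "{#}"])

lemma product_mult_F:
  "set js \<subseteq> {..<N} \<Longrightarrow> x \<in> F f i \<Longrightarrow> prod_list (map v js) * x \<in> F f ((\<Sum>k\<leftarrow>js. f k) + i)"
proof (induction js)
  case (Cons j js)
  then have "v j * (prod_list (map v js) * x) \<in> F f ((\<Sum>k\<leftarrow>js. f k) + i + f j)" by (intro gen_mult_F) auto
  then show ?case by (simp add: mult.assoc add_ac)
qed simp

lemma M_mult_F:
  assumes "m \<in> E" "x \<in> F f i"
  shows "M m * x \<in> F f ((\<Sum>k\<in>#m. f k) + i)"
proof -
  have "(\<Sum>k\<leftarrow>sorted_list_of_multiset m. f k) = (\<Sum>k\<in>#m. f k)"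
    by (metis mset_map mset_sorted_list_of_multiset sum_mset_sum_list)
  moreover have "set (sorted_list_of_multiset m) \<subseteq> {..<N}" using assms(1) unfolding monomials_def by auto
  ultimately show ?thesis using product_mult_F[OF _ assms(2)] unfolding M_def by metis
qed

lemma mult_F:
  assumes "x \<in> F f i" "y \<in> F f j"
  shows "x * y \<in> F f (i + j)"
proof (rule mult_right_span[OF _ subspace_F assms(1)[unfolded F_def]])
  fix z assume "z \<in> M ` {m \<in> E. (\<Sum>k\<in>#m. f k) = i}"
  then show "z * y \<in> F f (i + j)" using M_mult_F[OF _ assms(2)] by auto
qed

lemma gen_F:
  assumes "k < N"
  shows "v k \<in> F f (f k)"
  using gen_mult_F[OF assms one_F] by simp

lemma prod_list_F: "list_all2 (\<lambda>n x. x \<in> F f n) ns xs \<Longrightarrow> prod_list xs \<in> F f (sum_list ns)"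
  by (induction rule: list_all2_induct) (auto intro: mult_F one_F)

end

locale monomial_algebra = generated_algebra +
  assumes M_inj: "inj_on M E" and M_independent: "independent (M ` E)" and M_span: "span (M ` E) = UNIV"
begin

definition cf :: "nat multiset \<Rightarrow> 'a \<Rightarrow> rat" where
  "cf m x = representation (M ` E) x (M m)"

lemma cf_lin: "cf m (x + y) = cf m x + cf m y" "cf m (scale c x) = c * cf m x" "cf m 0 = 0"
  "cf m (x - y) = cf m x - cf m y" "cf m (- x) = - cf m x"
  unfolding cf_def using M_independent M_span
  by (simp_all add: representation_add representation_scale representation_diff representation_neg representation_zero)

lemma cf_sum: "cf m (sum f A) = (\<Sum>a\<in>A. cf m (f a))"
  by (induction A rule: infinite_finite_induct) (simp_all add: cf_lin)

lemma cf_M: "m \<in> E \<Longrightarrow> m' \<in> E \<Longrightarrow> cf m (M m') = (if m = m' then 1 else 0)"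
  unfolding cf_def using representation_basis[OF M_independent, of "M m'"] inj_on_eq_iff[OF M_inj] by auto

lemma finite_cf: "finite {m \<in> E. cf m x \<noteq> 0}"
proof (rule finite_imageD)
  have "M ` {m \<in> E. cf m x \<noteq> 0} \<subseteq> {b. representation (M ` E) x b \<noteq> 0}" unfolding cf_def by auto
  then show "finite (M ` {m \<in> E. cf m x \<noteq> 0})" using finite_representation finite_subset by blast
  show "inj_on M {m \<in> E. cf m x \<noteq> 0}" using M_inj by (rule inj_on_subset) auto
qed

lemma expansion: "x = (\<Sum>m | m \<in> E \<and> cf m x \<noteq> 0. scale (cf m x) (M m))"
proof -
  have "{b. representation (M ` E) x b \<noteq> 0} = M ` {m \<in> E. cf m x \<noteq> 0}"
    unfolding cf_def using representation_ne_zero by blast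
  moreover have "inj_on M {m \<in> E. cf m x \<noteq> 0}" using M_inj by (rule inj_on_subset) auto
  moreover have "(\<Sum>b | representation (M ` E) x b \<noteq> 0. scale (representation (M ` E) x b) b) = x"
    by (rule sum_nonzero_representation_eq[OF M_independent]) (use M_span in auto)
  ultimately show ?thesis by (simp add: sum.reindex cf_def)
qed

lemma cf_eqI: "(\<And>m. m \<in> E \<Longrightarrow> cf m x = cf m y) \<Longrightarrow> x = y"
proof -
  assume *: "\<And>m. m \<in> E \<Longrightarrow> cf m x = cf m y"
  have "x - y = (\<Sum>m | m \<in> E \<and> cf m (x - y) \<noteq> 0. scale (cf m (x - y)) (M m))" by (rule expansion)
  moreover have "{m. m \<in> E \<and> cf m (x - y) \<noteq> 0} = {}" using * by (auto simp: cf_lin)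
  ultimately have "x - y = 0" by (metis sum.empty)
  then show "x = y" by simp
qed

lemma span_M_iff:
  assumes "S \<subseteq> E"
  shows "x \<in> span (M ` S) \<longleftrightarrow> (\<forall>m\<in>E. cf m x \<noteq> 0 \<longrightarrow> m \<in> S)"
proof
  assume "x \<in> span (M ` S)"
  then show "\<forall>m\<in>E. cf m x \<noteq> 0 \<longrightarrow> m \<in> S"
  proof (induction rule: span_induct_alt)
    case (step c b y)
    then obtain m' where "m' \<in> S" "b = M m'" by blast
    then show ?case using step(2) assms cf_M by (auto simp: cf_lin split: if_splits)
  qed (simp add: cf_lin)
next
  assume *: "\<forall>m\<in>E. cf m x \<noteq> 0 \<longrightarrow> m \<in> S"
  have "(\<Sum>m | m \<in> E \<and> cf m x \<noteq> 0. scale (cf m x) (M m)) \<in> span (M ` S)"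
    using * by (intro span_sum span_scale span_base) auto
  then show "x \<in> span (M ` S)" using expansion by simp
qed

lemma F_iff: "x \<in> F f i \<longleftrightarrow> (\<forall>m\<in>E. cf m x \<noteq> 0 \<longrightarrow> (\<Sum>k\<in>#m. f k) = i)"
  unfolding F_def by (subst span_M_iff) auto

lemma linear_eqI:
  assumes "Vector_Spaces.linear scale scale p" "Vector_Spaces.linear scale scale q"
    and "\<And>m. m \<in> E \<Longrightarrow> p (M m) = q (M m)"
  shows "p x = q x"
proof -
  interpret p: Vector_Spaces.linear scale scale p by (rule assms(1))
  interpret q: Vector_Spaces.linear scale scale q by (rule assms(2))
  have "x \<in> span (M ` E)" using M_span by simp
  then show ?thesis
    by (induction rule: span_induct_alt) (auto simp: assms(3) p.add q.add p.scale q.scale p.zero q.zero)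
qed

section \<open>Bihomogeneous projections and monomial ideals\<close>

definition S :: "int \<Rightarrow> int \<Rightarrow> nat multiset set" where
  "S i p = {m \<in> E. int (\<Sum>k\<in>#m. g k) = i \<and> int (size m) = p}"

definition pr :: "int \<Rightarrow> int \<Rightarrow> 'a \<Rightarrow> 'a" where
  "pr i p x = (\<Sum>m\<in>S i p. scale (cf m x) (M m))"

text \<open>For \<open>k \<le> N\<close>, the ideal of the first \<open>k\<close> generators. It is
  a monomial ideal, so membership can be read off the monomials that occur.\<close>

definition I :: "nat \<Rightarrow> 'a set" where
  "I k = {x. \<forall>m\<in>E. cf m x \<noteq> 0 \<longrightarrow> (\<exists>j<k. j \<in># m)}"

lemma finite_S: "finite (S i p)"
proof (rule finite_subset)
  show "S i p \<subseteq> {m. set_mset m \<subseteq> {..<N} \<and> size m \<le> nat p}" unfolding S_def monomials_def by auto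
qed (simp add: finite_bounded_multisets)

lemma cf_pr: "m \<in> E \<Longrightarrow> cf m (pr i p x) = (if m \<in> S i p then cf m x else 0)"
proof -
  assume m: "m \<in> E"
  have "cf m (pr i p x) = (\<Sum>m'\<in>S i p. if m' = m then cf m x else 0)"
    unfolding pr_def cf_sum using m by (intro sum.cong) (auto simp: cf_lin cf_M S_def)
  then show ?thesis using finite_S by (simp add: sum.delta')
qed

lemma linear_pr: "Vector_Spaces.linear scale scale (pr i p)"
  unfolding Vector_Spaces.linear_iff
proof (intro conjI allI)
  show "pr i p (x + y) = pr i p x + pr i p y" for x y by (rule cf_eqI) (simp add: cf_pr cf_lin)
  show "pr i p (scale c x) = scale c (pr i p x)" for c x by (rule cf_eqI) (simp add: cf_pr cf_lin)
qed (rule vector_space_axioms)+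

lemma linear_mult: "Vector_Spaces.linear scale scale ((*) y)"
  unfolding Vector_Spaces.linear_iff
  by (auto simp: distrib_left scale_mult_right intro: vector_space_axioms)

lemma pr_eq:
  assumes "x \<in> F g i'" "x \<in> F (\<lambda>_. 1) p'"
  shows "pr i p x = (if i = int i' \<and> p = int p' then x else 0)"
  by (rule cf_eqI) (use assms in \<open>auto simp: cf_pr cf_lin F_iff S_def\<close>)

lemma subspace_I: "subspace (I k)"
  unfolding subspace_def
proof (intro conjI allI ballI)
  show "0 \<in> I k" by (simp add: I_def cf_lin)
  show "x + y \<in> I k" if "x \<in> I k" "y \<in> I k" for x y
    unfolding I_def
  proof (intro CollectI ballI impI)
    fix m assume m: "m \<in> E" "cf m (x + y) \<noteq> 0"
    then have "cf m x \<noteq> 0 \<or> cf m y \<noteq> 0" by (auto simp: cf_lin)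
    then show "\<exists>j<k. j \<in># m" using that m(1) unfolding I_def by blast
  qed
  show "scale c x \<in> I k" if "x \<in> I k" for c x using that by (auto simp: I_def cf_lin)
qed

text \<open>Adding \<open>k\<close> is injective on monomials, so each coefficient of
  \<open>v k * x\<close> comes from at most one coefficient of \<open>x\<close>, up to sign.\<close>

lemma cf_gen_mult:
  assumes "k < N" "m \<in> E"
  shows "k \<notin># m \<Longrightarrow> cf m (v k * x) = 0"
    and "add_mset k m \<in> E \<Longrightarrow> cf (add_mset k m) (v k * x) = 0 \<longleftrightarrow> cf m x = 0"
proof -
  interpret m: Vector_Spaces.linear scale scale "(*) (v k)" by (rule linear_mult)
  have x: "x \<in> span (M ` E)" using M_span by simp
  show "cf m (v k * x) = 0" if "k \<notin># m"
    using x
  proof (induction rule: span_induct_alt)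
    case (step c b y)
    then obtain m' where m': "m' \<in> E" "b = M m'" by blast
    have "cf m (v k * b) = 0"
    proof (cases "add_mset k m' \<in> E")
      case True
      then show ?thesis using gen_mult_M(1)[OF assms(1) m'(1) True] cf_M[OF assms(2) True] that m'(2)
        by (auto simp: cf_lin)
    next
      case False
      then show ?thesis using gen_mult_M(2)[OF assms(1) m'(1) False] m'(2) by (simp add: cf_lin)
    qed
    then show ?case using step(2) by (simp add: m.add m.scale cf_lin)
  qed (simp add: cf_lin)
  assume km: "add_mset k m \<in> E"
  obtain \<sigma> where \<sigma>: "\<sigma> = 1 \<or> \<sigma> = - 1" "cf (add_mset k m) (v k * M m) = \<sigma>"
    using gen_mult_M(1)[OF assms km] cf_M[OF km km] by (auto simp: cf_lin)
  have "cf (add_mset k m) (v k * x) = \<sigma> * cf m x"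
    using x
  proof (induction rule: span_induct_alt)
    case (step c b y)
    then obtain m' where m': "m' \<in> E" "b = M m'" by blast
    have "cf (add_mset k m) (v k * b) = \<sigma> * cf m b"
    proof (cases "m' = m")
      case True
      then show ?thesis using \<sigma>(2) m'(2) cf_M[OF assms(2,2)] by simp
    next
      case False
      then have 0: "cf m b = 0" using cf_M[OF assms(2) m'(1)] m'(2) by auto
      show ?thesis
      proof (cases "add_mset k m' \<in> E")
        case True
        then show ?thesis using gen_mult_M(1)[OF assms(1) m'(1) True] cf_M[OF km True] False m'(2) 0
          by (auto simp: cf_lin)
      next
        case False
        then show ?thesis using gen_mult_M(2)[OF assms(1) m'(1) False] m'(2) 0 by (simp add: cf_lin)
      qed
    qed
    then show ?case using step(2) by (simp add: m.add m.scale cf_lin algebra_simps)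
  qed (simp add: cf_lin)
  then show "cf (add_mset k m) (v k * x) = 0 \<longleftrightarrow> cf m x = 0" using \<sigma>(1) by auto
qed

lemma submonomial: "add_mset k m \<in> E \<Longrightarrow> m \<in> E"
proof -
  assume a: "add_mset k m \<in> E"
  have "count m j \<le> 1" if "odd (g j)" for j
  proof -
    have "count m j \<le> count (add_mset k m) j" by simp
    also have "\<dots> \<le> 1" using a that unfolding monomials_def by blast
    finally show ?thesis .
  qed
  then show "m \<in> E" using a unfolding monomials_def by auto
qed

lemma add_mset_E: "k < N \<Longrightarrow> m \<in> E \<Longrightarrow> add_mset k m \<in> E \<longleftrightarrow> even (g k) \<or> k \<notin># m"
  unfolding monomials_def by (auto simp: count_eq_zero_iff[symmetric])

text \<open>Multiplication by an odd generator kills exactly the monomials that already contain it;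
  an even generator kills none.\<close>

lemma mult_I:
  assumes "k < N"
  shows "v k * x \<in> I k \<longleftrightarrow> x \<in> (if odd (g k) then I (Suc k) else I k)"
proof -
  have "v k * x \<in> I k \<longleftrightarrow> (\<forall>m\<in>E. add_mset k m \<in> E \<longrightarrow> cf m x \<noteq> 0 \<longrightarrow> (\<exists>j<k. j \<in># m))"
  proof
    assume a: "v k * x \<in> I k"
    show "\<forall>m\<in>E. add_mset k m \<in> E \<longrightarrow> cf m x \<noteq> 0 \<longrightarrow> (\<exists>j<k. j \<in># m)"
    proof (intro ballI impI)
      fix m assume m: "m \<in> E" "add_mset k m \<in> E" "cf m x \<noteq> 0"
      then have "\<exists>j<k. j \<in># add_mset k m" using a cf_gen_mult(2)[OF assms m(1,2)] unfolding I_def by blast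
      then show "\<exists>j<k. j \<in># m" by auto
    qed
  next
    assume a: "\<forall>m\<in>E. add_mset k m \<in> E \<longrightarrow> cf m x \<noteq> 0 \<longrightarrow> (\<exists>j<k. j \<in># m)"
    show "v k * x \<in> I k" unfolding I_def
    proof (intro CollectI ballI impI)
      fix m assume m: "m \<in> E" "cf m (v k * x) \<noteq> 0"
      then have "k \<in># m" using cf_gen_mult(1)[OF assms m(1)] by blast
      then obtain m' where m': "m = add_mset k m'" by (metis insert_DiffM)
      then have "m' \<in> E" using submonomial m(1) by blast
      then have "\<exists>j<k. j \<in># m'" using a cf_gen_mult(2)[OF assms] m m' by blast
      then show "\<exists>j<k. j \<in># m" using m' by auto
    qed
  qed
  also have "\<dots> \<longleftrightarrow> x \<in> (if odd (g k) then I (Suc k) else I k)"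
  proof (cases "odd (g k)")
    case True
    have "x \<in> I (Suc k) \<longleftrightarrow> (\<forall>m\<in>E. cf m x \<noteq> 0 \<longrightarrow> k \<in># m \<or> (\<exists>j<k. j \<in># m))"
      unfolding I_def less_Suc_eq by blast
    then show ?thesis using add_mset_E[OF assms] True by (simp only: if_True simp_thms) blast
  next
    case False
    then show ?thesis using add_mset_E[OF assms] unfolding I_def by (simp only: if_False simp_thms) blast
  qed
  finally show ?thesis .
qed

lemma I_mono: "x \<in> I k \<Longrightarrow> x \<in> I (Suc k)"
  unfolding I_def using less_Suc_eq by blast

lemma mult_I_Suc: "k < N \<Longrightarrow> v k * x \<in> I (Suc k)"
  unfolding I_def using cf_gen_mult(1) by blast

lemma I_Suc:
  assumes k: "k < N"
  shows "x \<in> I (Suc k) \<longleftrightarrow> (\<exists>a. x - v k * a \<in> I k)"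
proof
  assume "\<exists>a. x - v k * a \<in> I k"
  then obtain a where "x - v k * a \<in> I k" by blast
  then have "x - v k * a + v k * a \<in> I (Suc k)"
    using I_mono mult_I_Suc[OF k] subspace_add[OF subspace_I] by blast
  then show "x \<in> I (Suc k)" by simp
next
  let ?S = "{m \<in> E. \<exists>j<Suc k. j \<in># m}"
  assume "x \<in> I (Suc k)"
  then have "x \<in> span (M ` ?S)" unfolding I_def by (subst span_M_iff) auto
  then show "\<exists>a. x - v k * a \<in> I k"
  proof (induction rule: span_induct_alt)
    case base
    then show ?case using subspace_0[OF subspace_I] by (auto intro!: exI[of _ 0])
  next
    case (step c b y)
    then obtain m where m: "m \<in> ?S" "b = M m" by blast
    have "\<exists>a. b - v k * a \<in> I k"
    proof (cases "k \<in># m")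
      case True
      then obtain m' where m': "m = add_mset k m'" by (metis insert_DiffM)
      then have "m' \<in> E" using submonomial m(1) by blast
      then have "b = v k * M m' \<or> b = v k * (- M m')"
        using gen_mult_M(1)[OF k, of m'] m m' by auto
      then obtain a where "b = v k * a" by blast
      then have "b - v k * a \<in> I k" using subspace_0[OF subspace_I] by simp
      then show ?thesis by blast
    next
      case False
      then have "\<exists>j<k. j \<in># m" using m(1) less_Suc_eq by auto
      then have "b \<in> I k" unfolding I_def m(2) using m(1) cf_M by auto
      then show ?thesis by (intro exI[of _ 0]) simp
    qed
    then obtain a where a: "b - v k * a \<in> I k" by blast
    obtain a' where a': "y - v k * a' \<in> I k" using step(2) by blast
    have "scale c b + y - v k * (scale c a + a') = scale c (b - v k * a) + (y - v k * a')"
      by (simp add: scale_right_diff_distrib distrib_left scale_mult_right)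
    then have "scale c b + y - v k * (scale c a + a') \<in> I k"
      by (simp only: subspace_add[OF subspace_I subspace_scale[OF subspace_I a] a'])
    then show ?case by blast
  qed
qed

lemma I_0: "I 0 = {0}"
proof (intro equalityI subsetI)
  fix x assume "x \<in> I 0"
  then have "cf m x = cf m 0" if "m \<in> E" for m using that unfolding I_def by (auto simp: cf_lin)
  then have "x = 0" by (rule cf_eqI)
  then show "x \<in> {0}" by simp
qed (simp add: subspace_0[OF subspace_I])

lemma I_right_ideal: "k \<le> N \<Longrightarrow> x \<in> I k \<Longrightarrow> x * y \<in> I k"
proof (induction k arbitrary: x)
  case 0
  then show ?case by (simp add: I_0)
next
  case (Suc k)
  then have k: "k < N" by simp
  then obtain a where "x - v k * a \<in> I k" using Suc.prems I_Suc by blast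
  then have "(x - v k * a) * y \<in> I k" using Suc k by simp
  then have "x * y - v k * (a * y) \<in> I k" by (simp add: left_diff_distrib mult.assoc)
  then show ?case using I_Suc[OF k] by blast
qed

lemma pr_I: "x \<in> I k \<Longrightarrow> pr i p x \<in> I k"
  unfolding I_def by (auto simp: cf_pr)

lemma range_pr: "range (pr i p) = span (M ` S i p)"
proof
  show "range (pr i p) \<subseteq> span (M ` S i p)"
  proof clarify
    fix x show "pr i p x \<in> span (M ` S i p)"
      unfolding pr_def by (rule span_sum) (simp add: span_scale span_base)
  qed
  show "span (M ` S i p) \<subseteq> range (pr i p)"
  proof
    fix x assume "x \<in> span (M ` S i p)"
    then have "\<forall>m\<in>E. cf m x \<noteq> 0 \<longrightarrow> m \<in> S i p" by (subst (asm) span_M_iff) (auto simp: S_def)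
    then have "pr i p x = x" by (intro cf_eqI) (auto simp: cf_pr)
    then show "x \<in> range (pr i p)" by (metis rangeI)
  qed
qed

lemma dim_range_pr: "dim (range (pr i p)) = card (S i p)"
proof -
  have "S i p \<subseteq> E" unfolding S_def by auto
  then have "independent (M ` S i p)" "inj_on M (S i p)"
    using independent_mono[OF M_independent image_mono] inj_on_subset[OF M_inj] by blast+
  then show ?thesis unfolding range_pr by (simp add: dim_eq_card_independent card_image)
qed

end

locale homogeneous_derivation = monomial_algebra +
  fixes d :: "'a \<Rightarrow> 'a" and l :: nat
  assumes d_linear: "Vector_Spaces.linear scale scale d"
    and d_one: "d 1 = 0"
    and d_gen_mult: "k < N \<Longrightarrow> d (v k * x) = d (v k) * x + (- 1) ^ g k * (v k * d x)"
    and d_gen: "k < N \<Longrightarrow> d (v k) \<in> F g (Suc (g k))" "k < N \<Longrightarrow> d (v k) \<in> F (\<lambda>_. 1) l"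
    and l2: "2 \<le> l"
begin

declare of_nat_sum_mset [simp del]

lemma d_product_F:
  assumes "set js \<subseteq> {..<N}"
  shows "d (prod_list (map v js)) \<in> F g (Suc (\<Sum>k\<leftarrow>js. g k)) \<and>
    d (prod_list (map v js)) \<in> F (\<lambda>_. 1) (length js + (l - 1))"
  using assms
proof (induction js)
  case Nil
  then show ?case using d_one subspace_0[OF subspace_F] by simp
next
  case (Cons j js)
  let ?P = "prod_list (map v js)"
  have j: "j < N" "set js \<subseteq> {..<N}" using Cons.prems by auto
  have P: "?P \<in> F f (\<Sum>k\<leftarrow>js. f k)" for f using product_mult_F[OF j(2) one_F, of f] by simp
  have "(- 1) ^ g j * (v j * d ?P) = v j * d ?P \<or> (- 1) ^ g j * (v j * d ?P) = - (v j * d ?P)"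
    by (cases "even (g j)") auto
  then have sgn: "(- 1) ^ g j * (v j * d ?P) \<in> F f i" if "v j * d ?P \<in> F f i" for f i
    using that subspace_neg[OF subspace_F] by metis
  have "d (v j) * ?P \<in> F g (Suc (g j) + (\<Sum>k\<leftarrow>js. g k))" by (rule mult_F[OF d_gen(1)[OF j(1)] P])
  moreover have "v j * d ?P \<in> F g (Suc (\<Sum>k\<leftarrow>js. g k) + g j)"
    using gen_mult_F[OF j(1)] Cons.IH[OF j(2)] by blast
  ultimately have 1: "d (v j * ?P) \<in> F g (Suc (\<Sum>k\<leftarrow>j # js. g k))"
    unfolding d_gen_mult[OF j(1)] using sgn[of g] by (intro subspace_add[OF subspace_F]) (simp_all add: add_ac)
  have "d (v j) * ?P \<in> F (\<lambda>_. 1) (l + length js)"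
    using mult_F[OF d_gen(2)[OF j(1)] P] by (simp add: sum_list_triv)
  moreover have "v j * d ?P \<in> F (\<lambda>_. 1) (length js + (l - 1) + 1)"
    using gen_mult_F[OF j(1)] Cons.IH[OF j(2)] by blast
  ultimately have "d (v j * ?P) \<in> F (\<lambda>_. 1) (length (j # js) + (l - 1))"
    unfolding d_gen_mult[OF j(1)] using sgn[of "\<lambda>_. 1"] l2
    by (intro subspace_add[OF subspace_F]) (simp_all add: add_ac)
  with 1 show ?case by simp
qed

lemma M_F: "m \<in> E \<Longrightarrow> M m \<in> F f (\<Sum>k\<in>#m. f k)"
  using M_mult_F[OF _ one_F] by simp

lemma d_M_F:
  assumes "m \<in> E"
  shows "d (M m) \<in> F g (Suc (\<Sum>k\<in>#m. g k))" "d (M m) \<in> F (\<lambda>_. 1) (size m + (l - 1))"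
proof -
  have "(\<Sum>k\<leftarrow>sorted_list_of_multiset m. g k) = (\<Sum>k\<in>#m. g k)"
    by (metis mset_map mset_sorted_list_of_multiset sum_mset_sum_list)
  moreover have "length (sorted_list_of_multiset m) = size m"
    by (metis mset_sorted_list_of_multiset size_mset)
  moreover have "set (sorted_list_of_multiset m) \<subseteq> {..<N}" using assms(1) unfolding monomials_def by auto
  ultimately show "d (M m) \<in> F g (Suc (\<Sum>k\<in>#m. g k))" "d (M m) \<in> F (\<lambda>_. 1) (size m + (l - 1))"
    using d_product_F[of "sorted_list_of_multiset m"] unfolding M_def by auto
qed

end

text \<open>Generator 0 is exempt from the order by degree: it is a cocycle, so the ideal it
  generates is stable without any comparison of degrees.\<close>

locale homogeneous_model = homogeneous_derivation +
  assumes d_d: "d (d x) = 0"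
    and first: "0 < N" "d (v 0) = 0" "odd (g 0)"
    and g_sorted: "0 < i \<Longrightarrow> i \<le> j \<Longrightarrow> j < N \<Longrightarrow> g i \<le> g j"
    and g_ge_2: "k < N \<Longrightarrow> 2 \<le> g k"
    and finite_cohomology: "\<exists>T. finite T \<and> (\<forall>z. d z = 0 \<longrightarrow> (\<exists>y\<in>span T. z - y \<in> range d))"
begin

text \<open>
  This uses 1-connectedness: a monomial of degree \<open>g k + 1\<close> with at least two factors, all of
  degree at least 2, has only factors of degree less than \<open>g k\<close>.
\<close>

lemma d_gen_I:
  assumes k: "k < N"
  shows "d (v k) \<in> I k"
proof (cases "k = 0")
  case True
  then show ?thesis using first(2) subspace_0[OF subspace_I] by simp
next
  case False
  show ?thesis
    unfolding I_def
  proof (intro CollectI ballI impI, rule ccontr)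
    fix m assume m: "m \<in> E" "cf m (d (v k)) \<noteq> 0" and no: "\<not> (\<exists>j<k. j \<in># m)"
    have deg: "(\<Sum>k\<in>#m. g k) = Suc (g k)" and len: "size m = l"
      using d_gen[OF k] m unfolding F_iff by auto
    have ge: "g k \<le> g j" if "j \<in># m" for j
    proof (rule g_sorted)
      show "k \<le> j" using no that by (meson not_less)
      show "j < N" using m(1) that unfolding monomials_def by auto
    qed (use False in simp)
    have "size m * g k \<le> (\<Sum>k\<in>#m. g k)"
      using ge by (induction m) (simp, force intro: add_mono)
    then have "l * g k \<le> Suc (g k)" using deg len by simp
    moreover have "2 * g k \<le> l * g k" using l2 by simp
    ultimately show False using g_ge_2[OF k] by linarith
  qed
qed

lemma d_I: "k \<le> N \<Longrightarrow> x \<in> I k \<Longrightarrow> d x \<in> I k"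
proof (induction k arbitrary: x)
  case 0
  interpret d: Vector_Spaces.linear scale scale d by (rule d_linear)
  show ?case using 0 by (simp add: I_0 d.zero)
next
  case (Suc k)
  interpret d: Vector_Spaces.linear scale scale d by (rule d_linear)
  have k: "k < N" using Suc.prems by simp
  then obtain a where "x - v k * a \<in> I k" using Suc.prems I_Suc by blast
  then have "d x - d (v k * a) \<in> I k" using Suc.IH[of "x - v k * a"] k by (simp add: d.diff)
  then have 1: "d x - d (v k * a) \<in> I (Suc k)" by (rule I_mono)
  have 2: "d (v k) * a \<in> I (Suc k)" using I_right_ideal[OF _ d_gen_I[OF k]] k I_mono by simp
  have "(- 1) ^ g k * (v k * d a) = v k * d a \<or> (- 1) ^ g k * (v k * d a) = v k * (- d a)"
    by (cases "even (g k)") auto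
  then have "(- 1) ^ g k * (v k * d a) \<in> I (Suc k)" using mult_I_Suc[OF k] by metis
  then have "d (v k * a) \<in> I (Suc k)" unfolding d_gen_mult[OF k] using 2 by (rule subspace_add[OF subspace_I, rotated])
  with 1 have "d x - d (v k * a) + d (v k * a) \<in> I (Suc k)" by (rule subspace_add[OF subspace_I])
  then show ?case by simp
qed

lemma pr_d: "pr i p (d x) = d (pr (i - 1) (p - (int l - 1)) x)"
proof (rule linear_eqI[where p = "\<lambda>x. pr i p (d x)" and q = "\<lambda>x. d (pr (i - 1) (p - (int l - 1)) x)"])
  show "Vector_Spaces.linear scale scale (\<lambda>x. pr i p (d x))"
    using Vector_Spaces.linear_compose[OF d_linear linear_pr] by (simp add: comp_def)
  show "Vector_Spaces.linear scale scale (\<lambda>x. d (pr (i - 1) (p - (int l - 1)) x))"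
    using Vector_Spaces.linear_compose[OF linear_pr d_linear] by (simp add: comp_def)
  fix m assume m: "m \<in> E"
  interpret d: Vector_Spaces.linear scale scale d by (rule d_linear)
  have "pr i p (d (M m)) =
     (if i = int (Suc (\<Sum>k\<in>#m. g k)) \<and> p = int (size m + (l - 1)) then d (M m) else 0)"
    by (rule pr_eq[OF d_M_F[OF m]])
  moreover have "pr (i - 1) (p - (int l - 1)) (M m) =
     (if i - 1 = int (\<Sum>k\<in>#m. g k) \<and> p - (int l - 1) = int (size m) then M m else 0)"
    using pr_eq[OF M_F[OF m] M_F[OF m, of "\<lambda>_. 1"]] by simp
  ultimately show "pr i p (d (M m)) = d (pr (i - 1) (p - (int l - 1)) (M m))"
    using l2 by (auto simp: d.zero of_nat_diff)
qed

lemma pr_mult: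
  assumes k: "k < N"
  shows "pr i p (v k * x) = v k * pr (i - int (g k)) (p - 1) x"
proof (rule linear_eqI[where p = "\<lambda>x. pr i p (v k * x)" and q = "\<lambda>x. v k * pr (i - int (g k)) (p - 1) x"])
  show "Vector_Spaces.linear scale scale (\<lambda>x. pr i p (v k * x))"
    using Vector_Spaces.linear_compose[OF linear_mult linear_pr] by (simp add: comp_def)
  show "Vector_Spaces.linear scale scale (\<lambda>x. v k * pr (i - int (g k)) (p - 1) x)"
    using Vector_Spaces.linear_compose[OF linear_pr linear_mult] by (simp add: comp_def)
  fix m assume m: "m \<in> E"
  have 1: "v k * M m \<in> F g ((\<Sum>k\<in>#m. g k) + g k)" by (rule gen_mult_F[OF k M_F[OF m]])
  have 2: "v k * M m \<in> F (\<lambda>_. 1) (size m + 1)" using gen_mult_F[OF k M_F[OF m, of "\<lambda>_. 1"]] by simp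
  have "pr (i - int (g k)) (p - 1) (M m) =
     (if i - int (g k) = int (\<Sum>k\<in>#m. g k) \<and> p - 1 = int (size m) then M m else 0)"
    using pr_eq[OF M_F[OF m] M_F[OF m, of "\<lambda>_. 1"]] by simp
  then show "pr i p (v k * M m) = v k * pr (i - int (g k)) (p - 1) (M m)"
    unfolding pr_eq[OF 1 2] by auto
qed

text \<open>The bound \<open>2 * p \<le> i\<close> holds because all generators have degree at least
  2. In the upper bound the sum of all degrees serves as a common bound for each of them.\<close>

lemma pr_nonzero:
  assumes "pr i p x \<noteq> 0"
  shows "0 \<le> i" "0 \<le> p" "2 * p \<le> i" "i \<le> int (\<Sum>k<N. g k) * p"
proof -
  from assms obtain m where m: "m \<in> S i p" unfolding pr_def by (metis all_not_in_conv sum.empty)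
  then have mE: "m \<in> E" "int (\<Sum>k\<in>#m. g k) = i" "int (size m) = p" unfolding S_def by auto
  then show "0 \<le> i" "0 \<le> p" by auto
  have sub: "set_mset m \<subseteq> {..<N}" using mE(1) unfolding monomials_def by blast
  then have "2 * size m \<le> (\<Sum>k\<in>#m. g k) \<and> (\<Sum>k\<in>#m. g k) \<le> (\<Sum>k<N. g k) * size m"
  proof (induction m)
    case (add j m)
    then have "2 \<le> g j" "g j \<le> (\<Sum>k<N. g k)" using g_ge_2 by (auto intro: member_le_sum)
    then show ?case using add by auto
  qed simp
  then have "int (2 * size m) \<le> i" "i \<le> int ((\<Sum>k<N. g k) * size m)" using mE(2) by linarith+
  then show "2 * p \<le> i" "i \<le> int (\<Sum>k<N. g k) * p" using mE(3) by auto
qed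

lemma pr_decomposition: "\<exists>T. finite T \<and> x = (\<Sum>(i, p)\<in>T. pr i p x)"
proof -
  define f where "f m = (int (\<Sum>k\<in>#m. g k), int (size m))" for m
  define T where "T = f ` {m \<in> E. cf m x \<noteq> 0}"
  have T: "finite T" unfolding T_def using finite_cf by simp
  have "x = (\<Sum>(i, p)\<in>T. pr i p x)"
  proof (rule cf_eqI)
    fix m assume m: "m \<in> E"
    have "cf m (\<Sum>(i, p)\<in>T. pr i p x) = (\<Sum>q\<in>T. if q = f m then cf m x else 0)"
      unfolding cf_sum using m by (intro sum.cong) (auto simp: cf_pr f_def S_def split: if_splits)
    also have "\<dots> = (if f m \<in> T then cf m x else 0)" using T by (simp add: sum.delta)
    also have "\<dots> = cf m x" using m unfolding T_def by auto
    finally show "cf m x = cf m (\<Sum>(i, p)\<in>T. pr i p x)" by simp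
  qed
  with T show ?thesis by blast
qed

lemma finite_ideal_tower:
  "finite_ideal_tower scale d pr I (\<lambda>k x. v k * x) g N (int l - 1) (int (\<Sum>k<N. g k)) 1"
proof (intro finite_ideal_tower.intro ideal_tower.intro ideal_tower_axioms.intro
    finite_ideal_tower_axioms.intro)
  show ri: "relative_independence scale"
    by (rule relative_independence.intro) (rule vector_space_axioms)
  interpret d: Vector_Spaces.linear scale scale d by (rule d_linear)
  show "Vector_Spaces.linear scale scale d" by (rule d_linear)
  show "Vector_Spaces.linear scale scale ((*) (v k))" for k by (rule linear_mult)
  show "Vector_Spaces.linear scale scale (pr i p)" for i p by (rule linear_pr)
  show "d (d x) = 0" for x by (rule d_d)
  show "subspace (I k)" for k by (rule subspace_I)
  show "k \<le> N \<Longrightarrow> x \<in> I k \<Longrightarrow> d x \<in> I k" for k x by (rule d_I)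
  show "x \<in> I k \<Longrightarrow> pr i p x \<in> I k" for k x i p by (rule pr_I)
  show "pr i p (d x) = d (pr (i - 1) (p - (int l - 1)) x)" for i p x by (rule pr_d)
  show "k < N \<Longrightarrow> pr i p (v k * x) = v k * pr (i - int (g k)) (p - 1) x" for k i p x by (rule pr_mult)
  show "pr i p (pr i p x) = pr i p x" for i p x by (rule cf_eqI) (simp add: cf_pr)
  show "pr i p x \<noteq> 0 \<Longrightarrow> 0 \<le> i \<and> 0 \<le> p \<and> i \<le> int (\<Sum>k<N. g k) * p" for i p x
    using pr_nonzero by blast
  show "k < N \<Longrightarrow> x \<in> I (Suc k) \<longleftrightarrow> (\<exists>a. x - v k * a \<in> I k)" for k x by (rule I_Suc)
  show "k < N \<Longrightarrow> v k * x \<in> I k \<longleftrightarrow> x \<in> (if odd (g k) then I (Suc k) else I k)" for k x by (rule mult_I)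
  show "(if odd (g k) then d (v k * x) + v k * d x else d (v k * x) - v k * d x) \<in> I k" if "k < N" for k x
    using I_right_ideal[OF _ d_gen_I[OF that], of x] that by (auto simp: d_gen_mult)
  show "x \<in> I N" if "(i, p) \<noteq> (0, 0)" "pr i p x = x" for i p x
    unfolding I_def
  proof (intro CollectI ballI impI)
    fix m assume m: "m \<in> E" "cf m x \<noteq> 0"
    then have "m \<in> S i p" using cf_pr[OF m(1), of i p x] that(2) by (auto split: if_splits)
    then have "m \<noteq> {#}" using that(1) unfolding S_def by auto
    then obtain j where "j \<in># m" by blast
    then show "\<exists>j<N. j \<in># m" using m(1) unfolding monomials_def by auto
  qed
  have e: "{#} \<in> E" unfolding monomials_def by simp
  show "pr 0 0 1 = 1" using pr_eq[OF one_F one_F, of 0 0] by simp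
  show "1 \<notin> I N"
  proof
    assume "1 \<in> I N"
    moreover have "cf {#} 1 \<noteq> 0" using cf_M[OF e e] M_empty by simp
    ultimately have "\<exists>j<N. j \<in># {#}" using e unfolding I_def by blast
    then show False by simp
  qed
  show "d 1 = 0" by (rule d_one)
  show "k < N \<Longrightarrow> 2 \<le> g k" for k by (rule g_ge_2)
  show "1 \<le> int l - 1" using l2 by simp
  show "I 0 = {0}" by (rule I_0)
  show "0 < N" "odd (g 0)" using first by auto
  show "\<exists>F. finite F \<and> range (pr i p) \<subseteq> span F" for i p
    by (rule exI[of _ "M ` S i p"]) (simp add: range_pr finite_S)
  show "\<exists>T. finite T \<and> x = (\<Sum>(i, p)\<in>T. pr i p x)" for x by (rule pr_decomposition)
  show "pr i p (pr i' p' x) = 0" if "(i, p) \<noteq> (i', p')" for i p i' p' x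
    by (rule cf_eqI) (use that in \<open>auto simp: cf_pr cf_lin S_def\<close>)
  show "\<exists>F. finite F \<and> relative_independence.spans_mod scale (range d) {z. d z = 0} F"
    using finite_cohomology by (simp add: relative_independence.spans_mod_def[OF ri])
qed

sublocale tower: finite_ideal_tower scale d pr I "\<lambda>k x. v k * x" g N "int l - 1" "int (\<Sum>k<N. g k)" 1
  by (rule finite_ideal_tower)

lemma more_odd_generators: "card {k \<in> {..<N}. even (g k)} \<le> card {k \<in> {..<N}. odd (g k)}"
proof -
  obtain W where W: "\<And>w. w > W \<Longrightarrow>
      (\<Sum>i\<le>2 * w. (- 1) ^ i * int (dim (range (pr (int i) ((int l - 1) * int i - int w))))) = 0"
    using tower.euler_characteristic_vanishes pr_nonzero(3) by blast
  \<comment> \<open>The weight of a single generator, which has wordlength 1; it is positive because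
    \<open>l\<close> and \<open>g k\<close> are at least 2.\<close>
  define u where "u k = (l - 1) * g k - 1" for k
  have u: "int (u k) = (int l - 1) * int (g k) - 1" "g k \<le> 2 * u k" "0 < u k" if "k < N" for k
  proof -
    define P where "P = (l - 1) * g k"
    have "1 * g k \<le> P" unfolding P_def using l2 by (intro mult_right_mono) auto
    moreover have "int P = (int l - 1) * int (g k)" unfolding P_def using l2 by (simp add: of_nat_diff)
    moreover have "u k = P - 1" unfolding P_def u_def ..
    ultimately show "int (u k) = (int l - 1) * int (g k) - 1" "g k \<le> 2 * u k" "0 < u k"
      using g_ge_2[OF that] by auto
  qed
  have weight: "int (\<Sum>k\<in>#m. u k) = (int l - 1) * int (\<Sum>k\<in>#m. g k) - int (size m) \<and>
      (\<Sum>k\<in>#m. g k) \<le> 2 * (\<Sum>k\<in>#m. u k)" if "m \<in> E" for m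
  proof -
    have "set_mset m \<subseteq> {..<N}" using that unfolding monomials_def by blast
    then show ?thesis
    proof (induction m)
      case (add j m)
      then show ?case using u[of j] by (auto simp: algebra_simps)
    qed simp
  qed
  have split: "weight_set g u {..<N} w = (\<Union>i\<le>2 * w. S (int i) ((int l - 1) * int i - int w))" for w
  proof (intro equalityI subsetI)
    fix m assume "m \<in> weight_set g u {..<N} w"
    then have m: "m \<in> E" "(\<Sum>k\<in>#m. u k) = w" unfolding weight_set_def by auto
    then have "m \<in> S (int (\<Sum>k\<in>#m. g k)) ((int l - 1) * int (\<Sum>k\<in>#m. g k) - int w)" "(\<Sum>k\<in>#m. g k) \<le> 2 * w"
      using weight[OF m(1)] unfolding S_def by auto
    then show "m \<in> (\<Union>i\<le>2 * w. S (int i) ((int l - 1) * int i - int w))" by blast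
  next
    fix m assume "m \<in> (\<Union>i\<le>2 * w. S (int i) ((int l - 1) * int i - int w))"
    then obtain i where m: "m \<in> E" "(\<Sum>k\<in>#m. g k) = i" "int (size m) = (int l - 1) * int i - int w"
      unfolding S_def by auto
    then show "m \<in> weight_set g u {..<N} w" using weight[OF m(1)] unfolding weight_set_def by auto
  qed
  have vanish: "signed_count g u {..<N} w = 0" if "w > W" for w
  proof -
    have disj: "\<forall>i\<in>{..2 * w}. \<forall>j\<in>{..2 * w}. i \<noteq> j \<longrightarrow>
      S (int i) ((int l - 1) * int i - int w) \<inter> S (int j) ((int l - 1) * int j - int w) = {}"
      unfolding S_def by auto
    have "signed_count g u {..<N} w =
      (\<Sum>i\<le>2 * w. \<Sum>m\<in>S (int i) ((int l - 1) * int i - int w). (- 1) ^ (\<Sum>k\<in>#m. g k))"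
      unfolding signed_count_def split using finite_S disj by (intro sum.UNION_disjoint) auto
    also have "\<dots> = (\<Sum>i\<le>2 * w. \<Sum>m\<in>S (int i) ((int l - 1) * int i - int w). (- 1) ^ i)"
      by (intro sum.cong refl) (auto simp: S_def)
    also have "\<dots> = of_int (\<Sum>i\<le>2 * w. (- 1) ^ i * int (dim (range (pr (int i) ((int l - 1) * int i - int w)))))"
      by (simp add: dim_range_pr mult.commute)
    also have "\<dots> = 0" using W[OF that] by simp
    finally show ?thesis .
  qed
  show ?thesis
  proof (rule even_le_odd)
    show "0 < u j" if "j \<in> {..<N}" for j using u(3) that by blast
    show "signed_count g u {..<N} w = 0" if "w > W" for w using that by (rule vanish)
  qed simp
qed

theorem many_cohomology_classes:
  obtains L where "L \<subseteq> {z. d z = 0}" "finite L" "tower.indep_mod (range d) L" "N \<le> card L"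
proof -
  obtain L where L: "L \<subseteq> {z. d z = 0}" "finite L" "tower.indep_mod (range d) L"
    "2 * card {j \<in> {..<N}. odd (g j)} \<le> card L" using tower.many_classes by blast
  have "{..<N} = {k \<in> {..<N}. even (g k)} \<union> {k \<in> {..<N}. odd (g k)}" by auto
  then have "N \<le> card {k \<in> {..<N}. even (g k)} + card {k \<in> {..<N}. odd (g k)}"
    by (metis card_Un_le card_lessThan)
  then show ?thesis using more_odd_generators L that by auto
qed

end

section \<open>From freeness to monomial bases\<close>

lemma (in rat_algebra) degree_unique:
  assumes graded: "graded_subspace V" and "x \<in> V i" "x \<in> V j" "x \<noteq> 0"
  shows "i = j"
proof (rule ccontr)
  assume ij: "i \<noteq> j"
  define f where "f n = (if n = i then x else if n = j then - x else 0)" for n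
  have supp: "{n. f n \<noteq> 0} = {i, j}" unfolding f_def using assms(4) by auto
  have "subspace (V n)" for n using graded unfolding graded_subspace_def by blast
  then have "f n \<in> V n" for n unfolding f_def using assms(2,3) subspace_neg subspace_0 by auto
  moreover have "(\<Sum>n | f n \<noteq> 0. f n) = 0" unfolding supp using ij by (simp add: f_def)
  ultimately have "f i = 0" using graded supp unfolding graded_subspace_def by (metis finite.simps)
  then show False using assms(4) unfolding f_def by simp
qed

text \<open>
  A finite homogeneous basis \<open>bs\<close> of \<open>V\<close> with ordered words as in the definition of freeness, and
  a further family \<open>v\<close> of generators with the same degrees.
\<close>

locale generating_family = rat_algebra scale
  for scale :: "rat \<Rightarrow> 'a::ring_1 \<Rightarrow> 'a" +
  fixes V :: "nat \<Rightarrow> 'a set" and r :: "'a rel" and bs :: "'a list" and v :: "nat \<Rightarrow> 'a" and g :: "nat \<Rightarrow> nat"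
  assumes graded: "graded_subspace V"
    and koszul: "x \<in> V i \<Longrightarrow> y \<in> V j \<Longrightarrow> x * y = (- 1) ^ (i * j) * (y * x)"
    and order: "linear_order_on (set bs) r"
    and words_inj: "inj_on prod_list (ordered_words V (set bs) r)"
    and words_independent: "independent (prod_list ` ordered_words V (set bs) r)"
    and words_span: "span (prod_list ` ordered_words V (set bs) r) = UNIV"
    and bs_basis: "distinct bs" "independent (set bs)" "\<And>j. j < length bs \<Longrightarrow> bs ! j \<in> V (g j)"
    and v_span: "\<And>n. V n = span (v ` {j \<in> {..<length bs}. g j = n})"
begin

abbreviation N :: nat where "N \<equiv> length bs"

lemma v_V: "j < N \<Longrightarrow> v j \<in> V (g j)"
  using v_span by (auto intro: span_base)

lemma total_eq: "total V = span (v ` {..<N})"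
proof
  have "V n \<subseteq> span (v ` {..<N})" for n unfolding v_span by (rule span_mono) auto
  then show "total V \<subseteq> span (v ` {..<N})" unfolding total_def by (intro span_minimal) auto
  show "span (v ` {..<N}) \<subseteq> total V" unfolding total_def using v_V by (intro span_mono) auto
qed

sublocale generated_algebra scale v g N
  by unfold_locales (rule koszul[OF v_V v_V])

lemma V_F: "x \<in> V n \<Longrightarrow> x \<in> F g n"
  unfolding v_span using span_minimal[OF _ subspace_F, of "v ` {j \<in> {..<N}. g j = n}" g n] gen_F[of _ g]
  by blast

lemma total_F: "x \<in> total V \<Longrightarrow> x \<in> F (\<lambda>_. 1) 1"
  unfolding total_eq using span_minimal[OF _ subspace_F, of "v ` {..<N}" "\<lambda>_. 1" 1] gen_F[of _ "\<lambda>_. 1"]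
  by blast

lemma degree_part_F: "degree_part V n \<subseteq> F g n"
  unfolding degree_part_def
proof (rule span_minimal[OF _ subspace_F], rule subsetI)
  fix x assume "x \<in> {prod_list vs | vs ns. list_all2 (\<lambda>n v. v \<in> V n) ns vs \<and> sum_list ns = n}"
  then obtain vs ns where x: "x = prod_list vs" "list_all2 (\<lambda>n v. v \<in> V n) ns vs" "sum_list ns = n" by blast
  from x(2) have "list_all2 (\<lambda>n x. x \<in> F g n) ns vs" by (rule list_all2_mono) (rule V_F)
  then have "prod_list vs \<in> F g (sum_list ns)" by (rule prod_list_F)
  then show "x \<in> F g n" using x by simp
qed

lemma product_F:
  assumes "set vs \<subseteq> total V"
  shows "prod_list vs \<in> F (\<lambda>_. 1) (length vs)"
proof -
  have "list_all2 (\<lambda>n x. x \<in> F (\<lambda>_. 1) n) (replicate (length vs) 1) vs"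
    by (rule list_all2_all_nthI) (use total_F[OF subsetD[OF assms nth_mem]] in simp_all)
  from prod_list_F[OF this] show ?thesis by (simp add: sum_list_replicate)
qed

lemma wordlength_part_eq: "wordlength_part V n = F (\<lambda>_. 1) n"
proof
  show "wordlength_part V n \<subseteq> F (\<lambda>_. 1) n"
    unfolding wordlength_part_def by (rule span_minimal[OF _ subspace_F]) (use product_F in auto)
  show "F (\<lambda>_. 1) n \<subseteq> wordlength_part V n"
    unfolding F_def wordlength_part_def
  proof (rule span_mono, rule subsetI)
    fix x assume "x \<in> M ` {m \<in> E. (\<Sum>k\<in>#m. 1) = n}"
    then obtain m where m: "m \<in> E" "(\<Sum>k\<in>#m. 1) = n" "x = M m" by blast
    define vs where "vs = map v (sorted_list_of_multiset m)"
    have "v j \<in> total V" if "j \<in># m" for j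
      using m(1) that unfolding total_eq monomials_def by (auto intro: span_base)
    then have "set vs \<subseteq> total V" unfolding vs_def by auto
    moreover have "length vs = (\<Sum>k\<in>#m. 1)"
      unfolding vs_def by (simp flip: size_mset)
    moreover have "M m = prod_list vs" unfolding vs_def M_def ..
    ultimately show "x \<in> {prod_list vs | vs. set vs \<subseteq> total V \<and> length vs = n}" using m(2,3) by blast
  qed
qed

lemma bs_total: "set bs \<subseteq> total V"
proof
  fix b assume "b \<in> set bs"
  then obtain j where "j < N" "b = bs ! j" by (metis in_set_conv_nth)
  then show "b \<in> total V" using bs_basis(3) unfolding total_def by (auto intro: span_base)
qed

text \<open>The number of predecessors turns the linear order \<open>r\<close> into a numerical
  sorting key.\<close>

definition rank :: "'a \<Rightarrow> nat" where
  "rank b = card {x \<in> set bs. (x, b) \<in> r}"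

lemma rank_le:
  assumes "x \<in> set bs" "y \<in> set bs" "rank x \<le> rank y"
  shows "(x, y) \<in> r"
proof (rule ccontr)
  assume n: "(x, y) \<notin> r"
  have o: "refl_on (set bs) r" "trans r" "antisym r" "total_on (set bs) r"
    using order unfolding linear_order_on_def partial_order_on_def preorder_on_def by auto
  have "x \<noteq> y" using n o(1) assms(1) unfolding refl_on_def by blast
  then have yx: "(y, x) \<in> r" using n o(4) assms unfolding total_on_def by blast
  have "{z \<in> set bs. (z, y) \<in> r} \<subseteq> {z \<in> set bs. (z, x) \<in> r}" using yx o(2) unfolding trans_def by blast
  moreover have "x \<in> {z \<in> set bs. (z, x) \<in> r}" using o(1) assms(1) unfolding refl_on_def by blast
  moreover have "x \<notin> {z \<in> set bs. (z, y) \<in> r}" using n by blast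
  ultimately have "{z \<in> set bs. (z, y) \<in> r} \<subset> {z \<in> set bs. (z, x) \<in> r}" by blast
  then have "rank y < rank x" unfolding rank_def by (intro psubset_card_mono) auto
  then show False using assms(3) by simp
qed

text \<open>Sorting the letters of a monomial yields the word. A letter repeated in it comes from an
  index of multiplicity at least 2 in \<open>m\<close>, which has even degree.\<close>

lemma word_exists:
  assumes "m \<in> E"
  obtains xs where "xs \<in> ordered_words V (set bs) r" "mset xs = image_mset (nth bs) m"
proof -
  define xs where "xs = sort_key rank (map (nth bs) (sorted_list_of_multiset m))"
  have ms: "mset xs = image_mset (nth bs) m" unfolding xs_def by simp
  have mN: "set_mset m \<subseteq> {..<N}" using assms unfolding monomials_def by blast
  have set_xs: "set xs \<subseteq> set bs" unfolding xs_def using mN by auto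
  have sorted: "sorted (map rank xs)" unfolding xs_def by simp
  have "sorted_wrt (\<lambda>x y. (x, y) \<in> r \<and> (x = y \<longrightarrow> (\<exists>i. even i \<and> x \<in> V i))) xs"
    unfolding sorted_wrt_iff_nth_less
  proof (intro allI impI conjI)
    fix i j assume ij: "i < j" "j < length xs"
    then have "rank (xs ! i) \<le> rank (xs ! j)" using sorted by (simp add: sorted_iff_nth_mono)
    moreover have "xs ! i \<in> set bs" "xs ! j \<in> set bs" using ij set_xs nth_mem[of i xs] nth_mem[of j xs] by auto
    ultimately show "(xs ! i, xs ! j) \<in> r" by (intro rank_le)
    assume eq: "xs ! i = xs ! j"
    have "xs ! i \<in># image_mset (nth bs) m" using ij unfolding ms[symmetric] by simp
    then obtain k where k: "k \<in># m" "xs ! i = bs ! k" by auto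
    then have kN: "k < N" using mN by auto
    have "{i, j} \<subseteq> {n. n < length xs \<and> bs ! k = xs ! n}" using ij eq k(2) by auto
    then have "card {i, j} \<le> card {n. n < length xs \<and> bs ! k = xs ! n}" by (intro card_mono) auto
    then have "2 \<le> count (mset xs) (bs ! k)" using ij(1) by (simp add: count_mset count_list_eq_length_filter length_filter_conv_card)
    moreover have "count (image_mset (nth bs) m) (bs ! k) = count m k"
    proof -
      have "nth bs -` {bs ! k} \<inter> set_mset m = {k}"
        using mN kN k(1) bs_basis(1) nth_eq_iff_index_eq[OF bs_basis(1)] by auto
      then show ?thesis by (simp add: count_image_mset)
    qed
    ultimately have "1 < count m k" unfolding ms by simp
    then have "even (g k)" using assms unfolding monomials_def by (auto simp flip: not_le)
    then show "\<exists>i'. even i' \<and> xs ! i \<in> V i'" using bs_basis(3)[OF kN] k(2) by auto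
  qed
  then show ?thesis using that[of xs] ms set_xs unfolding ordered_words_def by auto
qed

lemma span_M_bounded:
  assumes "set vs \<subseteq> total V" "length vs \<le> p"
  shows "prod_list vs \<in> span (M ` {m \<in> E. size m \<le> p})"
proof -
  have "F (\<lambda>_. 1) (length vs) \<subseteq> span (M ` {m \<in> E. size m \<le> p})"
    unfolding F_def using assms(2) by (intro span_mono) auto
  then show ?thesis using product_F[OF assms(1)] by blast
qed

text \<open>
  The monomials of wordlength at most \<open>p\<close> in the family \<open>v\<close> span the space which has the
  ordered words of length at most \<open>p\<close> as a basis, and there are not more of them.
\<close>

lemma bounded_monomials:
  shows "inj_on M {m \<in> E. size m \<le> p} \<and> independent (M ` {m \<in> E. size m \<le> p})"
proof -
  let ?E = "{m \<in> E. size m \<le> p}"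
  define W where "W = {xs \<in> ordered_words V (set bs) r. length xs \<le> p}"
  have "finite {m. set_mset m \<subseteq> {..<N} \<and> size m \<le> p}" by (rule finite_bounded_multisets) simp
  then have fE: "finite ?E" by (rule rev_finite_subset) (auto simp: monomials_def)
  have "W \<subseteq> {xs. set xs \<subseteq> set bs \<and> length xs \<le> p}" unfolding W_def ordered_words_def by auto
  then have fW: "finite W" using finite_lists_length_le[of "set bs" p] finite_subset by blast
  define \<psi> where "\<psi> = inv_into {..<N} (nth bs)"
  have inj: "inj_on (nth bs) {..<N}" using bs_basis(1) by (simp add: inj_on_def nth_eq_iff_index_eq)
  have "?E \<subseteq> (\<lambda>xs. image_mset \<psi> (mset xs)) ` W"
  proof
    fix m assume m: "m \<in> ?E"
    obtain xs where xs: "xs \<in> ordered_words V (set bs) r" "mset xs = image_mset (nth bs) m"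
      using word_exists[of m] m by auto
    have "size (mset xs) = size (image_mset (nth bs) m)" using xs(2) by (rule arg_cong)
    then have "length xs = size m" by simp
    then have "xs \<in> W" unfolding W_def using xs(1) m by simp
    moreover have "image_mset \<psi> (mset xs) = image_mset (\<lambda>k. k) m"
      unfolding xs(2) multiset.map_comp
      by (rule image_mset_cong) (use m inj in \<open>auto simp: \<psi>_def monomials_def intro!: inv_into_f_f\<close>)
    ultimately show "m \<in> (\<lambda>xs. image_mset \<psi> (mset xs)) ` W"
      by (intro image_eqI[of _ _ xs]) simp_all
  qed
  then have cEW: "card ?E \<le> card W" using fW by (rule surj_card_le[rotated])
  have Wsub: "W \<subseteq> ordered_words V (set bs) r" unfolding W_def by blast
  then have cW: "card (prod_list ` W) = card W"
    by (intro card_image inj_on_subset[OF words_inj])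
  have iW: "independent (prod_list ` W)" using independent_mono[OF words_independent image_mono[OF Wsub]] .
  have W_span: "prod_list ` W \<subseteq> span (M ` ?E)"
  proof clarify
    fix xs assume "xs \<in> W"
    then have "set xs \<subseteq> total V" "length xs \<le> p" using bs_total unfolding W_def ordered_words_def by auto
    then show "prod_list xs \<in> span (M ` ?E)" by (rule span_M_bounded)
  qed
  obtain C where C: "C \<subseteq> M ` ?E" "independent C" "M ` ?E \<subseteq> span C" by (rule maximal_independent_subset)
  have fC: "finite C" using C(1) fE finite_subset by blast
  have "span (M ` ?E) \<subseteq> span C" using C(3) subspace_span by (rule span_minimal)
  then have "card (prod_list ` W) \<le> card C" using independent_span_bound[OF fC iW] W_span by blast
  \<comment> \<open>The inequalities close up in a circle: \<open>W\<close>, \<open>C\<close>, the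
    products and the monomials all have the same number of elements.\<close>
  then have c: "card C = card (M ` ?E)" "card (M ` ?E) = card ?E"
    using cW cEW card_image_le[OF fE, of M] card_mono[OF finite_imageI[OF fE] C(1)] by linarith+
  have "C = M ` ?E" using card_subset_eq[OF finite_imageI[OF fE] C(1) c(1)] .
  then show ?thesis using C(2) eq_card_imp_inj_on[OF fE c(2)] by simp
qed

text \<open>Counting works only for bounded wordlength, where everything is finite. The bounded sets
  form a chain, so independence passes to their union.\<close>

lemma monomial_algebra: "monomial_algebra scale v g N"
proof
  show "inj_on M E"
  proof (rule inj_onI)
    fix m m' assume "m \<in> E" "m' \<in> E" "M m = M m'"
    then show "m = m'" using bounded_monomials[of "max (size m) (size m')"]
      by (auto simp: inj_on_def)
  qed
  define C where "C = range (\<lambda>p. M ` {m \<in> E. size m \<le> p})"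
  have "M ` E = \<Union>C" unfolding C_def by auto
  moreover have "independent (\<Union>C)"
  proof (rule independent_Union_directed)
    show "independent c" if "c \<in> C" for c using that bounded_monomials unfolding C_def by auto
    fix c c' assume "c \<in> C" "c' \<in> C"
    then obtain p q where "c = M ` {m \<in> E. size m \<le> p}" "c' = M ` {m \<in> E. size m \<le> q}"
      unfolding C_def by auto
    then show "c \<subseteq> c' \<or> c' \<subseteq> c" by (cases "p \<le> q") (auto intro!: imageI)
  qed
  ultimately show "independent (M ` E)" by simp
  have "prod_list ` ordered_words V (set bs) r \<subseteq> span (M ` E)"
  proof clarify
    fix xs assume "xs \<in> ordered_words V (set bs) r"
    then have "set xs \<subseteq> total V" using bs_total unfolding ordered_words_def by auto
    then have "prod_list xs \<in> span (M ` {m \<in> E. size m \<le> length xs})" by (rule span_M_bounded) simp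
    then show "prod_list xs \<in> span (M ` E)" using span_mono[of "M ` {m \<in> E. size m \<le> length xs}" "M ` E"] by blast
  qed
  from span_minimal[OF this subspace_span] show "span (M ` E) = UNIV" unfolding words_span by blast
qed

sublocale monomial_algebra scale v g N
  by (rule monomial_algebra)

text \<open>The element described by \<open>THE\<close> is the part of wordlength 1 in the monomial
  expansion; for \<open>z\<close> of degree \<open>n\<close> it involves generators of degree
  \<open>n\<close> only.\<close>

lemma linear_part_properties:
  assumes z: "z \<in> degree_part V n"
  shows "linear_part V z \<in> V n" "z - linear_part V z \<in> span (M ` {m \<in> E. size m \<noteq> 1})"
proof -
  have parts: "span (\<Union>k\<in>- {1}. wordlength_part V k) = span (M ` {m \<in> E. size m \<noteq> 1})"
  proof
    show "span (\<Union>k\<in>- {1}. wordlength_part V k) \<subseteq> span (M ` {m \<in> E. size m \<noteq> 1})"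
    proof (rule span_minimal[OF _ subspace_span], rule subsetI)
      fix x assume "x \<in> (\<Union>k\<in>- {1}. wordlength_part V k)"
      then obtain k where "k \<noteq> 1" "x \<in> wordlength_part V k" by auto
      then show "x \<in> span (M ` {m \<in> E. size m \<noteq> 1})"
        unfolding wordlength_part_eq F_def using span_mono[of "M ` {m \<in> E. (\<Sum>k\<in>#m. 1) = k}" "M ` {m \<in> E. size m \<noteq> 1}"]
        by auto
    qed
    show "span (M ` {m \<in> E. size m \<noteq> 1}) \<subseteq> span (\<Union>k\<in>- {1}. wordlength_part V k)"
    proof (rule span_mono, rule subsetI)
      fix x assume "x \<in> M ` {m \<in> E. size m \<noteq> 1}"
      then obtain m where "m \<in> E" "size m \<noteq> 1" "x = M m" by auto
      then show "x \<in> (\<Union>k\<in>- {1}. wordlength_part V k)"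
        unfolding wordlength_part_eq F_def by (auto intro!: bexI[of _ "size m"] span_base)
    qed
  qed
  define y where "y = (\<Sum>m | m \<in> E \<and> cf m z \<noteq> 0 \<and> size m = 1. scale (cf m z) (M m))"
  have fin: "finite {m. m \<in> E \<and> cf m z \<noteq> 0 \<and> size m = 1}" using finite_cf[of z] by (rule rev_finite_subset) auto
  have cf_y: "cf m y = (if size m = 1 then cf m z else 0)" if m: "m \<in> E" for m
  proof -
    have "cf m y = (\<Sum>m' | m' \<in> E \<and> cf m' z \<noteq> 0 \<and> size m' = 1. if m' = m then cf m z else 0)"
      unfolding y_def cf_sum using m by (intro sum.cong) (auto simp: cf_lin cf_M)
    then show ?thesis using fin m by (auto simp: sum.delta)
  qed
  have y1: "y \<in> wordlength_part V 1" unfolding wordlength_part_eq F_iff using cf_y by auto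
  have y2: "z - y \<in> span (M ` {m \<in> E. size m \<noteq> 1})"
    by (subst span_M_iff) (auto simp: cf_lin cf_y)
  have "linear_part V z = y"
    unfolding linear_part_def parts
  proof (rule the_equality)
    show "y \<in> wordlength_part V 1 \<and> z - y \<in> span (M ` {m \<in> E. size m \<noteq> 1})" using y1 y2 by blast
    fix w assume w: "w \<in> wordlength_part V 1 \<and> z - w \<in> span (M ` {m \<in> E. size m \<noteq> 1})"
    show "w = y"
    proof (rule cf_eqI)
      fix m assume m: "m \<in> E"
      have "cf m w = 0" if "size m \<noteq> 1" using w m that unfolding wordlength_part_eq F_iff by auto
      moreover have "cf m (z - w) = 0" if "size m = 1"
        using w m that span_M_iff[of "{m \<in> E. size m \<noteq> 1}" "z - w"] by auto
      ultimately show "cf m w = cf m y" using cf_y[OF m] by (auto simp: cf_lin)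
    qed
  qed
  then show "z - linear_part V z \<in> span (M ` {m \<in> E. size m \<noteq> 1})" using y2 by simp
  have zF: "z \<in> F g n" using z degree_part_F by blast
  have "y \<in> V n" unfolding y_def
  proof (rule subspace_sum)
    show V: "subspace (V n)" unfolding v_span by (rule subspace_span)
    fix m assume "m \<in> {m. m \<in> E \<and> cf m z \<noteq> 0 \<and> size m = 1}"
    then have m: "m \<in> E" "cf m z \<noteq> 0" "size m = 1" by auto
    then obtain j where j: "m = {#j#}" using size_1_singleton_mset by auto
    have "j < N" using m(1) j unfolding monomials_def by simp
    moreover have "g j = n" using zF m j unfolding F_iff by auto
    ultimately have "M m \<in> V n" unfolding j M_def using v_V by auto
    then show "scale (cf m z) (M m) \<in> V n" by (rule subspace_scale[OF V])
  qed
  then show "linear_part V z \<in> V n" using \<open>linear_part V z = y\<close> by simp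
qed

end

text \<open>A basis vector that occurs in \<open>y\<close> can be recovered from \<open>y\<close>
  and the others. This lets a cocycle replace a generator of the same degree.\<close>

lemma (in rat_algebra) exchange_vector:
  assumes "independent S" "y \<in> span S" "y \<noteq> 0"
  obtains b where "b \<in> S" "b \<in> span (insert y (S - {b}))"
proof -
  have "\<exists>b. representation S y b \<noteq> 0"
  proof (rule ccontr)
    assume "\<not> ?thesis"
    then have "(\<Sum>b | representation S y b \<noteq> 0. scale (representation S y b) b) = 0" by simp
    then show False using sum_nonzero_representation_eq[OF assms(1,2)] assms(3) by simp
  qed
  then obtain b where b: "representation S y b \<noteq> 0" by blast
  then have bS: "b \<in> S" by (rule representation_ne_zero)
  have "y \<notin> span (S - {b})"
  proof
    assume "y \<in> span (S - {b})"
    from representation_extend[OF assms(1) this] b have "representation (S - {b}) y b \<noteq> 0" by auto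
    then have "b \<in> S - {b}" by (rule representation_ne_zero)
    then show False by simp
  qed
  then have "b \<in> span (insert y (S - {b}))"
    using in_span_insert[of y b "S - {b}"] assms(2) bS by (simp add: insert_absorb)
  then show ?thesis using that bS by blast
qed

text \<open>An infinite basis would have \<open>card\<close> 0, so the chosen basis is first shown
  to be finite by comparison with a finite one.\<close>

lemma (in rat_algebra) dim_quotient_ge:
  assumes N: "subspace N" and fin: "finite_dim_quotient M N"
    and L: "L \<subseteq> M" "relative_independence.indep_mod scale N L"
  shows "card L \<le> dim_quotient M N"
proof -
  interpret ri: relative_independence scale by (rule relative_independence.intro) (rule vector_space_axioms)
  have qb: "ri.indep_mod N Q \<and> ri.spans_mod N M Q \<and> Q \<subseteq> M" if Q: "quotient_basis M N Q" for Q
  proof -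
    have Q': "\<And>T c x. finite T \<Longrightarrow> T \<subseteq> Q \<Longrightarrow> (\<Sum>x\<in>T. scale (c x) x) \<in> N \<Longrightarrow> x \<in> T \<Longrightarrow> c x = 0"
      using Q unfolding quotient_basis_def by blast
    have "independent Q"
      unfolding independent_explicit_module
    proof (intro allI impI)
      fix T c x assume "finite T" "T \<subseteq> Q" "(\<Sum>x\<in>T. scale (c x) x) = 0" "x \<in> T"
      then show "c x = 0" using Q'[of T c x] subspace_0[OF N] by simp
    qed
    moreover have "x = 0" if "x \<in> span Q" "x \<in> N" for x
    proof -
      obtain T c where T: "finite T" "T \<subseteq> Q" "x = (\<Sum>a\<in>T. scale (c a) a)"
        using \<open>x \<in> span Q\<close> unfolding span_explicit by auto
      have "(\<Sum>a\<in>T. scale (c a) a) \<in> N" using T(3) \<open>x \<in> N\<close> by simp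
      then have "c a = 0" if "a \<in> T" for a using Q'[OF T(1,2) _ that] by blast
      then show ?thesis unfolding T(3) by simp
    qed
    ultimately have "ri.indep_mod N Q" unfolding ri.indep_mod_def by auto
    then show ?thesis using Q unfolding ri.spans_mod_def quotient_basis_def by simp
  qed
  obtain S where S: "finite S" "quotient_basis M N S" using fin unfolding finite_dim_quotient_def by blast
  define Q where "Q = (SOME S. quotient_basis M N S)"
  have Q: "quotient_basis M N Q" unfolding Q_def using S(2) by (rule someI)
  have "finite Q" using ri.indep_mod_card_le[OF N S(1), of M Q] qb[OF S(2)] qb[OF Q] by simp
  then have "card L \<le> card Q" using ri.indep_mod_card_le[OF N _ _ L, of Q] qb[OF Q] by simp
  then show ?thesis unfolding dim_quotient_def Q_def .
qed

section \<open>The Sullivan model, with the linear part of a cocycle as first generator\<close>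

context sullivan_algebra begin

lemma d_one: "d 1 = 0"
proof -
  have "prod_list [] \<in> degree_part V 0"
    unfolding degree_part_def by (intro span_base) (auto intro!: exI[of _ "[]"])
  then have "d (1 * 1) = d 1 * 1 + (- 1) ^ 0 * (1 * d 1)" by (intro d_derivation) simp
  then show ?thesis by simp
qed

lemma homogeneous_derivation:
  assumes "generating_family scale V r bs v g" "2 \<le> l" "d ` total V \<subseteq> wordlength_part V l"
  shows "homogeneous_derivation scale v g (length bs) d l"
proof -
  interpret gf: generating_family scale V r bs v g by (rule assms(1))
  have deg: "v k \<in> degree_part V (g k)" if "k < length bs" for k
  proof -
    have "list_all2 (\<lambda>n v. v \<in> V n) [g k] [v k]" "sum_list [g k] = g k" "v k = prod_list [v k]"
      using gf.v_V[OF that] by auto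
    then show ?thesis unfolding degree_part_def by (intro span_base) blast
  qed
  show ?thesis
  proof (intro homogeneous_derivation.intro homogeneous_derivation_axioms.intro)
    show "monomial_algebra scale v g (length bs)" by (rule gf.monomial_algebra)
    show "Vector_Spaces.linear scale scale d" by (rule d_linear)
    show "d 1 = 0" by (rule d_one)
    show "2 \<le> l" by fact
    fix k assume k: "k < length bs"
    show "d (v k * x) = d (v k) * x + (- 1) ^ g k * (v k * d x)" for x
      by (rule d_derivation[OF deg[OF k]])
    show "d (v k) \<in> gf.F g (Suc (g k))" using d_degree[of "g k"] deg[OF k] gf.degree_part_F by blast
    have "v k \<in> total V" unfolding gf.total_eq using k by (auto intro: span_base)
    then show "d (v k) \<in> gf.F (\<lambda>_. 1) l" using assms(3) gf.wordlength_part_eq by blast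
  qed
qed

text \<open>With \<open>y\<close> the linear part, \<open>d y\<close> has wordlength
  \<open>l\<close>, whereas \<open>d (z - y)\<close> has no part of wordlength \<open>l\<close>.
  They add up to \<open>d z = 0\<close>, so \<open>d y\<close> vanishes.\<close>

lemma linear_part_cocycle:
  assumes gf: "generating_family scale V r bs v g" and l: "2 \<le> l" "d ` total V \<subseteq> wordlength_part V l"
    and z: "z \<in> degree_part V n" "d z = 0"
  shows "d (linear_part V z) = 0"
proof -
  interpret gf: generating_family scale V r bs v g by (rule gf)
  interpret hd: homogeneous_derivation scale v g "length bs" d l
    by (rule homogeneous_derivation[OF gf l])
  interpret d: Vector_Spaces.linear scale scale d by (rule d_linear)
  define y where "y = linear_part V z"
  let ?S = "{m \<in> gf.E. size m \<noteq> l}"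
  have "d x \<in> span (gf.M ` ?S)" if "x \<in> span (gf.M ` {m \<in> gf.E. size m \<noteq> 1})" for x
    using that
  proof (induction rule: span_induct_alt)
    case base
    then show ?case by (simp add: d.zero span_zero)
  next
    case (step c b x)
    then obtain m where m: "m \<in> gf.E" "size m \<noteq> 1" "b = gf.M m" by blast
    have "gf.F (\<lambda>_. 1) (size m + (l - 1)) \<subseteq> span (gf.M ` ?S)"
      unfolding gf.F_def using m(2) l(1) by (intro span_mono) auto
    then have "d b \<in> span (gf.M ` ?S)" using hd.d_M_F(2)[OF m(1)] m(3) by blast
    then show ?case using step(2) by (simp add: d.add d.scale span_add span_scale)
  qed
  from this[OF gf.linear_part_properties(2)[OF z(1)]]
  have 1: "d (z - y) \<in> span (gf.M ` ?S)" unfolding y_def .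
  have "y \<in> total V" using gf.linear_part_properties(1)[OF z(1)] unfolding y_def total_def
    by (auto intro: span_base)
  then have 2: "d y \<in> gf.F (\<lambda>_. 1) l" using l(2) gf.wordlength_part_eq by blast
  have 3: "d y = - d (z - y)" using z(2) by (simp add: d.diff)
  have "d y = 0"
  proof (rule gf.cf_eqI)
    fix m assume m: "m \<in> gf.E"
    show "gf.cf m (d y) = gf.cf m 0"
    proof (cases "size m = l")
      case True
      then have "gf.cf m (d (z - y)) = 0" using 1 m gf.span_M_iff[of ?S "d (z - y)"] by auto
      then show ?thesis unfolding 3 by (simp add: gf.cf_lin)
    next
      case False
      then show ?thesis using 2 m unfolding gf.F_iff by (auto simp: gf.cf_lin)
    qed
  qed
  then show ?thesis unfolding y_def .
qed

theorem dim_total_le_cohomology_dim: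
  assumes "one_connected" "elliptic" and l: "2 \<le> l" "d ` total V \<subseteq> wordlength_part V l"
    and "odd k" "hurewicz_nonzero k"
  shows "dim (total V) \<le> cohomology_dim"
proof -
  have graded: "graded_subspace V" and koszul: "\<And>i j x y. x \<in> V i \<Longrightarrow> y \<in> V j \<Longrightarrow> x * y = (- 1) ^ (i * j) * (y * x)"
    using free unfolding free_graded_commutative_def by blast+
  have V_sub: "subspace (V n)" for n using graded unfolding graded_subspace_def by blast
  obtain B r where B: "homogeneous_basis V B" "linear_order_on B r"
      "inj_on prod_list (ordered_words V B r)" "independent (prod_list ` ordered_words V B r)"
      "span (prod_list ` ordered_words V B r) = UNIV"
    using free unfolding free_graded_commutative_def by blast
  have Bb: "B \<subseteq> (\<Union>i. V i)" "independent B" "\<And>i. V i = span (B \<inter> V i)"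
    using B(1) unfolding homogeneous_basis_def by blast+
  have B_total: "total V = span B"
  proof
    have "V i \<subseteq> span B" for i using Bb(3)[of i] span_mono[of "B \<inter> V i" B] by blast
    then show "total V \<subseteq> span B" unfolding total_def by (intro span_minimal) auto
    show "span B \<subseteq> total V" unfolding total_def using Bb(1) by (rule span_mono)
  qed
  obtain T where "finite T" "total V \<subseteq> span T" using assms(2) unfolding elliptic_def finite_dim_def by blast
  then have fB: "finite B" using independent_span_bound[of T B] Bb(2) B_total span_superset by blast
  obtain dg where dg: "\<And>b. b \<in> B \<Longrightarrow> b \<in> V (dg b)" using Bb(1) by (metis UN_E subsetD)
  have B0: "b \<noteq> 0" if "b \<in> B" for b using Bb(2) dependent_zero that by blast
  have dg_iff: "b \<in> V n \<longleftrightarrow> dg b = n" if "b \<in> B" for b n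
    using degree_unique[OF graded dg[OF that] _ B0[OF that], of n] dg[OF that] by blast
  have BV: "B \<inter> V n = {b \<in> B. dg b = n}" for n using dg_iff by blast

  obtain xs where xs: "set xs = B" "distinct xs" using finite_distinct_list[OF fB] by blast
  \<comment> \<open>The basis provided by freeness, as it stands, suffices to study the linear part
    of the given cocycle.\<close>
  have gf0: "generating_family scale V r xs (nth xs) (\<lambda>j. dg (xs ! j))"
  proof (unfold_locales)
    show "graded_subspace V" by (rule graded)
    show "x \<in> V i \<Longrightarrow> y \<in> V j \<Longrightarrow> x * y = (- 1) ^ (i * j) * (y * x)" for x y i j by (rule koszul)
    show "j < length xs \<Longrightarrow> xs ! j \<in> V (dg (xs ! j))" for j using dg xs(1) by auto
    have "nth xs ` {j \<in> {..<length xs}. dg (xs ! j) = n} = {b \<in> set xs. dg b = n}" for n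
      by (auto simp: in_set_conv_nth)
    then have "nth xs ` {j \<in> {..<length xs}. dg (xs ! j) = n} = B \<inter> V n" for n
      unfolding BV xs(1) .
    then show "V n = span (nth xs ` {j \<in> {..<length xs}. dg (xs ! j) = n})" for n using Bb(3) by simp
  qed (use B Bb xs in simp_all)

  obtain z where z: "z \<in> degree_part V k" "d z = 0" "linear_part V z \<noteq> 0"
    using assms(6) unfolding hurewicz_nonzero_def cocycles_def by blast
  define y where "y = linear_part V z"
  have y: "y \<in> V k" "y \<noteq> 0" "d y = 0"
    using generating_family.linear_part_properties(1)[OF gf0 z(1)] z(3) linear_part_cocycle[OF gf0 l z(1,2)]
    unfolding y_def by auto

  have iBk: "independent (B \<inter> V k)" using independent_mono[OF Bb(2)] by blast
  have "y \<in> span (B \<inter> V k)" using y(1) Bb(3) by blast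
  from exchange_vector[OF iBk this y(2)] obtain b0 where
    b0: "b0 \<in> B \<inter> V k" "b0 \<in> span (insert y (B \<inter> V k - {b0}))" by blast
  obtain us where us: "set us = B - {b0}" "distinct us" using finite_distinct_list[of "B - {b0}"] fB by blast
  define ws where "ws = sort_key dg us"
  have ws: "set ws = B - {b0}" "distinct ws" "sorted (map dg ws)" unfolding ws_def using us by auto
  \<comment> \<open>\<open>bs\<close> keeps the old basis, to which the ordered words belong;
    \<open>v\<close> differs from it only at index 0, where \<open>y\<close> replaces
    \<open>b0\<close>. Both have degree \<open>k\<close> there, so \<open>g\<close> fits
    both.\<close>
  define bs where "bs = b0 # ws"
  define v where "v j = (y # ws) ! j" for j
  define g where "g j = dg (bs ! j)" for j
  have bs: "set bs = B" "distinct bs" unfolding bs_def using ws b0(1) by auto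
  have dgb0: "dg b0 = k" using b0(1) dg_iff by blast
  have images: "v ` {j \<in> {..<length bs}. g j = n} = (if n = k then {y} else {}) \<union> {b \<in> B - {b0}. dg b = n}" for n
  proof -
    have "{j \<in> {..<length bs}. g j = n} = (if n = k then {0} else {}) \<union> Suc ` {j \<in> {..<length ws}. dg (ws ! j) = n}"
      unfolding bs_def g_def using dgb0 by (auto simp: lessThan_Suc_eq_insert_0)
    moreover have "v ` Suc ` {j \<in> {..<length ws}. dg (ws ! j) = n} = {b \<in> B - {b0}. dg b = n}"
      unfolding ws(1)[symmetric] image_image v_def by (auto simp: in_set_conv_nth)
    ultimately show ?thesis by (simp add: image_Un v_def)
  qed
  have gf: "generating_family scale V r bs v g"
  proof (unfold_locales)
    show "graded_subspace V" by (rule graded)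
    show "x \<in> V i \<Longrightarrow> y \<in> V j \<Longrightarrow> x * y = (- 1) ^ (i * j) * (y * x)" for x y i j by (rule koszul)
    show "bs ! j \<in> V (g j)" if "j < length bs" for j
      unfolding g_def by (rule dg) (use nth_mem[OF that] bs(1) in simp)
    show "V n = span (v ` {j \<in> {..<length bs}. g j = n})" for n
    proof (cases "n = k")
      case False
      then have "{b \<in> B - {b0}. dg b = n} = B \<inter> V n" unfolding BV using dgb0 by blast
      then have "v ` {j \<in> {..<length bs}. g j = n} = B \<inter> V n" unfolding images using False by simp
      then show ?thesis using Bb(3)[of n] by simp
    next
      case True
      then have im: "v ` {j \<in> {..<length bs}. g j = n} = insert y (B \<inter> V k - {b0})"
        using images[of n] BV[of k] by (simp add: True set_diff_eq Collect_conj_eq) blast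
      have "insert y (B \<inter> V k - {b0}) \<subseteq> V k" using y(1) by blast
      then have "span (insert y (B \<inter> V k - {b0})) \<subseteq> V k" by (rule span_minimal[OF _ V_sub])
      moreover have "b \<in> span (insert y (B \<inter> V k - {b0}))" if "b \<in> B \<inter> V k" for b
      proof (cases "b = b0")
        case False
        then have "b \<in> insert y (B \<inter> V k - {b0})" using that by blast
        then show ?thesis by (rule span_base)
      qed (use b0(2) in simp)
      then have "B \<inter> V k \<subseteq> span (insert y (B \<inter> V k - {b0}))" by (rule subsetI)
      then have "span (B \<inter> V k) \<subseteq> span (insert y (B \<inter> V k - {b0}))" by (intro span_minimal subspace_span)
      ultimately have "span (insert y (B \<inter> V k - {b0})) = V k" using Bb(3)[of k] by (simp add: subset_antisym)
      then show ?thesis unfolding im by (simp only: True)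
    qed
  qed (use B Bb bs in simp_all)

  have "homogeneous_model scale v g (length bs) d l"
  proof (intro homogeneous_model.intro homogeneous_model_axioms.intro)
    show "homogeneous_derivation scale v g (length bs) d l" by (rule homogeneous_derivation[OF gf l])
    show "d (d x) = 0" for x by (rule d_d)
    show "0 < length bs" unfolding bs_def by simp
    show "d (v 0) = 0" unfolding v_def using y(3) by simp
    show "odd (g 0)" unfolding g_def bs_def using dgb0 assms(5) by simp
    show "g i \<le> g j" if ij: "0 < i" "i \<le> j" "j < length bs" for i j
    proof -
      obtain i' j' where "i = Suc i'" "j = Suc j'" using ij(1,2) by (cases i; cases j) auto
      then show ?thesis using ij ws(3) unfolding g_def bs_def by (simp add: sorted_iff_nth_mono)
    qed
    show "2 \<le> g j" if "j < length bs" for j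
    proof (rule ccontr)
      assume "\<not> 2 \<le> g j"
      then have "V (g j) = {0}" using assms(1) unfolding one_connected_def by simp
      moreover have "bs ! j \<in> B" using that bs(1) by auto
      ultimately show False using dg B0 unfolding g_def by blast
    qed
    obtain S where S: "finite S" "quotient_basis cocycles coboundaries S"
      using assms(2) unfolding elliptic_def finite_dim_quotient_def by blast
    have "\<forall>z\<in>cocycles. \<exists>y\<in>span S. z - y \<in> coboundaries"
      using S(2) unfolding quotient_basis_def by (elim conjE)
    then have "\<forall>z. d z = 0 \<longrightarrow> (\<exists>y\<in>span S. z - y \<in> range d)"
      unfolding cocycles_def coboundaries_def by simp
    with S(1) show "\<exists>T. finite T \<and> (\<forall>z. d z = 0 \<longrightarrow> (\<exists>y\<in>span T. z - y \<in> range d))"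
      by (intro exI[of _ S] conjI)
  qed
  then interpret hm: homogeneous_model scale v g "length bs" d l .
  obtain L where L: "L \<subseteq> {z. d z = 0}" "hm.tower.indep_mod (range d) L" "length bs \<le> card L"
    by (rule hm.many_cohomology_classes)
  interpret d: Vector_Spaces.linear scale scale d by (rule d_linear)
  have "subspace (range d)" using d.subspace_image subspace_UNIV by blast
  from dim_quotient_ge[OF this _ L(1,2)] have "card L \<le> cohomology_dim"
    using assms(2) unfolding elliptic_def cohomology_dim_def cocycles_def coboundaries_def by blast
  moreover have "dim (total V) = card B" unfolding B_total using Bb(2) by (simp add: dim_eq_card_independent)
  moreover have "card B = length bs" using bs distinct_card by metis
  ultimately show ?thesis using L(3) by linarith
qed

end

theorem proposition2:
  fixes scale :: "rat \<Rightarrow> 'a::ring_1 \<Rightarrow> 'a"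
    and V :: "nat \<Rightarrow> 'a set"
    and d :: "'a \<Rightarrow> 'a"
    and l :: nat
    and k :: nat
  assumes "minimal_sullivan_model scale V d"
    and "sullivan_algebra.one_connected V"
    and "sullivan_algebra.elliptic scale V d"
    and "l \<ge> 2"
    and "d ` rat_algebra.total scale V \<subseteq> rat_algebra.wordlength_part scale V l"
    and "odd k"
    and "sullivan_algebra.hurewicz_nonzero scale V d k"
  shows "sullivan_algebra.cohomology_dim scale d
           \<ge> vector_space.dim scale (rat_algebra.total scale V)"
proof -
  interpret minimal_sullivan_model scale V d by (rule assms(1))
  show ?thesis using assms(2-) by (rule dim_total_le_cohomology_dim)
qed

end
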